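(* Let $\Gamma$ be a finite simple graph, $G=G_\Gamma$ its right-angled Artin group, $\chi\colon G\twoheadrightarrow\mathbb Z$ an epimorphism, $N=\ker(\chi)$, and $\iota\colon N\to G$ the inclusion. Suppose $H_1(N,\mathbb Q)$ has trivial $\mathbb Q\mathbb Z$-action. Then we have split exact sequences of graded Lie algebras $$0\to\operatorname{gr}(N)\xrightarrow{\operatorname{gr}(\iota)}\operatorname{gr}(G)\xrightarrow{\operatorname{gr}(\chi)}\operatorname{gr}(\mathbb Z)\to0,$$ $$0\to\operatorname{gr}(N/N'')\xrightarrow{\operatorname{gr}(\bar\iota)}\operatorname{gr}(G/G'')\xrightarrow{\operatorname{gr}(\bar\chi)}\operatorname{gr}(\mathbb Z)\to0.$$
   Context: $G_\Gamma=\langle v\in\mathsf V\mid uv=vu\text{ if }\{u,v\}\in\mathsf E\rangle$ for $\Gamma=(\mathsf V,\mathsf E)$. The group $\mathbb Z=G/N$ acts on $H_1(N,\mathbb Q)$ via conjugation in $G$; the action is trivial if every element of $\mathbb Z$ acts as the identity. For a group $G$, $\gamma_1G=G$, $\gamma_{k+1}G=(\gamma_kG,G)$ is the lower central series, and $\operatorname{gr}(G)=\bigoplus_{k\ge1}\gamma_kG/\gamma_{k+1}G$ is the associated graded Lie algebra (over $\mathbb Z$), with bracket induced by the group commutator. $G'=\gamma_2G$ and $G''=(G')'$. For a homomorphism $\alpha\colon G\to H$, $\operatorname{gr}(\alpha)\colon\operatorname{gr}(G)\to\operatorname{gr}(H)$ is the induced morphism and $\bar\alpha\colon G/G''\to H/H''$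 is the induced map on maximal metabelian quotients. *)

theory Defs
  imports "HOL-Algebra.Algebra" "HOL-Library.Poly_Mapping"
begin

section \<open>Right-angled Artin groups\<close>

definition simple_graph :: "'v set \<Rightarrow> 'v set set \<Rightarrow> bool" where
  "simple_graph V E \<longleftrightarrow> E \<subseteq> {e. e \<subseteq> V \<and> card e = 2}"

text \<open>A letter \<open>(x, True)\<close> stands for the generator \<open>x\<close>, and \<open>(x, False)\<close> for its inverse.\<close>

type_synonym 'x word = "('x \<times> bool) list"

inductive_set presentation_rel :: "'x set \<Rightarrow> ('x word \<times> 'x word) set \<Rightarrow> ('x word \<times> 'x word) set"
  for S :: "'x set" and R :: "('x word \<times> 'x word) set" where
  refl: "w \<in> lists (S \<times> UNIV) \<Longrightarrow> (w, w) \<in> presentation_rel S R"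
| sym: "(u, w) \<in> presentation_rel S R \<Longrightarrow> (w, u) \<in> presentation_rel S R"
| trans: "(u, v) \<in> presentation_rel S R \<Longrightarrow> (v, w) \<in> presentation_rel S R
    \<Longrightarrow> (u, w) \<in> presentation_rel S R"
| cancel: "p \<in> lists (S \<times> UNIV) \<Longrightarrow> q \<in> lists (S \<times> UNIV) \<Longrightarrow> x \<in> S
    \<Longrightarrow> (p @ [(x, b), (x, \<not> b)] @ q, p @ q) \<in> presentation_rel S R"
| relator: "p \<in> lists (S \<times> UNIV) \<Longrightarrow> q \<in> lists (S \<times> UNIV) \<Longrightarrow> (u, v) \<in> R
    \<Longrightarrow> u \<in> lists (S \<times> UNIV) \<Longrightarrow> v \<in> lists (S \<times> UNIV)
    \<Longrightarrow> (p @ u @ q, p @ v @ q) \<in> presentation_rel S R"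

text \<open>The group presented by the generators \<open>S\<close> and the relations \<open>u = v\<close> for \<open>(u, v) \<in> R\<close>;
  its elements are equivalence classes of words.\<close>

definition presented_group :: "'x set \<Rightarrow> ('x word \<times> 'x word) set \<Rightarrow> 'x word set monoid" where
  "presented_group S R =
    \<lparr>carrier = lists (S \<times> UNIV) // presentation_rel S R,
     monoid.mult = (\<lambda>A B. \<Union>u\<in>A. \<Union>v\<in>B. presentation_rel S R `` {u @ v}),
     one = presentation_rel S R `` {[]}\<rparr>"

definition raag :: "'v set \<Rightarrow> 'v set set \<Rightarrow> 'v word set monoid" where
  "raag V E = presented_group V
     {([(u, True), (v, True)], [(v, True), (u, True)]) | u v. {u, v} \<in> E}"


section \<open>Quotients of groups\<close>

text \<open>The map of right cosets induced by \<open>\<alpha>\<close>, into \<open>H Mod K\<close>. If \<open>\<alpha>\<close> is a homomorphism mapping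
  the denominator of the source into \<open>K\<close>, all the cosets in the union below are equal.\<close>

definition coset_map :: "('b, 'm) monoid_scheme \<Rightarrow> 'b set \<Rightarrow> ('a \<Rightarrow> 'b) \<Rightarrow> 'a set \<Rightarrow> 'b set" where
  "coset_map H K \<alpha> A = (\<Union>x\<in>A. K #>\<^bsub>H\<^esub> \<alpha> x)"

definition second_derived :: "('a, 'm) monoid_scheme \<Rightarrow> 'a set" where
  "second_derived G = derived G (derived G (carrier G))"

definition max_metabelian :: "('a, 'm) monoid_scheme \<Rightarrow> 'a set monoid" where
  "max_metabelian G = G Mod second_derived G"

definition max_metabelian_map :: "('b, 'm) monoid_scheme \<Rightarrow> ('a \<Rightarrow> 'b) \<Rightarrow> 'a set \<Rightarrow> 'b set" where
  "max_metabelian_map H \<alpha> = coset_map H (second_derived H) \<alpha>"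


section \<open>Rational group homology\<close>

text \<open>\<open>H\<^sub>n(G, \<rat>)\<close> is the homology of the inhomogeneous bar complex with trivial coefficients \<open>\<rat>\<close>:
  the basis element \<open>[g\<^sub>1|\<dots>|g\<^sub>n]\<close> is the list of the \<open>g\<^sub>i\<close>, and
  \<open>\<partial>[g\<^sub>1|\<dots>|g\<^sub>n] = [g\<^sub>2|\<dots>|g\<^sub>n] + (\<Sum>i=1..n-1. (-1)^i [g\<^sub>1|\<dots>|g\<^sub>i g\<^sub>i\<^sub>+\<^sub>1|\<dots>|g\<^sub>n]) + (-1)^n [g\<^sub>1|\<dots>|g\<^sub>n\<^sub>-\<^sub>1]\<close>.\<close>

definition bar_chains :: "('a, 'm) monoid_scheme \<Rightarrow> nat \<Rightarrow> ('a list \<Rightarrow>\<^sub>0 rat) set" where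
  "bar_chains G n = {c. \<forall>w\<in>Poly_Mapping.keys c. length w = n \<and> set w \<subseteq> carrier G}"

definition bar_face :: "('a, 'm) monoid_scheme \<Rightarrow> nat \<Rightarrow> 'a list \<Rightarrow> 'a list" where
  "bar_face G i w =
    (if i = 0 then tl w
     else if i = length w then butlast w
     else take (i - 1) w @ [(w ! (i - 1)) \<otimes>\<^bsub>G\<^esub> (w ! i)] @ drop (i + 1) w)"

definition bar_boundary :: "('a, 'm) monoid_scheme \<Rightarrow> ('a list \<Rightarrow>\<^sub>0 rat) \<Rightarrow> ('a list \<Rightarrow>\<^sub>0 rat)" where
  "bar_boundary G c = (\<Sum>w\<in>Poly_Mapping.keys c.
     if w = [] then 0
     else \<Sum>i\<le>length w. Poly_Mapping.single (bar_face G i w) ((-1) ^ i * Poly_Mapping.lookup c w))"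

definition bar_cycles :: "('a, 'm) monoid_scheme \<Rightarrow> nat \<Rightarrow> ('a list \<Rightarrow>\<^sub>0 rat) monoid" where
  "bar_cycles G n =
    \<lparr>carrier = {c \<in> bar_chains G n. bar_boundary G c = 0}, monoid.mult = (+), one = 0\<rparr>"

definition bar_boundaries :: "('a, 'm) monoid_scheme \<Rightarrow> nat \<Rightarrow> ('a list \<Rightarrow>\<^sub>0 rat) set" where
  "bar_boundaries G n = bar_boundary G ` bar_chains G (Suc n)"

definition rat_homology :: "('a, 'm) monoid_scheme \<Rightarrow> nat \<Rightarrow> ('a list \<Rightarrow>\<^sub>0 rat) set monoid" where
  "rat_homology G n = bar_cycles G n Mod bar_boundaries G n"

definition bar_map :: "('a \<Rightarrow> 'b) \<Rightarrow> ('a list \<Rightarrow>\<^sub>0 rat) \<Rightarrow> ('b list \<Rightarrow>\<^sub>0 rat)" where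
  "bar_map f c = (\<Sum>w\<in>Poly_Mapping.keys c.
     Poly_Mapping.single (map f w) (Poly_Mapping.lookup c w))"

definition rat_homology_map :: "('b, 'm) monoid_scheme \<Rightarrow> nat \<Rightarrow> ('a \<Rightarrow> 'b)
    \<Rightarrow> ('a list \<Rightarrow>\<^sub>0 rat) set \<Rightarrow> ('b list \<Rightarrow>\<^sub>0 rat) set" where
  "rat_homology_map H n f = coset_map (bar_cycles H n) (bar_boundaries H n) (bar_map f)"

text \<open>For a normal subgroup \<open>N\<close> of \<open>G\<close>, the class of \<open>g\<close> in \<open>G/N\<close> acts on \<open>H\<^sub>1(N, \<rat>)\<close> by the map
  induced by \<open>x \<mapsto> g x g\<^sup>-\<^sup>1\<close>; this depends only on the class, as \<open>N\<close> acts trivially on its own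
  homology.\<close>

definition trivial_H1_action :: "('a, 'm) monoid_scheme \<Rightarrow> 'a set \<Rightarrow> bool" where
  "trivial_H1_action G N \<longleftrightarrow>
    (\<forall>g\<in>carrier G. \<forall>A\<in>carrier (rat_homology (G\<lparr>carrier := N\<rparr>) 1).
       rat_homology_map (G\<lparr>carrier := N\<rparr>) 1 (\<lambda>x. g \<otimes>\<^bsub>G\<^esub> x \<otimes>\<^bsub>G\<^esub> inv\<^bsub>G\<^esub> g) A = A)"


section \<open>Graded Lie algebras over the integers\<close>

text \<open>The additive group of a graded Lie algebra is written multiplicatively, as is customary for
  commutative groups in HOL-Algebra. Degrees are positive; \<open>piece L 0\<close> is irrelevant.\<close>

record 'a graded_lie = "'a monoid" +
  bracket :: "'a \<Rightarrow> 'a \<Rightarrow> 'a"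
  piece :: "nat \<Rightarrow> 'a set"

locale graded_lie_algebra = comm_group L for L :: "('a, 'm) graded_lie_scheme" (structure) +
  assumes bracket_closed:
      "\<lbrakk>x \<in> carrier L; y \<in> carrier L\<rbrakk> \<Longrightarrow> bracket L x y \<in> carrier L"
    and bracket_add_left:
      "\<lbrakk>x \<in> carrier L; y \<in> carrier L; z \<in> carrier L\<rbrakk>
        \<Longrightarrow> bracket L (x \<otimes> y) z = bracket L x z \<otimes> bracket L y z"
    and bracket_add_right:
      "\<lbrakk>x \<in> carrier L; y \<in> carrier L; z \<in> carrier L\<rbrakk>
        \<Longrightarrow> bracket L x (y \<otimes> z) = bracket L x y \<otimes> bracket L x z"
    and bracket_self: "x \<in> carrier L \<Longrightarrow> bracket L x x = \<one>"
    and jacobi: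
      "\<lbrakk>x \<in> carrier L; y \<in> carrier L; z \<in> carrier L\<rbrakk>
        \<Longrightarrow> bracket L x (bracket L y z) \<otimes> bracket L y (bracket L z x)
              \<otimes> bracket L z (bracket L x y) = \<one>"
    and piece_subgroup: "k \<ge> 1 \<Longrightarrow> subgroup (piece L k) L"
    and direct_sum:
      "bij_betw (\<lambda>x. finprod L x {k \<in> {1..}. x k \<noteq> \<one>})
         (carrier (sum_group {1..} (\<lambda>k. L\<lparr>carrier := piece L k\<rparr>))) (carrier L)"
    and bracket_piece:
      "\<lbrakk>i \<ge> 1; j \<ge> 1; x \<in> piece L i; y \<in> piece L j\<rbrakk> \<Longrightarrow> bracket L x y \<in> piece L (i + j)"

definition graded_lie_hom ::
    "('a, 'm) graded_lie_scheme \<Rightarrow> ('b, 'n) graded_lie_scheme \<Rightarrow> ('a \<Rightarrow> 'b) set" where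
  "graded_lie_hom L M =
    {f \<in> hom L M. (\<forall>x\<in>carrier L. \<forall>y\<in>carrier L. f (bracket L x y) = bracket M (f x) (f y)) \<and>
                  (\<forall>k\<ge>1. f ` piece L k \<subseteq> piece M k)}"

text \<open>\<open>0 \<rightarrow> A \<rightarrow> B \<rightarrow> C \<rightarrow> 0\<close>, with maps \<open>f\<close> and \<open>g\<close>, is an exact sequence of graded Lie algebras and
  splits by a morphism of graded Lie algebras \<open>C \<rightarrow> B\<close>.\<close>

definition split_exact_graded_lie ::
    "('a, 'm) graded_lie_scheme \<Rightarrow> ('a \<Rightarrow> 'b) \<Rightarrow> ('b, 'n) graded_lie_scheme \<Rightarrow> ('b \<Rightarrow> 'c)
      \<Rightarrow> ('c, 'o) graded_lie_scheme \<Rightarrow> bool" where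
  "split_exact_graded_lie A f B g C \<longleftrightarrow>
    graded_lie_algebra A \<and> graded_lie_algebra B \<and> graded_lie_algebra C \<and>
    f \<in> graded_lie_hom A B \<and> g \<in> graded_lie_hom B C \<and>
    inj_on f (carrier A) \<and> f ` carrier A = kernel B C g \<and> g ` carrier B = carrier C \<and>
    (\<exists>s\<in>graded_lie_hom C B. \<forall>z\<in>carrier C. g (s z) = z)"


section \<open>The associated graded Lie algebra of a group\<close>

definition group_commutator :: "('a, 'm) monoid_scheme \<Rightarrow> 'a \<Rightarrow> 'a \<Rightarrow> 'a" where
  "group_commutator G x y = x \<otimes>\<^bsub>G\<^esub> y \<otimes>\<^bsub>G\<^esub> inv\<^bsub>G\<^esub> x \<otimes>\<^bsub>G\<^esub> inv\<^bsub>G\<^esub> y"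

definition commutator_subgroup :: "('a, 'm) monoid_scheme \<Rightarrow> 'a set \<Rightarrow> 'a set \<Rightarrow> 'a set" where
  "commutator_subgroup G H K = generate G {group_commutator G h k | h k. h \<in> H \<and> k \<in> K}"

text \<open>Indexed as \<open>\<gamma>\<^sub>1 G = G\<close>, \<open>\<gamma>\<^sub>2 G = (G, G)\<close>, and so on; the index \<open>0\<close> is not used.\<close>

definition lower_central :: "('a, 'm) monoid_scheme \<Rightarrow> nat \<Rightarrow> 'a set" where
  "lower_central G k = ((\<lambda>H. commutator_subgroup G H (carrier G)) ^^ (k - 1)) (carrier G)"

definition gr_piece :: "('a, 'm) monoid_scheme \<Rightarrow> nat \<Rightarrow> 'a set monoid" where
  "gr_piece G k = G\<lparr>carrier := lower_central G k\<rparr> Mod lower_central G (k + 1)"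

text \<open>The bracket of the classes of \<open>a\<close> in degree \<open>i\<close> and \<open>b\<close> in degree \<open>j\<close> is the class of \<open>(a, b)\<close>
  in degree \<open>i + j\<close>. It does not depend on the representatives, so the cosets in the union agree.\<close>

definition gr_piece_bracket ::
    "('a, 'm) monoid_scheme \<Rightarrow> nat \<Rightarrow> nat \<Rightarrow> 'a set \<Rightarrow> 'a set \<Rightarrow> 'a set" where
  "gr_piece_bracket G i j A B =
    (\<Union>a\<in>A. \<Union>b\<in>B. lower_central G (i + j + 1) #>\<^bsub>G\<^esub> group_commutator G a b)"

definition gr :: "('a, 'm) monoid_scheme \<Rightarrow> (nat \<Rightarrow> 'a set) graded_lie" where
  "gr G =
    \<lparr>carrier = carrier (sum_group {1..} (gr_piece G)),
     monoid.mult = monoid.mult (sum_group {1..} (gr_piece G)),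
     one = one (sum_group {1..} (gr_piece G)),
     bracket = (\<lambda>x y. \<lambda>k\<in>{1..}.
       finprod (gr_piece G k) (\<lambda>i. gr_piece_bracket G i (k - i) (x i) (y (k - i))) {1..<k}),
     piece = (\<lambda>k. {x \<in> carrier (sum_group {1..} (gr_piece G)).
       \<forall>j\<ge>1. j \<noteq> k \<longrightarrow> x j = \<one>\<^bsub>gr_piece G j\<^esub>})\<rparr>"

definition gr_map :: "('b, 'm) monoid_scheme \<Rightarrow> ('a \<Rightarrow> 'b)
    \<Rightarrow> (nat \<Rightarrow> 'a set) \<Rightarrow> (nat \<Rightarrow> 'b set)" where
  "gr_map H \<alpha> x = (\<lambda>k\<in>{1..}. coset_map H (lower_central H (k + 1)) \<alpha> (x k))"

end

theory Submission
  imports Defs "HOL-Computational_Algebra.Polynomial"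
begin

text \<open>Let \<open>G\<close> be the right-angled Artin group, \<open>N\<close> the kernel of \<open>\<chi>\<close>, and \<open>t\<close> an element with
  \<open>\<chi> t = 1\<close>. Everything rests on the equality \<open>G' = N'\<close> of derived subgroups
  (\<open>raag_derived_eq_derived_kernel\<close>).

  Suppose that \<open>G' = N'\<close>. Then \<open>G\<close> acts trivially on \<open>N/N'\<close>, and therefore, by the three subgroups
  argument, on all of \<open>gr N\<close>, which is generated in degree 1. It follows that \<open>\<gamma>\<^sub>k N = \<gamma>\<^sub>k G\<close> for
  \<open>k \<ge> 2\<close>. So \<open>gr N\<close> and \<open>gr G\<close> have the same pieces in degrees at least 2, and in degree 1 the group
  \<open>N/G'\<close> is the kernel of \<open>G/G' \<rightarrow> \<int>\<close>: the graded Lie algebra \<open>gr N\<close> is a subalgebra of \<open>gr G\<close>, namely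
  the kernel of \<open>gr \<chi>\<close>. The homomorphism \<open>n \<mapsto> t\<^sup>n\<close> splits \<open>\<chi>\<close>, and by functoriality its associated
  graded map splits \<open>gr \<chi>\<close> (\<open>split_exact_gr\<close>). The equality \<open>G' = N'\<close> also gives \<open>G'' = N''\<close> and passes
  to \<open>G/G''\<close> and its subgroup \<open>N/N''\<close>, to which the same argument applies
  (\<open>split_exact_gr_max_metabelian\<close>).

  To prove \<open>G' = N'\<close>, view the abelian group \<open>N/N'\<close> as a module over \<open>\<int>[X]\<close>, where \<open>X\<close> acts as
  conjugation by \<open>t\<close>. It has to be shown that the commutators \<open>w u v\<close> of vertex generators vanish in
  it. After inverting some generators, all degrees \<open>n v = \<chi> v\<close> are nonnegative. With
  \<open>[n] = 1 + X + \<dots> + X\<^sup>n\<^sup>-\<^sup>1\<close> there is the relation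
  \<open>[n u] w v y = [n v] w u y + [n y] w v u\<close>, and \<open>w u v = 0\<close> if \<open>u\<close> and \<open>v\<close> are adjacent. If some
  \<open>w u v\<close> is not zero, localize at a prime ideal \<open>I\<close> that contains its annihilator. The \<open>n\<close> with
  \<open>[n] \<in> I\<close> are the multiples of a number \<open>m \<noteq> 1\<close>, so that \<open>[n v]\<close> becomes invertible exactly for the
  vertices \<open>v\<close> of degree not divisible by \<open>m\<close>. If these vertices span a connected subgraph and every
  other vertex is adjacent to one of them, then the relations, used along the edges, kill all
  commutators in the localization, which is a contradiction (\<open>generators_commute\<close>).

  These properties of the graph for every \<open>m \<noteq> 1\<close> are what the hypothesis on \<open>H\<^sub>1(N, \<rat>)\<close> provides.
  Choose a complex number \<open>\<zeta>\<close> with \<open>\<zeta>\<^sup>k = 1\<close> exactly for the multiples \<open>k\<close> of \<open>m\<close>, and let \<open>D\<close> be a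
  crossed homomorphism \<open>G \<rightarrow> \<complex>\<close>, where \<open>g\<close> acts as multiplication by \<open>\<zeta>\<close> to the power \<open>\<chi> g\<close>. On \<open>N\<close> it is
  additive, and conjugation by \<open>t\<close> multiplies it by \<open>\<zeta> \<noteq> 1\<close>; as \<open>t\<close> acts trivially on \<open>H\<^sub>1(N, \<rat>)\<close>, it
  vanishes on \<open>N\<close>, in particular on commutators. But if the subgraph is disconnected, or if
  a vertex is not dominated by it, there is a crossed homomorphism that is nonzero on a commutator
  (\<open>support_connected\<close>, \<open>support_dominating\<close>). Rational homology suffices for this integral conclusion
  because the complex numbers \<open>\<zeta>\<close> realize every \<open>m\<close>, including those that come from prime ideals of
  positive characteristic.\<close>

section \<open>Commutator calculus\<close>

context group
begin

lemma cancel_inv_left [simp]: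
  "\<lbrakk>x \<in> carrier G; y \<in> carrier G\<rbrakk> \<Longrightarrow> inv x \<otimes> (x \<otimes> y) = y"
  "\<lbrakk>x \<in> carrier G; y \<in> carrier G\<rbrakk> \<Longrightarrow> x \<otimes> (inv x \<otimes> y) = y"
  by (simp_all add: m_assoc [symmetric])

text \<open>Together with the cancellation rules, these equations reduce every expression to a freely reduced
  word, so that the simplifier decides identities that hold in free groups.\<close>

lemmas word_simps = m_assoc inv_mult_group

lemma commutator_closed [simp]:
  "\<lbrakk>x \<in> carrier G; y \<in> carrier G\<rbrakk> \<Longrightarrow> group_commutator G x y \<in> carrier G"
  by (simp add: group_commutator_def)

lemma commutator_mult_left:
  "\<lbrakk>x \<in> carrier G; y \<in> carrier G; z \<in> carrier G\<rbrakk> \<Longrightarrow>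
    group_commutator G (x \<otimes> y) z =
      group_commutator G x (group_commutator G y z) \<otimes> group_commutator G y z \<otimes> group_commutator G x z"
  by (simp add: group_commutator_def word_simps)

lemma inv_commutator:
  "\<lbrakk>x \<in> carrier G; y \<in> carrier G\<rbrakk> \<Longrightarrow> inv (group_commutator G x y) = group_commutator G y x"
  by (simp add: group_commutator_def word_simps)

lemma commutator_self: "x \<in> carrier G \<Longrightarrow> group_commutator G x x = \<one>"
  by (simp add: group_commutator_def word_simps)

lemma commutator_one:
  "x \<in> carrier G \<Longrightarrow> group_commutator G x \<one> = \<one>"
  "x \<in> carrier G \<Longrightarrow> group_commutator G \<one> x = \<one>"
  by (simp_all add: group_commutator_def)

lemma conjugate_eq_commutator_mult:
  "\<lbrakk>x \<in> carrier G; y \<in> carrier G\<rbrakk> \<Longrightarrow> x \<otimes> y \<otimes> inv x = group_commutator G x y \<otimes> y"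
  by (simp add: group_commutator_def word_simps)

text \<open>This is the source of the Jacobi identity and of the inclusions between the terms of the lower
  central series: if two of the three factors lie in a normal subgroup, then so does the third.\<close>

lemma Hall_Witt:
  assumes "x \<in> carrier G" "y \<in> carrier G" "z \<in> carrier G"
  shows "group_commutator G (group_commutator G x y) (y \<otimes> z \<otimes> inv y)
    \<otimes> group_commutator G (group_commutator G y z) (z \<otimes> x \<otimes> inv z)
    \<otimes> group_commutator G (group_commutator G z x) (x \<otimes> y \<otimes> inv x) = \<one>"
  using assms by (simp add: group_commutator_def word_simps)

lemma normal_conjugate:
  assumes "M \<lhd> G" "x \<in> M" "g \<in> carrier G" shows "g \<otimes> x \<otimes> inv g \<in> M"
  by (rule normal.inv_op_closed2[OF assms(1,3,2)])

lemma commutator_normal: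
  assumes "M \<lhd> G" "x \<in> M" "g \<in> carrier G" shows "group_commutator G x g \<in> M" "group_commutator G g x \<in> M"
proof -
  interpret M: normal M G by fact
  have "x \<otimes> (g \<otimes> inv x \<otimes> inv g) \<in> M" "(g \<otimes> x \<otimes> inv g) \<otimes> inv x \<in> M"
    using assms by (simp_all add: normal_conjugate)
  with assms show "group_commutator G x g \<in> M" "group_commutator G g x \<in> M"
    by (simp_all add: group_commutator_def m_assoc M.mem_carrier)
qed

lemma commutator_subgroup_incl:
  assumes "H \<subseteq> carrier G" "K \<subseteq> carrier G" "subgroup M G"
    and "\<And>h k. h \<in> H \<Longrightarrow> k \<in> K \<Longrightarrow> group_commutator G h k \<in> M"
  shows "commutator_subgroup G H K \<subseteq> M"
  unfolding commutator_subgroup_def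
  by (rule generate_subgroup_incl) (use assms in auto)

lemma commutator_in_commutator_subgroup:
  "h \<in> H \<Longrightarrow> k \<in> K \<Longrightarrow> group_commutator G h k \<in> commutator_subgroup G H K"
  unfolding commutator_subgroup_def by (rule generate.incl) auto

lemma commutator_subgroup_normal:
  assumes "H \<lhd> G" shows "commutator_subgroup G H (carrier G) \<lhd> G"
  unfolding commutator_subgroup_def
proof (rule normal_generateI)
  interpret H: normal H G by fact
  show "{group_commutator G h k |h k. h \<in> H \<and> k \<in> carrier G} \<subseteq> carrier G"
    using H.subset by auto
  fix h g assume "h \<in> {group_commutator G h k |h k. h \<in> H \<and> k \<in> carrier G}" and g: "g \<in> carrier G"
  then obtain x y where x: "x \<in> H" and y: "y \<in> carrier G" and h: "h = group_commutator G x y" by auto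
  have "g \<otimes> h \<otimes> inv g = group_commutator G (g \<otimes> x \<otimes> inv g) (g \<otimes> y \<otimes> inv g)"
    unfolding h group_commutator_def using x y g by (simp add: word_simps H.mem_carrier)
  moreover have "g \<otimes> x \<otimes> inv g \<in> H" using assms x g by (rule normal_conjugate)
  ultimately show "g \<otimes> h \<otimes> inv g \<in> {group_commutator G h k |h k. h \<in> H \<and> k \<in> carrier G}"
    using g y by blast
qed

section \<open>The lower central series\<close>

lemma lower_central_1 [simp]: "lower_central G (Suc 0) = carrier G"
  by (simp add: lower_central_def)

lemma lower_central_Suc:
  "k \<ge> 1 \<Longrightarrow> lower_central G (Suc k) = commutator_subgroup G (lower_central G k) (carrier G)"
  by (cases k) (auto simp: lower_central_def)

lemma lower_central_normal: "k \<ge> 1 \<Longrightarrow> lower_central G k \<lhd> G"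
  by (induction k rule: nat_induct_at_least)
     (simp_all add: lower_central_Suc normal_self commutator_subgroup_normal)

lemma lower_central_subgroup: "k \<ge> 1 \<Longrightarrow> subgroup (lower_central G k) G"
  using lower_central_normal normal_imp_subgroup by blast

lemma lower_central_carrier: "k \<ge> 1 \<Longrightarrow> x \<in> lower_central G k \<Longrightarrow> x \<in> carrier G"
  using lower_central_subgroup subgroup.mem_carrier by metis

lemma lower_central_Suc_subset: "k \<ge> 1 \<Longrightarrow> lower_central G (Suc k) \<subseteq> lower_central G k"
  unfolding lower_central_Suc
  by (rule commutator_subgroup_incl)
     (auto intro: commutator_normal(1)[OF lower_central_normal] lower_central_carrier lower_central_subgroup)

lemma lower_central_antimono:
  assumes "1 \<le> k" "k \<le> l" shows "lower_central G l \<subseteq> lower_central G k"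
  using assms(2,1)
proof (induction rule: dec_induct)
  case (step n) then show ?case using lower_central_Suc_subset[of n] by force
qed auto

lemma commutator_in_lower_central_Suc:
  "k \<ge> 1 \<Longrightarrow> x \<in> lower_central G k \<Longrightarrow> g \<in> carrier G
    \<Longrightarrow> group_commutator G x g \<in> lower_central G (Suc k)"
  by (simp add: lower_central_Suc commutator_in_commutator_subgroup)

text \<open>By this lemma it suffices to check on generators that all commutators with \<open>S\<close> lie in \<open>M\<close>.\<close>

lemma subgroup_centralizing_modulo:
  assumes M: "M \<lhd> G" and S: "S \<subseteq> carrier G"
  shows "subgroup {z \<in> carrier G. \<forall>x\<in>S. group_commutator G z x \<in> M} G" (is "subgroup ?C G")
proof (rule subgroupI)
  interpret M: normal M G by fact
  have "\<one> \<in> ?C" using S by (simp add: commutator_one subsetD)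
  then show "?C \<noteq> {}" by blast
  fix a assume a: "a \<in> ?C"
  have "group_commutator G (inv a) x \<in> M" if x: "x \<in> S" for x
  proof -
    have "group_commutator G (inv a) x = inv a \<otimes> inv (group_commutator G a x) \<otimes> inv (inv a)"
      using a x S by (auto simp: group_commutator_def word_simps subsetD)
    also have "\<dots> \<in> M" using a x by (intro normal_conjugate[OF M]) auto
    finally show ?thesis .
  qed
  with a show "inv a \<in> ?C" by auto
  fix b assume b: "b \<in> ?C"
  have "group_commutator G (a \<otimes> b) x \<in> M" if x: "x \<in> S" for x
  proof -
    have "group_commutator G a (group_commutator G b x) \<in> M"
      using a b x by (auto intro: commutator_normal(2)[OF M])
    moreover have "group_commutator G b x \<in> M" "group_commutator G a x \<in> M" using a b x by auto
    ultimately have "group_commutator G a (group_commutator G b x)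
        \<otimes> group_commutator G b x \<otimes> group_commutator G a x \<in> M"
      by (intro subgroup.m_closed[OF M.subgroup_axioms])
    then show ?thesis using a b x S by (simp add: commutator_mult_left subsetD)
  qed
  with a b show "a \<otimes> b \<in> ?C" by auto
qed auto

text \<open>The three subgroups argument, by induction on \<open>j\<close>: for a generator \<open>(y, g)\<close> of the next term, the
  Hall-Witt identity expresses its commutator with \<open>x\<close> through \<open>((g, x), y)\<close> and \<open>((x, y), g)\<close>, up to
  conjugations; the induction hypothesis bounds \<open>((g, x), y)\<close> and \<open>(x, y)\<close>.\<close>

lemma commutator_lower_central:
  assumes "i \<ge> 1" "j \<ge> 1" "x \<in> lower_central G i" "y \<in> lower_central G j"
  shows "group_commutator G x y \<in> lower_central G (i + j)"
  using assms(2,1,3,4)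
proof (induction j arbitrary: i x y rule: nat_induct_at_least)
  case base
  then show ?case using commutator_in_lower_central_Suc by simp
next
  case (Suc j)
  let ?M = "lower_central G (i + Suc j)"
  have M: "?M \<lhd> G" using Suc.prems by (intro lower_central_normal) auto
  interpret M: normal ?M G by (rule M)
  let ?C = "{z \<in> carrier G. \<forall>x\<in>lower_central G i. group_commutator G z x \<in> ?M}"
  have i: "lower_central G i \<subseteq> carrier G" using lower_central_carrier Suc.prems(1) by auto
  have "lower_central G (Suc j) \<subseteq> ?C"
    unfolding lower_central_Suc[OF Suc.hyps(1)]
  proof (rule commutator_subgroup_incl)
    show "subgroup ?C G" by (rule subgroup_centralizing_modulo[OF M i])
    show "lower_central G j \<subseteq> carrier G" using lower_central_carrier Suc.hyps by auto
    fix y g assume y: "y \<in> lower_central G j" and g: "g \<in> carrier G"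
    have yc: "y \<in> carrier G" using y lower_central_carrier Suc.hyps by auto
    have "group_commutator G (group_commutator G y g) x \<in> ?M" if x: "x \<in> lower_central G i" for x
    proof -
      have xc: "x \<in> carrier G" using x i by auto
      \<comment> \<open>chosen such that the conjugate by \<open>g\<close> in the Hall-Witt identity is \<open>x\<close> itself\<close>
      define x' where "x' = inv g \<otimes> x \<otimes> g"
      have x': "x' \<in> lower_central G i" unfolding x'_def
        using normal_conjugate[OF lower_central_normal[OF Suc.prems(1)] x, of "inv g"] g by simp
      have x'c: "x' \<in> carrier G" using x' i by auto
      have gx: "g \<otimes> x' \<otimes> inv g = x" using g xc by (simp add: x'_def word_simps)
      let ?b = "group_commutator G (group_commutator G g x') (x' \<otimes> y \<otimes> inv x')"
      let ?c = "group_commutator G (group_commutator G x' y) (y \<otimes> g \<otimes> inv y)"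
      have "group_commutator G g x' \<in> lower_central G (Suc i)"
        using commutator_in_lower_central_Suc[OF Suc.prems(1) x' g] lower_central_subgroup[of "Suc i"]
          inv_commutator[OF x'c g] subgroup.m_inv_closed by fastforce
      moreover have "x' \<otimes> y \<otimes> inv x' \<in> lower_central G j"
        using lower_central_normal[OF Suc.hyps(1)] y x'c by (rule normal_conjugate)
      ultimately have b: "?b \<in> ?M" using Suc.IH[of "Suc i"] by simp
      have c: "?c \<in> ?M"
        using commutator_in_lower_central_Suc[OF _ Suc.IH[OF Suc.prems(1) x' y], of "y \<otimes> g \<otimes> inv y"]
          Suc.prems(1) g yc by simp
      have "group_commutator G (group_commutator G y g) x \<otimes> ?b \<otimes> ?c = \<one>"
        using Hall_Witt[OF yc g x'c] unfolding gx .
      then have "group_commutator G (group_commutator G y g) x = inv (?b \<otimes> ?c)"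
        using g yc xc x'c by (intro inv_equality[symmetric]) (auto simp: m_assoc)
      moreover have "inv (?b \<otimes> ?c) \<in> ?M"
        by (intro subgroup.m_inv_closed[OF M.subgroup_axioms] subgroup.m_closed[OF M.subgroup_axioms] b c)
      ultimately show ?thesis by simp
    qed
    then show "group_commutator G y g \<in> ?C" using g yc by auto
  qed auto
  then have "group_commutator G y x \<in> ?M" using Suc.prems by auto
  then have "inv (group_commutator G y x) \<in> ?M" by blast
  then show ?case using Suc.prems i lower_central_carrier[of "Suc j" y] by (subst (asm) inv_commutator) auto
qed

end

section \<open>Homogeneous pieces of the associated graded Lie algebra\<close>

definition gr_class :: "('a, 'm) monoid_scheme \<Rightarrow> nat \<Rightarrow> 'a \<Rightarrow> 'a set" where
  "gr_class G k x = lower_central G (Suc k) #>\<^bsub>G\<^esub> x"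

context group
begin

lemma r_coset_eq_iff:
  assumes M: "subgroup M G" and "x \<in> carrier G" "y \<in> carrier G"
  shows "M #> x = M #> y \<longleftrightarrow> x \<otimes> inv y \<in> M"
proof
  interpret M: subgroup M G by fact
  assume "M #> x = M #> y"
  then have "x \<in> M #> y" using assms rcos_self by blast
  then show "x \<otimes> inv y \<in> M" using assms M.rcos_module by blast
next
  interpret M: subgroup M G by fact
  assume "x \<otimes> inv y \<in> M"
  then have "x \<in> M #> y" using assms M.rcos_module by blast
  then show "M #> x = M #> y" using assms repr_independence by metis
qed

lemma gr_class_eq_iff:
  "\<lbrakk>x \<in> carrier G; y \<in> carrier G\<rbrakk>
    \<Longrightarrow> gr_class G k x = gr_class G k y \<longleftrightarrow> x \<otimes> inv y \<in> lower_central G (Suc k)"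
  unfolding gr_class_def by (rule r_coset_eq_iff) (auto intro: lower_central_subgroup)

lemma in_gr_class: "x \<in> carrier G \<Longrightarrow> x \<in> gr_class G k x"
  unfolding gr_class_def by (intro rcos_self lower_central_subgroup) auto

lemma gr_class_subset: "k \<ge> 1 \<Longrightarrow> x \<in> lower_central G k \<Longrightarrow> gr_class G k x \<subseteq> lower_central G k"
  using lower_central_Suc_subset[of k] subgroup.m_closed[OF lower_central_subgroup[of k]]
  by (auto simp: gr_class_def r_coset_def)

lemma carrier_gr_piece: "carrier (gr_piece G k) = gr_class G k ` lower_central G k"
  by (auto simp: gr_piece_def FactGroup_def RCOSETS_def r_coset_def gr_class_def)

lemma one_gr_piece: "\<one>\<^bsub>gr_piece G k\<^esub> = gr_class G k \<one>"
  using coset_mult_one[of "lower_central G (Suc k)"] lower_central_carrier[of "Suc k"]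
  by (auto simp: gr_piece_def FactGroup_def gr_class_def subset_iff)

lemma gr_class_eq_one:
  "x \<in> carrier G \<Longrightarrow> gr_class G k x = \<one>\<^bsub>gr_piece G k\<^esub> \<longleftrightarrow> x \<in> lower_central G (Suc k)"
  by (simp add: one_gr_piece gr_class_eq_iff)

lemma gr_class_mult:
  "\<lbrakk>x \<in> carrier G; y \<in> carrier G\<rbrakk>
    \<Longrightarrow> gr_class G k x \<otimes>\<^bsub>gr_piece G k\<^esub> gr_class G k y = gr_class G k (x \<otimes> y)"
  using normal.rcos_sum[OF lower_central_normal[of "Suc k"], of x y]
  by (simp add: gr_piece_def FactGroup_def gr_class_def set_mult_def)

lemma gr_piece_comm_group:
  assumes "k \<ge> 1" shows "comm_group (gr_piece G k)"
proof -
  have *: "subgroup (lower_central G k) G" "lower_central G (Suc k) \<lhd> G"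
      "lower_central G (Suc k) \<subseteq> lower_central G k"
    using assms by (auto intro: lower_central_subgroup lower_central_normal
        lower_central_Suc_subset[THEN subsetD])
  then have "lower_central G (Suc k) \<lhd> G\<lparr>carrier := lower_central G k\<rparr>"
    by (intro normal_restrict_supergroup) auto
  then have "group (gr_piece G k)"
    unfolding gr_piece_def by (simp add: normal.factorgroup_is_group)
  then show ?thesis
  proof (rule group.group_comm_groupI)
    fix A B assume "A \<in> carrier (gr_piece G k)" "B \<in> carrier (gr_piece G k)"
    then obtain a b where a: "a \<in> lower_central G k" "A = gr_class G k a"
      and b: "b \<in> lower_central G k" "B = gr_class G k b"
      by (auto simp: carrier_gr_piece)
    note ab = a(1)[THEN lower_central_carrier[OF assms]] b(1)[THEN lower_central_carrier[OF assms]]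
    have "a \<otimes> b \<otimes> inv (b \<otimes> a) = group_commutator G a b"
      using ab by (simp add: group_commutator_def word_simps)
    then show "A \<otimes>\<^bsub>gr_piece G k\<^esub> B = B \<otimes>\<^bsub>gr_piece G k\<^esub> A"
      using a b ab commutator_in_lower_central_Suc[OF assms a(1) ab(2)]
      by (simp add: gr_class_mult gr_class_eq_iff)
  qed
qed

text \<open>The group identity for \<open>(a a', b)\<close> has the extra factor \<open>(a, (a', b))\<close>, which vanishes here because it
  has degree \<open>2 i + j > i + j\<close>.\<close>

lemma gr_class_commutator_mult_left:
  assumes "i \<ge> 1" "j \<ge> 1" "a \<in> lower_central G i" "a' \<in> lower_central G i" "b \<in> lower_central G j"
  shows "gr_class G (i + j) (group_commutator G (a \<otimes> a') b) =
    gr_class G (i + j) (group_commutator G a b) \<otimes>\<^bsub>gr_piece G (i + j)\<^esub>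
      gr_class G (i + j) (group_commutator G a' b)"
proof -
  interpret P: comm_group "gr_piece G (i + j)" using assms by (intro gr_piece_comm_group) auto
  have c: "a \<in> carrier G" "a' \<in> carrier G" "b \<in> carrier G"
    using assms lower_central_carrier by blast+
  have d: "group_commutator G a b \<in> lower_central G (i + j)" "group_commutator G a' b \<in> lower_central G (i + j)"
    using assms by (auto intro: commutator_lower_central)
  have "group_commutator G a (group_commutator G a' b) \<in> lower_central G (i + (i + j))"
    using assms d by (intro commutator_lower_central) auto
  then have "group_commutator G a (group_commutator G a' b) \<in> lower_central G (Suc (i + j))"
    using lower_central_antimono[of "Suc (i + j)" "i + (i + j)"] assms by auto
  then have "gr_class G (i + j) (group_commutator G a (group_commutator G a' b)) = \<one>\<^bsub>gr_piece G (i + j)\<^esub>"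
    using c by (simp add: gr_class_eq_one)
  moreover have "gr_class G (i + j) (group_commutator G a b) \<in> carrier (gr_piece G (i + j))"
      "gr_class G (i + j) (group_commutator G a' b) \<in> carrier (gr_piece G (i + j))"
    using d by (auto simp: carrier_gr_piece)
  ultimately show ?thesis
    using c by (simp add: commutator_mult_left gr_class_mult [symmetric] P.m_comm)
qed

lemma gr_class_inv_commutator:
  assumes "i \<ge> 1" "j \<ge> 1" "a \<in> lower_central G i" "b \<in> lower_central G j"
  shows "gr_class G (i + j) (group_commutator G b a) =
    inv\<^bsub>gr_piece G (i + j)\<^esub> gr_class G (i + j) (group_commutator G a b)"
proof -
  interpret P: comm_group "gr_piece G (i + j)" using assms by (intro gr_piece_comm_group) auto
  have c: "a \<in> carrier G" "b \<in> carrier G"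
    using assms lower_central_carrier by blast+
  have d: "group_commutator G a b \<in> lower_central G (i + j)" "group_commutator G b a \<in> lower_central G (i + j)"
    using assms commutator_lower_central[of j i b a] by (auto intro: commutator_lower_central simp: add.commute)
  have "group_commutator G b a \<otimes> group_commutator G a b = \<one>"
    using c inv_commutator[OF c] by (metis commutator_closed l_inv)
  then show ?thesis using c d
    by (intro P.inv_equality [symmetric]) (auto simp: carrier_gr_piece gr_class_mult one_gr_piece)
qed

lemma gr_class_commutator_mult_right:
  assumes "i \<ge> 1" "j \<ge> 1" "a \<in> lower_central G i" "b \<in> lower_central G j" "b' \<in> lower_central G j"
  shows "gr_class G (i + j) (group_commutator G a (b \<otimes> b')) =
    gr_class G (i + j) (group_commutator G a b) \<otimes>\<^bsub>gr_piece G (i + j)\<^esub>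
      gr_class G (i + j) (group_commutator G a b')"
proof -
  interpret P: comm_group "gr_piece G (i + j)" using assms by (intro gr_piece_comm_group) auto
  have d: "gr_class G (i + j) (group_commutator G b a) \<in> carrier (gr_piece G (i + j))"
      "gr_class G (i + j) (group_commutator G b' a) \<in> carrier (gr_piece G (i + j))"
    using assms commutator_lower_central[of j i _ a] by (auto simp: carrier_gr_piece add.commute)
  have bb: "b \<otimes> b' \<in> lower_central G j"
    using assms subgroup.m_closed[OF lower_central_subgroup] by auto
  show ?thesis
    using gr_class_inv_commutator[of j i "b \<otimes> b'" a] gr_class_inv_commutator[of j i b a]
      gr_class_inv_commutator[of j i b' a] gr_class_commutator_mult_left[of j i b b' a] assms d bb
    by (simp add: add.commute P.inv_mult)
qed

lemma gr_piece_bracket_class: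
  assumes "i \<ge> 1" "j \<ge> 1" "a \<in> lower_central G i" "b \<in> lower_central G j"
  shows "gr_piece_bracket G i j (gr_class G i a) (gr_class G j b) =
    gr_class G (i + j) (group_commutator G a b)"
proof -
  interpret P: comm_group "gr_piece G (i + j)" using assms by (intro gr_piece_comm_group) auto
  have c: "a \<in> carrier G" "b \<in> carrier G"
    using assms lower_central_carrier by blast+
  have "gr_class G (i + j) (group_commutator G a' b') = gr_class G (i + j) (group_commutator G a b)"
    if a'b': "a' \<in> gr_class G i a" "b' \<in> gr_class G j b" for a' b'
  proof -
    obtain m n where m: "m \<in> lower_central G (Suc i)" "a' = m \<otimes> a"
      and n: "n \<in> lower_central G (Suc j)" "b' = n \<otimes> b"
      using a'b' by (auto simp: gr_class_def r_coset_def)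
    have mn: "m \<in> lower_central G i" "n \<in> lower_central G j"
      using m n lower_central_Suc_subset assms by blast+
    have b': "b' \<in> lower_central G j"
      using gr_class_subset assms that by blast
    have c': "m \<in> carrier G" "n \<in> carrier G" "b' \<in> carrier G"
      using mn b' assms lower_central_carrier by blast+
    have "group_commutator G m b' \<in> lower_central G (Suc (i + j))"
      using commutator_lower_central[of "Suc i" j m b'] assms m b' by simp
    moreover have "group_commutator G a n \<in> lower_central G (Suc (i + j))"
      using commutator_lower_central[of i "Suc j" a n] assms n by simp
    ultimately have "gr_class G (i + j) (group_commutator G m b') = \<one>\<^bsub>gr_piece G (i + j)\<^esub>"
      "gr_class G (i + j) (group_commutator G a n) = \<one>\<^bsub>gr_piece G (i + j)\<^esub>"
      using c c' by (simp_all add: gr_class_eq_one)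
    moreover have "gr_class G (i + j) (group_commutator G a b') \<in> carrier (gr_piece G (i + j))"
        "gr_class G (i + j) (group_commutator G a b) \<in> carrier (gr_piece G (i + j))"
      using assms b' by (auto simp: carrier_gr_piece intro!: imageI commutator_lower_central)
    ultimately show ?thesis
      using gr_class_commutator_mult_left[of i j m a b'] gr_class_commutator_mult_right[of i j a n b]
        assms mn b' m(2) n(2) by simp
  qed
  then have "gr_piece_bracket G i j (gr_class G i a) (gr_class G j b) =
      (\<Union>a'\<in>gr_class G i a. \<Union>b'\<in>gr_class G j b. gr_class G (i + j) (group_commutator G a b))"
    unfolding gr_piece_bracket_def by (simp add: gr_class_def)
  also have "\<dots> = gr_class G (i + j) (group_commutator G a b)"
    using in_gr_class[OF c(1)] in_gr_class[OF c(2)] by blast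
  finally show ?thesis .
qed

text \<open>In the Hall-Witt identity, conjugating \<open>z\<close> by \<open>y\<close> multiplies it by \<open>(y, z)\<close>, of degree higher than
  that of \<open>z\<close>. Modulo the next term of the lower central series the conjugations therefore disappear.\<close>

lemma gr_class_Jacobi:
  assumes "i \<ge> 1" "j \<ge> 1" "l \<ge> 1"
    and "x \<in> lower_central G i" "y \<in> lower_central G j" "z \<in> lower_central G l"
  defines "n \<equiv> i + j + l"
  shows "gr_class G n (group_commutator G (group_commutator G x y) z) \<otimes>\<^bsub>gr_piece G n\<^esub>
    gr_class G n (group_commutator G (group_commutator G y z) x) \<otimes>\<^bsub>gr_piece G n\<^esub>
    gr_class G n (group_commutator G (group_commutator G z x) y) = \<one>\<^bsub>gr_piece G n\<^esub>"
proof -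
  have *: "gr_class G (i + j + l) (group_commutator G (group_commutator G x y) (y \<otimes> z \<otimes> inv y)) =
      gr_class G (i + j + l) (group_commutator G (group_commutator G x y) z)"
    if "i \<ge> 1" "j \<ge> 1" "l \<ge> 1"
    and "x \<in> lower_central G i" "y \<in> lower_central G j" "z \<in> lower_central G l" for i j l x y z
  proof -
    interpret P: comm_group "gr_piece G (i + j + l)" using that by (intro gr_piece_comm_group) auto
    have c: "x \<in> carrier G" "y \<in> carrier G" "z \<in> carrier G"
      using that lower_central_carrier by blast+
    have xy: "group_commutator G x y \<in> lower_central G (i + j)"
      using that by (intro commutator_lower_central)
    have yz: "group_commutator G y z \<in> lower_central G (j + l)"
      using that by (intro commutator_lower_central)
    then have yz': "group_commutator G y z \<in> lower_central G l"
      using lower_central_antimono[of l "j + l"] that by auto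
    have "group_commutator G (group_commutator G x y) (group_commutator G y z)
        \<in> lower_central G ((i + j) + (j + l))"
      using that xy yz by (intro commutator_lower_central) auto
    then have "group_commutator G (group_commutator G x y) (group_commutator G y z)
        \<in> lower_central G (Suc (i + j + l))"
      using lower_central_antimono[of "Suc (i + j + l)" "(i + j) + (j + l)"] that by auto
    then have "gr_class G (i + j + l) (group_commutator G (group_commutator G x y) (group_commutator G y z))
        = \<one>\<^bsub>gr_piece G (i + j + l)\<^esub>"
      using c by (simp add: gr_class_eq_one)
    moreover have "gr_class G (i + j + l) (group_commutator G (group_commutator G x y) z)
        \<in> carrier (gr_piece G (i + j + l))"
      using that xy by (auto simp: carrier_gr_piece intro!: imageI commutator_lower_central)
    ultimately show ?thesis
      using gr_class_commutator_mult_right[of "i + j" l "group_commutator G x y" "group_commutator G y z" z]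
        that xy yz' c by (simp add: conjugate_eq_commutator_mult)
  qed
  have c: "x \<in> carrier G" "y \<in> carrier G" "z \<in> carrier G"
    using assms lower_central_carrier by blast+
  have n: "j + l + i = n" "l + i + j = n" "i + j + l = n" by (auto simp: n_def)
  show ?thesis
    using *[OF assms(1-6)] *[OF assms(2,3,1,5,6,4)] *[OF assms(3,1,2,6,4,5)] Hall_Witt[OF c] c
    unfolding n
    by (simp del: m_assoc add: gr_class_mult one_gr_piece)
       (metis (no_types, lifting) commutator_closed gr_class_mult inv_closed m_closed)
qed

end

section \<open>Graded Lie algebras assembled from their pieces\<close>

lemma finprod_hom:
  assumes "comm_monoid G" "comm_monoid H" "h \<in> hom G H" "h \<one>\<^bsub>G\<^esub> = \<one>\<^bsub>H\<^esub>" "f \<in> S \<rightarrow> carrier G"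
  shows "h (finprod G f S) = finprod H (\<lambda>i. h (f i)) S"
proof -
  interpret G: comm_monoid G by fact
  interpret H: comm_monoid H by fact
  show ?thesis using assms(5)
  proof (induction S rule: infinite_finite_induct)
    case (insert i S)
    then have "(\<lambda>i. h (f i)) \<in> S \<rightarrow> carrier H" "h (f i) \<in> carrier H"
      using assms(3) by (auto simp: hom_def)
    then show ?case using insert assms(3) by (simp add: hom_mult)
  qed (simp_all add: assms)
qed

text \<open>The construction of \<open>gr\<close> for arbitrary pieces \<open>P k\<close> and pairings \<open>B i j\<close> between them. It separates the
  passage from homogeneous to arbitrary elements from the commutator calculus.\<close>

definition lie_sum :: "(nat \<Rightarrow> 'a monoid) \<Rightarrow> (nat \<Rightarrow> nat \<Rightarrow> 'a \<Rightarrow> 'a \<Rightarrow> 'a) \<Rightarrow> (nat \<Rightarrow> 'a) graded_lie" where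
  "lie_sum P B =
    \<lparr>carrier = carrier (sum_group {1..} P),
     monoid.mult = monoid.mult (sum_group {1..} P),
     one = one (sum_group {1..} P),
     bracket = (\<lambda>x y. \<lambda>k\<in>{1..}. finprod (P k) (\<lambda>i. B i (k - i) (x i) (y (k - i))) {1..<k}),
     piece = (\<lambda>k. {x \<in> carrier (sum_group {1..} P). \<forall>j\<ge>1. j \<noteq> k \<longrightarrow> x j = \<one>\<^bsub>P j\<^esub>})\<rparr>"

lemma gr_eq_lie_sum: "gr G = lie_sum (gr_piece G) (gr_piece_bracket G)"
  by (simp add: gr_def lie_sum_def)

definition homogeneous :: "(nat \<Rightarrow> 'a monoid) \<Rightarrow> nat \<Rightarrow> 'a \<Rightarrow> nat \<Rightarrow> 'a" where
  "homogeneous P k a = (\<lambda>j\<in>{1..}. if j = k then a else \<one>\<^bsub>P j\<^esub>)"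

locale lie_pieces =
  fixes P :: "nat \<Rightarrow> 'a monoid" and B :: "nat \<Rightarrow> nat \<Rightarrow> 'a \<Rightarrow> 'a \<Rightarrow> 'a"
  assumes comm_group_P: "k \<ge> 1 \<Longrightarrow> comm_group (P k)"
    and B_closed: "\<lbrakk>i \<ge> 1; j \<ge> 1; x \<in> carrier (P i); y \<in> carrier (P j)\<rbrakk> \<Longrightarrow> B i j x y \<in> carrier (P (i + j))"
    and B_add_left: "\<lbrakk>i \<ge> 1; j \<ge> 1; x \<in> carrier (P i); x' \<in> carrier (P i); y \<in> carrier (P j)\<rbrakk>
      \<Longrightarrow> B i j (x \<otimes>\<^bsub>P i\<^esub> x') y = B i j x y \<otimes>\<^bsub>P (i + j)\<^esub> B i j x' y"
    and B_add_right: "\<lbrakk>i \<ge> 1; j \<ge> 1; x \<in> carrier (P i); y \<in> carrier (P j); y' \<in> carrier (P j)\<rbrakk>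
      \<Longrightarrow> B i j x (y \<otimes>\<^bsub>P j\<^esub> y') = B i j x y \<otimes>\<^bsub>P (i + j)\<^esub> B i j x y'"
    and B_self: "\<lbrakk>i \<ge> 1; x \<in> carrier (P i)\<rbrakk> \<Longrightarrow> B i i x x = \<one>\<^bsub>P (i + i)\<^esub>"
    and B_antisym: "\<lbrakk>i \<ge> 1; j \<ge> 1; x \<in> carrier (P i); y \<in> carrier (P j)\<rbrakk>
      \<Longrightarrow> B i j x y \<otimes>\<^bsub>P (i + j)\<^esub> B j i y x = \<one>\<^bsub>P (i + j)\<^esub>"
    and B_Jacobi: "\<lbrakk>i \<ge> 1; j \<ge> 1; l \<ge> 1; x \<in> carrier (P i); y \<in> carrier (P j); z \<in> carrier (P l)\<rbrakk>
      \<Longrightarrow> B i (j + l) x (B j l y z) \<otimes>\<^bsub>P (i + j + l)\<^esub> B j (l + i) y (B l i z x)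
        \<otimes>\<^bsub>P (i + j + l)\<^esub> B l (i + j) z (B i j x y) = \<one>\<^bsub>P (i + j + l)\<^esub>"
begin

abbreviation L where "L \<equiv> lie_sum P B"

lemma group_P: "k \<ge> 1 \<Longrightarrow> group (P k)"
  using comm_group_P comm_group.axioms(2) by blast

lemma P_one_closed [simp]: "k \<ge> Suc 0 \<Longrightarrow> \<one>\<^bsub>P k\<^esub> \<in> carrier (P k)"
  using group_P by (simp add: group.is_monoid monoid.one_closed)

lemma P_mult_closed [simp]:
  "k \<ge> Suc 0 \<Longrightarrow> x \<in> carrier (P k) \<Longrightarrow> y \<in> carrier (P k) \<Longrightarrow> x \<otimes>\<^bsub>P k\<^esub> y \<in> carrier (P k)"
  using group_P by (simp add: group.is_monoid monoid.m_closed)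

lemma P_one [simp]:
  "k \<ge> Suc 0 \<Longrightarrow> x \<in> carrier (P k) \<Longrightarrow> x \<otimes>\<^bsub>P k\<^esub> \<one>\<^bsub>P k\<^esub> = x"
  "k \<ge> Suc 0 \<Longrightarrow> x \<in> carrier (P k) \<Longrightarrow> \<one>\<^bsub>P k\<^esub> \<otimes>\<^bsub>P k\<^esub> x = x"
  using group_P by (simp_all add: group.is_monoid monoid.l_one monoid.r_one)

lemma B_one_left: "\<lbrakk>i \<ge> 1; j \<ge> 1; y \<in> carrier (P j)\<rbrakk> \<Longrightarrow> B i j \<one>\<^bsub>P i\<^esub> y = \<one>\<^bsub>P (i + j)\<^esub>"
  using B_add_left[of i j "\<one>\<^bsub>P i\<^esub>" "\<one>\<^bsub>P i\<^esub>" y] B_closed[of i j "\<one>\<^bsub>P i\<^esub>" y]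
    group.l_cancel_one[OF group_P[of "i + j"], of "B i j \<one>\<^bsub>P i\<^esub> y" "B i j \<one>\<^bsub>P i\<^esub> y"] by auto

lemma B_one_right: "\<lbrakk>i \<ge> 1; j \<ge> 1; x \<in> carrier (P i)\<rbrakk> \<Longrightarrow> B i j x \<one>\<^bsub>P j\<^esub> = \<one>\<^bsub>P (i + j)\<^esub>"
  using B_add_right[of i j x "\<one>\<^bsub>P j\<^esub>" "\<one>\<^bsub>P j\<^esub>"] B_closed[of i j x "\<one>\<^bsub>P j\<^esub>"]
    group.l_cancel_one[OF group_P[of "i + j"], of "B i j x \<one>\<^bsub>P j\<^esub>" "B i j x \<one>\<^bsub>P j\<^esub>"] by auto

lemma mult_L: "x \<otimes>\<^bsub>L\<^esub> y = (\<lambda>k\<in>{1..}. x k \<otimes>\<^bsub>P k\<^esub> y k)"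
  by (simp add: lie_sum_def)

lemma one_L: "\<one>\<^bsub>L\<^esub> = (\<lambda>k\<in>{1..}. \<one>\<^bsub>P k\<^esub>)"
  by (simp add: lie_sum_def)

lemma bracket_L:
  "bracket L x y = (\<lambda>k\<in>{1..}. finprod (P k) (\<lambda>i. B i (k - i) (x i) (y (k - i))) {1..<k})"
  by (simp add: lie_sum_def)

lemma carrier_L:
  "carrier L = {x \<in> \<Pi>\<^sub>E k\<in>{1..}. carrier (P k). finite {k \<in> {1..}. x k \<noteq> \<one>\<^bsub>P k\<^esub>}}"
  using carrier_sum_group[of "{1..}" P] group_P by (simp add: lie_sum_def)

lemma piece_L: "piece L k = {x \<in> carrier L. \<forall>j\<ge>1. j \<noteq> k \<longrightarrow> x j = \<one>\<^bsub>P j\<^esub>}"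
  by (simp add: lie_sum_def)

lemma coord_closed: "x \<in> carrier L \<Longrightarrow> k \<ge> Suc 0 \<Longrightarrow> x k \<in> carrier (P k)"
  by (auto simp: carrier_L)

lemma L_eqI:
  assumes "x \<in> carrier L" "y \<in> carrier L" "\<And>k. k \<ge> 1 \<Longrightarrow> x k = y k" shows "x = y"
  using assms by (intro extensionalityI[of _ "{1..}"]) (auto simp: carrier_L PiE_def)

lemma comm_group_L: "comm_group L"
proof -
  interpret S: group "sum_group {1..} P" by (rule sum_group) (simp add: group_P)
  have eq: "carrier L = carrier (sum_group {1..} P)" "monoid.mult L = monoid.mult (sum_group {1..} P)"
      "\<one>\<^bsub>L\<^esub> = \<one>\<^bsub>sum_group {1..} P\<^esub>"
    by (simp_all add: lie_sum_def)
  have "group L"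
    by (rule groupI; unfold eq) (fact S.m_closed S.one_closed S.m_assoc S.l_one S.l_inv_ex)+
  then show ?thesis
  proof (rule group.group_comm_groupI)
    fix x y assume xy: "x \<in> carrier L" "y \<in> carrier L"
    show "x \<otimes>\<^bsub>L\<^esub> y = y \<otimes>\<^bsub>L\<^esub> x" unfolding mult_L
      using comm_group_P comm_groupE(4) coord_closed[OF xy(1)] coord_closed[OF xy(2)]
      by (intro restrict_ext) fastforce
  qed
qed

sublocale L: comm_group L by (rule comm_group_L)

lemma mult_coord: "k \<ge> Suc 0 \<Longrightarrow> (x \<otimes>\<^bsub>L\<^esub> y) k = x k \<otimes>\<^bsub>P k\<^esub> y k"
  by (simp add: mult_L)

lemma one_coord: "k \<ge> Suc 0 \<Longrightarrow> \<one>\<^bsub>L\<^esub> k = \<one>\<^bsub>P k\<^esub>"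
  by (simp add: one_L)

lemma homogeneous_coord: "j \<ge> Suc 0 \<Longrightarrow> homogeneous P k a j = (if j = k then a else \<one>\<^bsub>P j\<^esub>)"
  by (simp add: homogeneous_def)

lemma homogeneous_closed:
  assumes "k \<ge> 1" "a \<in> carrier (P k)" shows "homogeneous P k a \<in> carrier L"
proof -
  have "{j \<in> {1..}. homogeneous P k a j \<noteq> \<one>\<^bsub>P j\<^esub>} \<subseteq> {k}"
    by (auto simp: homogeneous_def)
  then show ?thesis using assms by (auto simp: carrier_L homogeneous_def finite_subset)
qed

lemma homogeneous_one: "homogeneous P k \<one>\<^bsub>P k\<^esub> = \<one>\<^bsub>L\<^esub>"
  by (auto simp: homogeneous_def one_L)

lemma homogeneous_piece:
  "k \<ge> 1 \<Longrightarrow> a \<in> carrier (P k) \<Longrightarrow> homogeneous P k a \<in> piece L k"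
  by (auto simp: piece_L homogeneous_closed homogeneous_coord)

lemma piece_homogeneous:
  assumes "k \<ge> 1" "x \<in> piece L k" shows "x = homogeneous P k (x k)"
  using assms by (intro L_eqI) (auto simp: piece_L homogeneous_coord coord_closed intro!: homogeneous_closed)

text \<open>The axioms of a Lie algebra are additive in each variable; by this rule it is enough to verify them
  on homogeneous elements, where they are the axioms of \<open>lie_pieces\<close>.\<close>

lemma homogeneous_induct [consumes 1, case_names homogeneous mult]:
  assumes x: "x \<in> carrier L"
    and h: "\<And>k a. k \<ge> 1 \<Longrightarrow> a \<in> carrier (P k) \<Longrightarrow> Q (homogeneous P k a)"
    and m: "\<And>x y. x \<in> carrier L \<Longrightarrow> y \<in> carrier L \<Longrightarrow> Q x \<Longrightarrow> Q y \<Longrightarrow> Q (x \<otimes>\<^bsub>L\<^esub> y)"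
  shows "Q x"
proof -
  have one: "Q \<one>\<^bsub>L\<^esub>" using h[of 1 "\<one>\<^bsub>P 1\<^esub>"] by (simp add: homogeneous_one)
  have "Q x" if "finite S" "x \<in> carrier L" "{k \<in> {1..}. x k \<noteq> \<one>\<^bsub>P k\<^esub>} \<subseteq> S" for S x
    using that
  proof (induction S arbitrary: x rule: finite_induct)
    case empty
    then have "x = \<one>\<^bsub>L\<^esub>" by (intro L_eqI) (auto simp: one_coord)
    with one show ?case by simp
  next
    case (insert k S)
    show ?case
    proof (cases "k \<ge> 1")
      case True
      let ?y = "x(k := \<one>\<^bsub>P k\<^esub>)"
      have "{j \<in> {1..}. ?y j \<noteq> \<one>\<^bsub>P j\<^esub>} \<subseteq> {j \<in> {1..}. x j \<noteq> \<one>\<^bsub>P j\<^esub>}" by auto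
      then have "finite {j \<in> {1..}. ?y j \<noteq> \<one>\<^bsub>P j\<^esub>}"
        by (rule finite_subset) (use insert.prems(1) in \<open>simp add: carrier_L\<close>)
      moreover have "?y \<in> (\<Pi>\<^sub>E k\<in>{1..}. carrier (P k))" using insert.prems True
        by (auto simp: carrier_L PiE_def extensional_def)
      ultimately have y: "?y \<in> carrier L" unfolding carrier_L by blast
      have "{j \<in> {1..}. ?y j \<noteq> \<one>\<^bsub>P j\<^esub>} \<subseteq> S" using insert.prems by auto
      with y have "Q ?y" by (rule insert.IH)
      moreover have xk: "x k \<in> carrier (P k)" using insert.prems True coord_closed by simp
      have "x = homogeneous P k (x k) \<otimes>\<^bsub>L\<^esub> ?y"
        using insert.prems True y xk
        by (intro L_eqI) (auto simp: mult_coord homogeneous_coord coord_closed intro!: homogeneous_closed)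
      ultimately show ?thesis using m[of "homogeneous P k (x k)" ?y] h[of k "x k"] xk y True
        by (simp add: homogeneous_closed)
    next
      case False
      then show ?thesis using insert.prems by (intro insert.IH) auto
    qed
  qed
  then show ?thesis using x unfolding carrier_L by blast
qed

lemma bracket_coord:
  "k \<ge> Suc 0 \<Longrightarrow> bracket L x y k = finprod (P k) (\<lambda>i. B i (k - i) (x i) (y (k - i))) {1..<k}"
  by (simp add: bracket_L)

lemma bracket_term_closed:
  assumes "x \<in> carrier L" "y \<in> carrier L" "i \<in> {1..<k}"
  shows "B i (k - i) (x i) (y (k - i)) \<in> carrier (P k)"
  using assms B_closed[of i "k - i" "x i" "y (k - i)"] by (auto simp: coord_closed)

lemma coord_eventually_one:
  assumes "x \<in> carrier L" obtains m where "\<And>k. k > m \<Longrightarrow> x k = \<one>\<^bsub>P k\<^esub>"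
proof -
  have "finite {k \<in> {1..}. x k \<noteq> \<one>\<^bsub>P k\<^esub>}" using assms by (simp add: carrier_L)
  then obtain m where m: "{k \<in> {1..}. x k \<noteq> \<one>\<^bsub>P k\<^esub>} \<subseteq> {..m}"
    using finite_nat_iff_bounded_le by blast
  have "x k = \<one>\<^bsub>P k\<^esub>" if "k > m" for k
  proof -
    have "k \<notin> {k \<in> {1..}. x k \<noteq> \<one>\<^bsub>P k\<^esub>}" using m that by (meson atMost_iff not_le subsetD)
    then show ?thesis using that by simp
  qed
  then show ?thesis by (rule that)
qed

lemma bracket_closed:
  assumes xy: "x \<in> carrier L" "y \<in> carrier L" shows "bracket L x y \<in> carrier L"
proof -
  obtain m n where m: "\<And>k. k > m \<Longrightarrow> x k = \<one>\<^bsub>P k\<^esub>" and n: "\<And>k. k > n \<Longrightarrow> y k = \<one>\<^bsub>P k\<^esub>"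
    using coord_eventually_one xy by metis
  have "bracket L x y k = \<one>\<^bsub>P k\<^esub>" if k: "k > m + n" for k
  proof -
    interpret P: comm_group "P k" using k by (intro comm_group_P) auto
    have "B i (k - i) (x i) (y (k - i)) = \<one>\<^bsub>P k\<^esub>" if i: "i \<in> {1..<k}" for i
    proof (cases "i > m")
      case True
      then show ?thesis using m[of i] i xy B_one_left[of i "k - i"] by (simp add: coord_closed)
    next
      case False
      then have "k - i > n" using k by simp
      then show ?thesis using n[of "k - i"] i xy B_one_right[of i "k - i"] by (simp add: coord_closed)
    qed
    then have "finprod (P k) (\<lambda>i. B i (k - i) (x i) (y (k - i))) {1..<k} = \<one>\<^bsub>P k\<^esub>"
      by (rule P.finprod_one_eqI)
    then show ?thesis using k by (subst bracket_coord) auto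
  qed
  then have "{k \<in> {1..}. bracket L x y k \<noteq> \<one>\<^bsub>P k\<^esub>} \<subseteq> {..m + n}" by (auto simp: not_le[symmetric])
  moreover have "bracket L x y k \<in> carrier (P k)" if "k \<ge> 1" for k
  proof -
    interpret P: comm_group "P k" using that by (rule comm_group_P)
    show ?thesis using that xy by (auto simp: bracket_coord intro!: P.finprod_closed bracket_term_closed[simplified])
  qed
  moreover have "bracket L x y \<in> extensional {1..}" by (simp add: bracket_L)
  ultimately show ?thesis by (auto simp: carrier_L PiE_def finite_subset)
qed

lemma bracket_add_left:
  assumes xyz: "x \<in> carrier L" "y \<in> carrier L" "z \<in> carrier L"
  shows "bracket L (x \<otimes>\<^bsub>L\<^esub> y) z = bracket L x z \<otimes>\<^bsub>L\<^esub> bracket L y z"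
proof (rule L_eqI)
  fix k :: nat assume k: "k \<ge> 1"
  interpret P: comm_group "P k" using k by (rule comm_group_P)
  have "finprod (P k) (\<lambda>i. B i (k - i) ((x \<otimes>\<^bsub>L\<^esub> y) i) (z (k - i))) {1..<k} =
    finprod (P k) (\<lambda>i. B i (k - i) (x i) (z (k - i)) \<otimes>\<^bsub>P k\<^esub> B i (k - i) (y i) (z (k - i))) {1..<k}"
  proof (intro P.finprod_cong')
    fix i assume i: "i \<in> {1..<k}"
    show "B i (k - i) ((x \<otimes>\<^bsub>L\<^esub> y) i) (z (k - i)) =
        B i (k - i) (x i) (z (k - i)) \<otimes>\<^bsub>P k\<^esub> B i (k - i) (y i) (z (k - i))"
      using i xyz B_add_left[of i "k - i" "x i" "y i" "z (k - i)"]
      by (auto simp: mult_coord coord_closed Suc_le_eq)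
  qed (use xyz bracket_term_closed in auto)
  also have "\<dots> = bracket L x z k \<otimes>\<^bsub>P k\<^esub> bracket L y z k"
    using k xyz bracket_term_closed by (simp add: bracket_coord P.finprod_multf Pi_iff)
  finally show "bracket L (x \<otimes>\<^bsub>L\<^esub> y) z k = (bracket L x z \<otimes>\<^bsub>L\<^esub> bracket L y z) k"
    using k by (simp add: bracket_coord mult_coord)
qed (use xyz in \<open>simp_all add: bracket_closed\<close>)

lemma bracket_add_right:
  assumes xyz: "x \<in> carrier L" "y \<in> carrier L" "z \<in> carrier L"
  shows "bracket L x (y \<otimes>\<^bsub>L\<^esub> z) = bracket L x y \<otimes>\<^bsub>L\<^esub> bracket L x z"
proof (rule L_eqI)
  fix k :: nat assume k: "k \<ge> 1"
  interpret P: comm_group "P k" using k by (rule comm_group_P)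
  have "finprod (P k) (\<lambda>i. B i (k - i) (x i) ((y \<otimes>\<^bsub>L\<^esub> z) (k - i))) {1..<k} =
    finprod (P k) (\<lambda>i. B i (k - i) (x i) (y (k - i)) \<otimes>\<^bsub>P k\<^esub> B i (k - i) (x i) (z (k - i))) {1..<k}"
  proof (intro P.finprod_cong')
    fix i assume i: "i \<in> {1..<k}"
    show "B i (k - i) (x i) ((y \<otimes>\<^bsub>L\<^esub> z) (k - i)) =
        B i (k - i) (x i) (y (k - i)) \<otimes>\<^bsub>P k\<^esub> B i (k - i) (x i) (z (k - i))"
      using i xyz B_add_right[of i "k - i" "x i" "y (k - i)" "z (k - i)"]
      by (auto simp: mult_coord coord_closed Suc_le_eq)
  qed (use xyz bracket_term_closed in auto)
  also have "\<dots> = bracket L x y k \<otimes>\<^bsub>P k\<^esub> bracket L x z k"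
    using k xyz bracket_term_closed by (simp add: bracket_coord P.finprod_multf Pi_iff)
  finally show "bracket L x (y \<otimes>\<^bsub>L\<^esub> z) k = (bracket L x y \<otimes>\<^bsub>L\<^esub> bracket L x z) k"
    using k by (simp add: bracket_coord mult_coord)
qed (use xyz in \<open>simp_all add: bracket_closed\<close>)

lemma bracket_homogeneous:
  assumes ij: "i \<ge> 1" "j \<ge> 1" and ab: "a \<in> carrier (P i)" "b \<in> carrier (P j)"
  shows "bracket L (homogeneous P i a) (homogeneous P j b) = homogeneous P (i + j) (B i j a b)"
proof (rule L_eqI)
  fix k :: nat assume k: "k \<ge> 1"
  interpret P: comm_group "P k" using k by (rule comm_group_P)
  let ?f = "\<lambda>i'. B i' (k - i') (homogeneous P i a i') (homogeneous P j b (k - i'))"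
  have "?f i' = (if i = i' then if k = i + j then B i j a b else \<one>\<^bsub>P k\<^esub> else \<one>\<^bsub>P k\<^esub>)"
    if "i' \<in> {1..<k}" for i'
    using that ij ab B_one_left[of i' "k - i'"] B_one_right[of i "k - i"]
    by (auto simp: homogeneous_coord split: if_splits)
  then have "finprod (P k) ?f {1..<k} = finprod (P k)
      (\<lambda>i'. if i = i' then if k = i + j then B i j a b else \<one>\<^bsub>P k\<^esub> else \<one>\<^bsub>P k\<^esub>) {1..<k}"
    using B_closed[OF ij ab] by (intro P.finprod_cong') auto
  also have "\<dots> = (if k = i + j then B i j a b else \<one>\<^bsub>P k\<^esub>)"
  proof (cases "k = i + j")
    case True
    then show ?thesis
      using B_closed[OF ij ab] ij P.finprod_singleton[of i "{1..<k}" "\<lambda>_. B i j a b"] by auto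
  next
    case False
    then show ?thesis by (simp add: P.finprod_one_eqI)
  qed
  finally show "bracket L (homogeneous P i a) (homogeneous P j b) k = homogeneous P (i + j) (B i j a b) k"
    using k by (simp add: bracket_coord homogeneous_coord)
qed (use assms in \<open>auto intro!: bracket_closed homogeneous_closed B_closed\<close>)

lemma homogeneous_mult:
  "k \<ge> 1 \<Longrightarrow> a \<in> carrier (P k) \<Longrightarrow> b \<in> carrier (P k)
    \<Longrightarrow> homogeneous P k a \<otimes>\<^bsub>L\<^esub> homogeneous P k b = homogeneous P k (a \<otimes>\<^bsub>P k\<^esub> b)"
  by (intro L_eqI) (auto simp: mult_coord homogeneous_coord intro!: homogeneous_closed)

lemma mult_interchange:
  assumes "a \<in> carrier L" "b \<in> carrier L" "c \<in> carrier L" "d \<in> carrier L"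
  shows "(a \<otimes>\<^bsub>L\<^esub> b) \<otimes>\<^bsub>L\<^esub> (c \<otimes>\<^bsub>L\<^esub> d) = (a \<otimes>\<^bsub>L\<^esub> c) \<otimes>\<^bsub>L\<^esub> (b \<otimes>\<^bsub>L\<^esub> d)"
  using assms by (metis (no_types, lifting) L.m_assoc L.m_lcomm L.m_closed)

lemma bracket_antisym_mult:
  assumes "x \<in> carrier L" "x' \<in> carrier L" "y \<in> carrier L"
  shows "bracket L (x \<otimes>\<^bsub>L\<^esub> x') y \<otimes>\<^bsub>L\<^esub> bracket L y (x \<otimes>\<^bsub>L\<^esub> x') =
    (bracket L x y \<otimes>\<^bsub>L\<^esub> bracket L y x) \<otimes>\<^bsub>L\<^esub> (bracket L x' y \<otimes>\<^bsub>L\<^esub> bracket L y x')"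
proof -
  show ?thesis
    unfolding bracket_add_left[OF assms] bracket_add_right[OF assms(3,1,2)]
    using assms by (intro mult_interchange) (simp_all add: bracket_closed)
qed

lemma bracket_antisym:
  assumes "x \<in> carrier L" "y \<in> carrier L"
  shows "bracket L x y \<otimes>\<^bsub>L\<^esub> bracket L y x = \<one>\<^bsub>L\<^esub>"
  using assms
proof (induction x arbitrary: y rule: homogeneous_induct)
  case (homogeneous i a)
  from homogeneous(3) show ?case
  proof (induction y rule: homogeneous_induct)
    case (homogeneous j b)
    then show ?case
      using \<open>i \<ge> 1\<close> \<open>a \<in> carrier (P i)\<close> B_antisym[of i j a b] B_closed[of i j a b] B_closed[of j i b a]
      by (simp add: bracket_homogeneous add.commute[of j i] homogeneous_mult homogeneous_one)
  next
    case (mult x y)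
    then show ?case using homogeneous(1,2)
        bracket_antisym_mult[of x y "homogeneous P i a"]
        L.m_comm[of "bracket L (homogeneous P i a) _" "bracket L _ (homogeneous P i a)"]
      by (simp add: homogeneous_closed bracket_closed)
  qed
next
  case (mult x x')
  then show ?case by (simp add: bracket_antisym_mult)
qed

lemma bracket_self: "x \<in> carrier L \<Longrightarrow> bracket L x x = \<one>\<^bsub>L\<^esub>"
proof (induction x rule: homogeneous_induct)
  case (homogeneous k a)
  then show ?case by (simp add: bracket_homogeneous B_self homogeneous_one)
next
  case (mult x y)
  then have "bracket L x y \<otimes>\<^bsub>L\<^esub> bracket L y x = \<one>\<^bsub>L\<^esub>" by (intro bracket_antisym)
  with mult show ?case
    by (simp add: bracket_add_left bracket_add_right bracket_closed L.m_comm)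
qed

abbreviation Jacobi_sum where
  "Jacobi_sum x y z \<equiv> bracket L x (bracket L y z) \<otimes>\<^bsub>L\<^esub> bracket L y (bracket L z x) \<otimes>\<^bsub>L\<^esub> bracket L z (bracket L x y)"

text \<open>Thanks to this cyclic symmetry, additivity of the Jacobi sum in its first argument implies additivity
  in all three.\<close>

lemma Jacobi_sum_rotate:
  "\<lbrakk>x \<in> carrier L; y \<in> carrier L; z \<in> carrier L\<rbrakk> \<Longrightarrow> Jacobi_sum y z x = Jacobi_sum x y z"
  using L.m_comm[of "bracket L x (bracket L y z)"] by (simp add: L.m_assoc bracket_closed)

lemma Jacobi_sum_mult:
  assumes "x \<in> carrier L" "x' \<in> carrier L" "y \<in> carrier L" "z \<in> carrier L"
  shows "Jacobi_sum (x \<otimes>\<^bsub>L\<^esub> x') y z = Jacobi_sum x y z \<otimes>\<^bsub>L\<^esub> Jacobi_sum x' y z"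
proof -
  have *: "(a \<otimes>\<^bsub>L\<^esub> a') \<otimes>\<^bsub>L\<^esub> (b \<otimes>\<^bsub>L\<^esub> b') \<otimes>\<^bsub>L\<^esub> (c \<otimes>\<^bsub>L\<^esub> c') = a \<otimes>\<^bsub>L\<^esub> b \<otimes>\<^bsub>L\<^esub> c \<otimes>\<^bsub>L\<^esub> (a' \<otimes>\<^bsub>L\<^esub> b' \<otimes>\<^bsub>L\<^esub> c')"
    if "a \<in> carrier L" "a' \<in> carrier L" "b \<in> carrier L" "b' \<in> carrier L" "c \<in> carrier L" "c' \<in> carrier L"
    for a a' b b' c c'
    using that mult_interchange[of a a' b b'] mult_interchange[of "a \<otimes>\<^bsub>L\<^esub> b" "a' \<otimes>\<^bsub>L\<^esub> b'" c c']
    by (simp del: L.m_assoc)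
  have "Jacobi_sum (x \<otimes>\<^bsub>L\<^esub> x') y z =
      (bracket L x (bracket L y z) \<otimes>\<^bsub>L\<^esub> bracket L x' (bracket L y z))
      \<otimes>\<^bsub>L\<^esub> (bracket L y (bracket L z x) \<otimes>\<^bsub>L\<^esub> bracket L y (bracket L z x'))
      \<otimes>\<^bsub>L\<^esub> (bracket L z (bracket L x y) \<otimes>\<^bsub>L\<^esub> bracket L z (bracket L x' y))"
    using assms by (simp add: bracket_add_left bracket_add_right bracket_closed)
  also have "\<dots> = Jacobi_sum x y z \<otimes>\<^bsub>L\<^esub> Jacobi_sum x' y z"
    using assms by (intro *) (simp_all add: bracket_closed)
  finally show ?thesis .
qed

lemma bracket_Jacobi:
  assumes "x \<in> carrier L" "y \<in> carrier L" "z \<in> carrier L"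
  shows "Jacobi_sum x y z = \<one>\<^bsub>L\<^esub>"
  using assms
proof (induction x arbitrary: y z rule: homogeneous_induct)
  case x: (homogeneous i a)
  note x' = homogeneous_closed[OF x(1,2)]
  from x(3,4) show ?case
  proof (induction y arbitrary: z rule: homogeneous_induct)
    case y: (homogeneous j b)
    note y' = homogeneous_closed[OF y(1,2)]
    from y(3) show ?case
    proof (induction z rule: homogeneous_induct)
      case z: (homogeneous l c)
      have e: "j + l + i = i + j + l" "l + (i + j) = i + j + l" "i + (j + l) = i + j + l"
          "j + (l + i) = i + j + l"
        by auto
      show ?case
        using B_Jacobi[of i j l a b c] x y z B_closed[of i "j + l" a "B j l b c"] B_closed[of j "l + i" b "B l i c a"]
          B_closed[of l "i + j" c "B i j a b"] unfolding e
        by (simp add: bracket_homogeneous B_closed homogeneous_mult homogeneous_one e del: add.assoc)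
    next
      case (mult z z')
      then show ?case
        using Jacobi_sum_mult[of z z', OF _ _ x' y'] Jacobi_sum_rotate[OF _ x' y'] by simp
    qed
  next
    case (mult y y')
    then show ?case
      using Jacobi_sum_mult[of y y' _ "homogeneous P i a"] Jacobi_sum_rotate[OF x'] x' by simp
  qed
next
  case (mult x x')
  then show ?case by (simp add: Jacobi_sum_mult)
qed

lemma piece_subgroup: "subgroup (piece L k) L"
proof (rule L.subgroupI)
  show "piece L k \<subseteq> carrier L" by (auto simp: piece_L)
  have "\<one>\<^bsub>L\<^esub> \<in> piece L k" by (simp add: piece_L one_coord)
  then show "piece L k \<noteq> {}" by blast
  fix x assume x: "x \<in> piece L k"
  have xc: "x \<in> carrier L" using x by (simp add: piece_L)
  have "(inv\<^bsub>L\<^esub> x) j = \<one>\<^bsub>P j\<^esub>" if j: "j \<ge> 1" "j \<noteq> k" for j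
  proof -
    have "(inv\<^bsub>L\<^esub> x \<otimes>\<^bsub>L\<^esub> x) j = \<one>\<^bsub>P j\<^esub>" using xc j by (simp add: one_coord)
    then show ?thesis using x j coord_closed[OF L.inv_closed[OF xc]]
      by (simp add: mult_coord piece_L)
  qed
  then show "inv\<^bsub>L\<^esub> x \<in> piece L k" using xc by (simp add: piece_L)
  fix y assume "y \<in> piece L k"
  then show "x \<otimes>\<^bsub>L\<^esub> y \<in> piece L k" using x by (simp add: piece_L mult_coord)
qed

lemma bracket_piece:
  assumes "i \<ge> 1" "j \<ge> 1" "x \<in> piece L i" "y \<in> piece L j"
  shows "bracket L x y \<in> piece L (i + j)"
proof -
  have "x i \<in> carrier (P i)" "y j \<in> carrier (P j)" using assms by (simp_all add: piece_L coord_closed)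
  then have "bracket L (homogeneous P i (x i)) (homogeneous P j (y j)) \<in> piece L (i + j)"
    using assms by (simp add: bracket_homogeneous B_closed homogeneous_piece)
  then show ?thesis using piece_homogeneous assms by metis
qed

lemma finprod_coord:
  assumes "j \<ge> 1" "f \<in> S \<rightarrow> carrier L"
  shows "finprod L f S j = finprod (P j) (\<lambda>k. f k j) S"
  using assms
  by (intro finprod_hom[where h = "\<lambda>x. x j"])
     (auto simp: L.comm_monoid_axioms comm_group_P comm_group.axioms one_coord hom_def mult_coord coord_closed)

text \<open>The inverse sends \<open>y\<close> to the family of its homogeneous components; the \<open>j\<close>-th coordinate of a sum of
  homogeneous elements only sees the summand of degree \<open>j\<close>.\<close>

lemma direct_sum:
  "bij_betw (\<lambda>x. finprod L x {k \<in> {1..}. x k \<noteq> \<one>\<^bsub>L\<^esub>})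
     (carrier (sum_group {1..} (\<lambda>k. L\<lparr>carrier := piece L k\<rparr>))) (carrier L)"
proof -
  have "group (L\<lparr>carrier := piece L k\<rparr>)" for k
    by (rule L.subgroup_imp_group[OF piece_subgroup])
  then have car: "carrier (sum_group {1..} (\<lambda>k. L\<lparr>carrier := piece L k\<rparr>)) =
      {x \<in> \<Pi>\<^sub>E k\<in>{1..}. piece L k. finite {k \<in> {1..}. x k \<noteq> \<one>\<^bsub>L\<^esub>}}" (is "_ = ?D")
    by (subst carrier_sum_group) auto
  let ?F = "\<lambda>x. finprod L x {k \<in> {1..}. x k \<noteq> \<one>\<^bsub>L\<^esub>}"
  let ?I = "\<lambda>y. \<lambda>k\<in>{1..}. homogeneous P k (y k)"
  have F_closed: "?F x \<in> carrier L" if "x \<in> ?D" for x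
    using that by (intro L.finprod_closed) (auto simp: piece_L PiE_iff)
  have F_coord: "?F x j = x j j" if x: "x \<in> ?D" and j: "j \<ge> 1" for x j
  proof -
    interpret P: comm_group "P j" using j by (rule comm_group_P)
    let ?S = "{k \<in> {1..}. x k \<noteq> \<one>\<^bsub>L\<^esub>}"
    have fin: "finite ?S" and xk: "\<And>k. k \<ge> 1 \<Longrightarrow> x k \<in> piece L k" using x by (auto simp: PiE_iff)
    have xjj: "x j j \<in> carrier (P j)" using xk[OF j] j by (simp add: piece_L coord_closed)
    have "?F x j = finprod (P j) (\<lambda>k. x k j) ?S"
      using j xk by (intro finprod_coord) (auto simp: piece_L)
    also have "\<dots> = finprod (P j) (\<lambda>k. if j = k then x j j else \<one>\<^bsub>P j\<^esub>) ?S"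
      using j xk xjj by (intro P.finprod_cong') (auto simp: piece_L)
    also have "\<dots> = x j j"
    proof (cases "j \<in> ?S")
      case True
      then show ?thesis using P.finprod_singleton[OF True fin, of "\<lambda>_. x j j"] xjj by simp
    next
      case False
      then have "x j j = \<one>\<^bsub>P j\<^esub>" using j by (simp add: one_coord)
      then show ?thesis by (subst P.finprod_one_eqI) auto
    qed
    finally show ?thesis .
  qed
  have I_D: "?I y \<in> ?D" if y: "y \<in> carrier L" for y
  proof -
    have "{k \<in> {1..}. ?I y k \<noteq> \<one>\<^bsub>L\<^esub>} \<subseteq> {k \<in> {1..}. y k \<noteq> \<one>\<^bsub>P k\<^esub>}"
      by (auto simp: homogeneous_one)
    then have "finite {k \<in> {1..}. ?I y k \<noteq> \<one>\<^bsub>L\<^esub>}"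
      by (rule finite_subset) (use y in \<open>simp add: carrier_L\<close>)
    then show ?thesis using y by (auto simp: coord_closed homogeneous_piece)
  qed
  have FI: "?F (?I y) = y" if y: "y \<in> carrier L" for y
  proof (rule L_eqI)
    fix j :: nat assume "j \<ge> 1"
    then show "?F (?I y) j = y j"
      using F_coord[OF I_D[OF y]] by (simp add: homogeneous_coord)
  qed (use y F_closed[OF I_D[OF y]] in auto)
  have IF: "?I (?F x) = x" if x: "x \<in> ?D" for x
  proof (rule extensionalityI[of _ "{1..}"])
    show "x \<in> extensional {1..}" using x by (auto simp: PiE_def)
    fix k :: nat assume k: "k \<in> {1..}"
    then have "x k \<in> piece L k" using x by auto
    then show "?I (?F x) k = x k"
      using k F_coord[OF x] piece_homogeneous by simp
  qed simp
  show ?thesis unfolding car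
    by (rule bij_betw_byWitness[where f' = ?I]; intro ballI image_subsetI; fact IF FI F_closed I_D)
qed

theorem graded_lie_algebra_lie_sum: "graded_lie_algebra L"
  by (intro graded_lie_algebra.intro comm_group_L graded_lie_algebra_axioms.intro)
     (assumption | rule bracket_closed bracket_add_left bracket_add_right bracket_self bracket_Jacobi
        piece_subgroup direct_sum bracket_piece)+

end

lemma graded_lie_hom_lie_sum:
  assumes "lie_pieces P B" "lie_pieces P' B'"
    and hom: "\<And>k. k \<ge> 1 \<Longrightarrow> \<phi> k \<in> hom (P k) (P' k)"
    and B: "\<And>i j a b. \<lbrakk>i \<ge> 1; j \<ge> 1; a \<in> carrier (P i); b \<in> carrier (P j)\<rbrakk>
      \<Longrightarrow> \<phi> (i + j) (B i j a b) = B' i j (\<phi> i a) (\<phi> j b)"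
  shows "(\<lambda>x. \<lambda>k\<in>{1..}. \<phi> k (x k)) \<in> graded_lie_hom (lie_sum P B) (lie_sum P' B')"
proof -
  interpret S: lie_pieces P B by fact
  interpret T: lie_pieces P' B' by fact
  let ?f = "\<lambda>x. \<lambda>k\<in>{1..}. \<phi> k (x k)"
  have one: "\<phi> k \<one>\<^bsub>P k\<^esub> = \<one>\<^bsub>P' k\<^esub>" if "k \<ge> 1" for k
    using hom_one[OF hom[OF that] S.group_P[OF that] T.group_P[OF that]] .
  have cl: "\<phi> k a \<in> carrier (P' k)" if "k \<ge> 1" "a \<in> carrier (P k)" for k a
    using hom_in_carrier hom that by metis
  have f: "?f x \<in> carrier T.L" if x: "x \<in> carrier S.L" for x
  proof -
    have "{k \<in> {1..}. ?f x k \<noteq> \<one>\<^bsub>P' k\<^esub>} \<subseteq> {k \<in> {1..}. x k \<noteq> \<one>\<^bsub>P k\<^esub>}"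
      using one by auto
    then have "finite {k \<in> {1..}. ?f x k \<noteq> \<one>\<^bsub>P' k\<^esub>}"
      by (rule finite_subset) (use x in \<open>simp add: S.carrier_L\<close>)
    moreover have "?f x \<in> (\<Pi>\<^sub>E k\<in>{1..}. carrier (P' k))" using x cl by (auto simp: S.coord_closed)
    ultimately show ?thesis unfolding T.carrier_L by blast
  qed
  have "?f (x \<otimes>\<^bsub>S.L\<^esub> y) = ?f x \<otimes>\<^bsub>T.L\<^esub> ?f y" if "x \<in> carrier S.L" "y \<in> carrier S.L" for x y
    using that f hom_mult[OF hom]
    by (intro T.L_eqI) (auto simp: T.mult_coord S.mult_coord S.coord_closed)
  moreover have "?f (bracket S.L x y) = bracket T.L (?f x) (?f y)"
    if xy: "x \<in> carrier S.L" "y \<in> carrier S.L" for x y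
  proof (rule T.L_eqI)
    fix k :: nat assume k: "k \<ge> 1"
    interpret P': comm_group "P' k" using k by (rule T.comm_group_P)
    have "\<phi> k (bracket S.L x y k) =
        finprod (P' k) (\<lambda>i. \<phi> k (B i (k - i) (x i) (y (k - i)))) {1..<k}"
      unfolding S.bracket_coord[OF k[unfolded One_nat_def]]
      using k hom one S.bracket_term_closed[OF xy]
      by (intro finprod_hom) (auto simp: comm_group.axioms S.comm_group_P T.comm_group_P)
    also have "\<dots> = finprod (P' k) (\<lambda>i. B' i (k - i) (?f x i) (?f y (k - i))) {1..<k}"
    proof (intro P'.finprod_cong')
      fix i assume i: "i \<in> {1..<k}"
      then show "\<phi> k (B i (k - i) (x i) (y (k - i))) = B' i (k - i) (?f x i) (?f y (k - i))"
        using B[of i "k - i" "x i" "y (k - i)"] xy by (auto simp: S.coord_closed Suc_le_eq)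
    qed (use T.bracket_term_closed[OF f[OF xy(1)] f[OF xy(2)]] in auto)
    finally show "?f (bracket S.L x y) k = bracket T.L (?f x) (?f y) k"
      using k by (simp add: T.bracket_coord)
  qed (fact f[OF S.bracket_closed[OF xy]] T.bracket_closed[OF f[OF xy(1)] f[OF xy(2)]])+
  moreover have "?f ` piece S.L k \<subseteq> piece T.L k" for k
    using f one by (auto simp: S.piece_L T.piece_L)
  ultimately show ?thesis using f by (auto simp: graded_lie_hom_def hom_def)
qed

section \<open>The associated graded Lie algebra and its functoriality\<close>

lemma lie_pieces_gr:
  assumes "group G" shows "lie_pieces (gr_piece G) (gr_piece_bracket G)"
proof -
  interpret group G by fact
  have closed: "gr_piece_bracket G i j A B \<in> carrier (gr_piece G (i + j))"
    if "i \<ge> 1" "j \<ge> 1" "A \<in> carrier (gr_piece G i)" "B \<in> carrier (gr_piece G j)" for i j A B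
    using that by (auto simp: carrier_gr_piece gr_piece_bracket_class commutator_lower_central)
  note lc = lower_central_carrier
  show ?thesis
  proof (rule lie_pieces.intro)
    fix k :: nat assume "k \<ge> 1"
    then show "comm_group (gr_piece G k)" by (rule gr_piece_comm_group)
  next
    fix i j :: nat and A B
    assume "i \<ge> 1" "j \<ge> 1" "A \<in> carrier (gr_piece G i)" "B \<in> carrier (gr_piece G j)"
    then show "gr_piece_bracket G i j A B \<in> carrier (gr_piece G (i + j))" by (rule closed)
  next
    fix i j :: nat and A A' B
    assume *: "i \<ge> 1" "j \<ge> 1" "A \<in> carrier (gr_piece G i)" "A' \<in> carrier (gr_piece G i)"
      "B \<in> carrier (gr_piece G j)"
    then obtain a a' b where "A = gr_class G i a" "A' = gr_class G i a'" "B = gr_class G j b"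
      and m: "a \<in> lower_central G i" "a' \<in> lower_central G i" "b \<in> lower_central G j"
      by (auto simp: carrier_gr_piece)
    then show "gr_piece_bracket G i j (A \<otimes>\<^bsub>gr_piece G i\<^esub> A') B =
        gr_piece_bracket G i j A B \<otimes>\<^bsub>gr_piece G (i + j)\<^esub> gr_piece_bracket G i j A' B"
      using * lc[OF *(1) m(1)] lc[OF *(1) m(2)] subgroup.m_closed[OF lower_central_subgroup[OF *(1)] m(1,2)]
      by (simp add: gr_class_mult gr_piece_bracket_class gr_class_commutator_mult_left)
  next
    fix i j :: nat and A B B'
    assume *: "i \<ge> 1" "j \<ge> 1" "A \<in> carrier (gr_piece G i)" "B \<in> carrier (gr_piece G j)"
      "B' \<in> carrier (gr_piece G j)"
    then obtain a b b' where "A = gr_class G i a" "B = gr_class G j b" "B' = gr_class G j b'"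
      and m: "a \<in> lower_central G i" "b \<in> lower_central G j" "b' \<in> lower_central G j"
      by (auto simp: carrier_gr_piece)
    then show "gr_piece_bracket G i j A (B \<otimes>\<^bsub>gr_piece G j\<^esub> B') =
        gr_piece_bracket G i j A B \<otimes>\<^bsub>gr_piece G (i + j)\<^esub> gr_piece_bracket G i j A B'"
      using * lc[OF *(2) m(2)] lc[OF *(2) m(3)] subgroup.m_closed[OF lower_central_subgroup[OF *(2)] m(2,3)]
      by (simp add: gr_class_mult gr_piece_bracket_class gr_class_commutator_mult_right)
  next
    fix i :: nat and A
    assume *: "i \<ge> 1" "A \<in> carrier (gr_piece G i)"
    then obtain a where "A = gr_class G i a" "a \<in> lower_central G i" by (auto simp: carrier_gr_piece)
    then show "gr_piece_bracket G i i A A = \<one>\<^bsub>gr_piece G (i + i)\<^esub>"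
      using * lc by (simp add: gr_piece_bracket_class commutator_self one_gr_piece)
  next
    fix i j :: nat and A B
    assume *: "i \<ge> 1" "j \<ge> 1" "A \<in> carrier (gr_piece G i)" "B \<in> carrier (gr_piece G j)"
    then obtain a b where e: "A = gr_class G i a" "B = gr_class G j b"
      and m: "a \<in> lower_central G i" "b \<in> lower_central G j" by (auto simp: carrier_gr_piece)
    interpret P: comm_group "gr_piece G (i + j)" using * by (intro gr_piece_comm_group) auto
    have "gr_class G (i + j) (group_commutator G a b) \<in> carrier (gr_piece G (i + j))"
      using * m by (simp add: carrier_gr_piece commutator_lower_central)
    then show "gr_piece_bracket G i j A B \<otimes>\<^bsub>gr_piece G (i + j)\<^esub> gr_piece_bracket G j i B A =
        \<one>\<^bsub>gr_piece G (i + j)\<^esub>"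
      using * m by (simp add: e gr_piece_bracket_class gr_class_inv_commutator add.commute[of j i])
  next
    fix i j l :: nat and A B C
    assume *: "i \<ge> 1" "j \<ge> 1" "l \<ge> 1" "A \<in> carrier (gr_piece G i)" "B \<in> carrier (gr_piece G j)"
        "C \<in> carrier (gr_piece G l)"
    then obtain a b c where e: "A = gr_class G i a" "B = gr_class G j b" "C = gr_class G l c"
      and m: "a \<in> lower_central G i" "b \<in> lower_central G j" "c \<in> lower_central G l"
      by (auto simp: carrier_gr_piece)
    let ?P = "gr_piece G (i + j + l)"
    interpret P: comm_group ?P using * by (intro gr_piece_comm_group) auto
    let ?x = "gr_class G (i + j + l) (group_commutator G (group_commutator G b c) a)"
    let ?y = "gr_class G (i + j + l) (group_commutator G (group_commutator G c a) b)"
    let ?z = "gr_class G (i + j + l) (group_commutator G (group_commutator G a b) c)"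
    have n: "j + l + i = i + j + l" "l + i + j = i + j + l" "i + (j + l) = i + j + l"
        "j + (l + i) = i + j + l" "l + (i + j) = i + j + l" by auto
    have cl: "group_commutator G b c \<in> lower_central G (j + l)"
        "group_commutator G c a \<in> lower_central G (l + i)"
        "group_commutator G a b \<in> lower_central G (i + j)"
      using * m by (auto intro: commutator_lower_central)
    have xyz: "?x \<in> carrier ?P" "?y \<in> carrier ?P" "?z \<in> carrier ?P"
      using commutator_lower_central[OF _ *(1) cl(1) m(1)] commutator_lower_central[OF _ *(2) cl(2) m(2)]
        commutator_lower_central[OF _ *(3) cl(3) m(3)] *
      by (auto simp: carrier_gr_piece n)
    have "?z \<otimes>\<^bsub>?P\<^esub> ?x \<otimes>\<^bsub>?P\<^esub> ?y = \<one>\<^bsub>?P\<^esub>"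
      using gr_class_Jacobi[OF *(1-3) m] .
    then have "inv\<^bsub>?P\<^esub> ?x \<otimes>\<^bsub>?P\<^esub> inv\<^bsub>?P\<^esub> ?y \<otimes>\<^bsub>?P\<^esub> inv\<^bsub>?P\<^esub> ?z = \<one>\<^bsub>?P\<^esub>"
      using xyz by (metis P.inv_mult P.inv_one P.m_assoc P.m_comm P.m_closed)
    moreover have "gr_piece_bracket G i (j + l) A (gr_piece_bracket G j l B C) = inv\<^bsub>?P\<^esub> ?x"
      using * m cl gr_class_inv_commutator[of "j + l" i "group_commutator G b c" a]
      by (simp add: e gr_piece_bracket_class n)
    moreover have "gr_piece_bracket G j (l + i) B (gr_piece_bracket G l i C A) = inv\<^bsub>?P\<^esub> ?y"
      using * m cl gr_class_inv_commutator[of "l + i" j "group_commutator G c a" b]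
      by (simp add: e gr_piece_bracket_class n)
    moreover have "gr_piece_bracket G l (i + j) C (gr_piece_bracket G i j A B) = inv\<^bsub>?P\<^esub> ?z"
      using * m cl gr_class_inv_commutator[of "i + j" l "group_commutator G a b" c]
      by (simp add: e gr_piece_bracket_class n)
    ultimately show "gr_piece_bracket G i (j + l) A (gr_piece_bracket G j l B C) \<otimes>\<^bsub>?P\<^esub>
        gr_piece_bracket G j (l + i) B (gr_piece_bracket G l i C A) \<otimes>\<^bsub>?P\<^esub>
        gr_piece_bracket G l (i + j) C (gr_piece_bracket G i j A B) = \<one>\<^bsub>?P\<^esub>"
      by simp
  qed
qed

theorem graded_lie_algebra_gr: "group G \<Longrightarrow> graded_lie_algebra (gr G)"
  unfolding gr_eq_lie_sum by (rule lie_pieces.graded_lie_algebra_lie_sum[OF lie_pieces_gr])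

lemma hom_commutator:
  assumes "group G" "group H" "\<alpha> \<in> hom G H" "x \<in> carrier G" "y \<in> carrier G"
  shows "\<alpha> (group_commutator G x y) = group_commutator H (\<alpha> x) (\<alpha> y)"
proof -
  interpret group_hom G H \<alpha> using assms by (simp add: group_hom_def group_hom_axioms_def)
  show ?thesis using assms by (simp add: group_commutator_def)
qed

lemma hom_lower_central:
  assumes "group G" "group H" "\<alpha> \<in> hom G H" "k \<ge> 1" "x \<in> lower_central G k"
  shows "\<alpha> x \<in> lower_central H k"
proof -
  interpret group_hom G H \<alpha> using assms by (simp add: group_hom_def group_hom_axioms_def)
  show ?thesis using assms(4,5)
  proof (induction k arbitrary: x rule: nat_induct_at_least)
    case (Suc k)
    have "commutator_subgroup G (lower_central G k) (carrier G) \<subseteq>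
        {x \<in> carrier G. \<alpha> x \<in> lower_central H (Suc k)}"
    proof (rule G.commutator_subgroup_incl)
      show "subgroup {x \<in> carrier G. \<alpha> x \<in> lower_central H (Suc k)} G"
        using H.lower_central_subgroup[of "Suc k"]
        by (intro G.subgroupI) (auto simp: subgroup.m_closed subgroup.m_inv_closed subgroup.one_closed intro!: exI[of _ "\<one>\<^bsub>G\<^esub>"])
    qed (use Suc G.lower_central_carrier in \<open>auto simp: hom_commutator[OF assms(1-3)] H.commutator_in_lower_central_Suc\<close>)
    then show ?case using Suc G.lower_central_Suc by auto
  qed simp
qed

lemma coset_map_gr_class:
  assumes "group G" "group H" "\<alpha> \<in> hom G H" "x \<in> carrier G"
  shows "coset_map H (lower_central H (k + 1)) \<alpha> (gr_class G k x) = gr_class H k (\<alpha> x)"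
proof -
  interpret group_hom G H \<alpha> using assms by (simp add: group_hom_def group_hom_axioms_def)
  have "gr_class H k (\<alpha> y) = gr_class H k (\<alpha> x)" if y: "y \<in> gr_class G k x" for y
  proof -
    obtain m where m: "m \<in> lower_central G (Suc k)" "y = m \<otimes>\<^bsub>G\<^esub> x"
      using y by (auto simp: gr_class_def r_coset_def)
    have "m \<in> carrier G" using m G.lower_central_carrier[of "Suc k"] by simp
    moreover have "\<alpha> m \<in> lower_central H (Suc k)" using hom_lower_central[OF assms(1-3)] m by simp
    ultimately show ?thesis using assms(4) m(2)
      by (subst H.gr_class_eq_iff) (auto simp: H.m_assoc)
  qed
  then have "coset_map H (lower_central H (k + 1)) \<alpha> (gr_class G k x) =
      (\<Union>y\<in>gr_class G k x. gr_class H k (\<alpha> x))"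
    by (auto simp: coset_map_def gr_class_def)
  then show ?thesis using G.in_gr_class[OF assms(4)] by blast
qed

theorem gr_map_graded_lie_hom:
  assumes "group G" "group H" "\<alpha> \<in> hom G H"
  shows "gr_map H \<alpha> \<in> graded_lie_hom (gr G) (gr H)"
proof -
  interpret group_hom G H \<alpha> using assms by (simp add: group_hom_def group_hom_axioms_def)
  note cm = coset_map_gr_class[OF assms]
  have m: "gr_map H \<alpha> = (\<lambda>x. \<lambda>k\<in>{1..}. coset_map H (lower_central H (k + 1)) \<alpha> (x k))"
    by (auto simp: gr_map_def)
  show ?thesis
    unfolding gr_eq_lie_sum m
  proof (rule graded_lie_hom_lie_sum)
    show "lie_pieces (gr_piece G) (gr_piece_bracket G)" "lie_pieces (gr_piece H) (gr_piece_bracket H)"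
      using assms by (auto intro: lie_pieces_gr)
    fix k :: nat assume k: "k \<ge> 1"
    show "coset_map H (lower_central H (k + 1)) \<alpha> \<in> hom (gr_piece G k) (gr_piece H k)"
    proof (rule homI)
      fix A assume "A \<in> carrier (gr_piece G k)"
      then show "coset_map H (lower_central H (k + 1)) \<alpha> A \<in> carrier (gr_piece H k)"
        using k cm G.lower_central_carrier hom_lower_central[OF assms]
        by (auto simp: G.carrier_gr_piece H.carrier_gr_piece simp del: Suc_eq_plus1 add_Suc_right)
      fix B assume "B \<in> carrier (gr_piece G k)"
      with \<open>A \<in> carrier (gr_piece G k)\<close> obtain a b
        where "A = gr_class G k a" "B = gr_class G k b" "a \<in> carrier G" "b \<in> carrier G"
        using k G.lower_central_carrier by (auto simp: G.carrier_gr_piece)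
      then show "coset_map H (lower_central H (k + 1)) \<alpha> (A \<otimes>\<^bsub>gr_piece G k\<^esub> B) =
          coset_map H (lower_central H (k + 1)) \<alpha> A \<otimes>\<^bsub>gr_piece H k\<^esub> coset_map H (lower_central H (k + 1)) \<alpha> B"
        by (simp only: G.gr_class_mult H.gr_class_mult cm G.m_closed hom_mult hom_closed)
    qed
  next
    fix i j :: nat and A B
    assume *: "i \<ge> 1" "j \<ge> 1" "A \<in> carrier (gr_piece G i)" "B \<in> carrier (gr_piece G j)"
    then obtain a b where e: "A = gr_class G i a" "B = gr_class G j b"
      and m: "a \<in> lower_central G i" "b \<in> lower_central G j" by (auto simp: G.carrier_gr_piece)
    have c: "a \<in> carrier G" "b \<in> carrier G" using * m G.lower_central_carrier by auto
    have "\<alpha> a \<in> lower_central H i" "\<alpha> b \<in> lower_central H j"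
      using * m hom_lower_central[OF assms] by auto
    then show "coset_map H (lower_central H (i + j + 1)) \<alpha> (gr_piece_bracket G i j A B) =
        gr_piece_bracket H i j (coset_map H (lower_central H (i + 1)) \<alpha> A) (coset_map H (lower_central H (j + 1)) \<alpha> B)"
      using * m c
      by (simp only: e cm G.gr_piece_bracket_class H.gr_piece_bracket_class G.commutator_closed
          hom_commutator[OF assms])
  qed
qed

section \<open>The split exact sequence for a kernel with the same derived subgroup\<close>

lemma carrier_gr:
  "group G \<Longrightarrow> carrier (gr G) =
    {x \<in> \<Pi>\<^sub>E k\<in>{1..}. carrier (gr_piece G k). finite {k \<in> {1..}. x k \<noteq> \<one>\<^bsub>gr_piece G k\<^esub>}}"
  unfolding gr_eq_lie_sum by (rule lie_pieces.carrier_L[OF lie_pieces_gr])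

lemma one_gr: "\<one>\<^bsub>gr G\<^esub> = (\<lambda>k\<in>{1..}. \<one>\<^bsub>gr_piece G k\<^esub>)"
  by (simp add: gr_def)

lemma carrier_gr_coord:
  "group G \<Longrightarrow> x \<in> carrier (gr G) \<Longrightarrow> k \<ge> 1 \<Longrightarrow> x k \<in> gr_class G k ` lower_central G k"
  by (auto simp: carrier_gr PiE_iff group.carrier_gr_piece [symmetric])

lemma gr_map_coord: "k \<ge> 1 \<Longrightarrow> gr_map H \<alpha> x k = coset_map H (lower_central H (k + 1)) \<alpha> (x k)"
  by (simp add: gr_map_def)

lemma lower_central_integer_group: "k \<ge> 2 \<Longrightarrow> lower_central integer_group k = {0}"
proof (induction k rule: nat_induct_at_least)
  have inv: "inv\<^bsub>integer_group\<^esub> x = - x" for x by simp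
  have c: "group_commutator integer_group x y = 0" for x y
    by (simp add: group_commutator_def)
  have *: "commutator_subgroup integer_group S UNIV \<subseteq> {0}" if "S \<subseteq> UNIV" for S
    using group.triv_subgroup[OF group_integer_group]
    by (intro group.commutator_subgroup_incl[OF group_integer_group]) (auto simp: c)
  have z: "lower_central integer_group (Suc k) = {0}" if "k \<ge> 1" for k
    using * group.lower_central_Suc[OF group_integer_group that]
      subgroup.one_closed[OF group.lower_central_subgroup[OF group_integer_group, of "Suc k"]]
    by auto
  case base show ?case using z[of 1] by (simp add: numeral_2_eq_2)
  case (Suc k) then show ?case using z[of k] by simp
qed

lemma (in group) commutator_restrict:
  assumes "subgroup K G" "x \<in> K" "y \<in> K"
  shows "group_commutator (G\<lparr>carrier := K\<rparr>) x y = group_commutator G x y"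
  using assms m_inv_consistent by (simp add: group_commutator_def)

lemma (in group) derived_eq_lower_central_2: "derived G (carrier G) = lower_central G 2"
proof -
  have "derived_set G (carrier G) = {group_commutator G h k |h k. h \<in> carrier G \<and> k \<in> carrier G}"
    by (auto simp: group_commutator_def)
  then show ?thesis
    using lower_central_Suc[of 1] by (simp add: derived_def commutator_subgroup_def numeral_2_eq_2)
qed

context
  fixes G :: "('a, 'm) monoid_scheme" (structure) and K and N :: "('a, 'm) monoid_scheme"
  assumes G: "group G" and K: "K \<lhd> G"
    and derived_eq: "derived G (carrier G) = derived G K"
  defines "N \<equiv> G\<lparr>carrier := K\<rparr>"
begin

interpretation group G by (rule G)

interpretation K: normal K G by (rule K)

interpretation N: group N
  unfolding N_def by (rule subgroup_imp_group[OF K.subgroup_axioms])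

lemma carrier_N: "carrier N = K" by (simp add: N_def)

lemma kernel_subset_carrier: "x \<in> K \<Longrightarrow> x \<in> carrier G"
  by (rule K.mem_carrier)

lemma lower_central_N_subset: "k \<ge> 1 \<Longrightarrow> lower_central N k \<subseteq> K"
  using N.lower_central_carrier carrier_N by blast

lemma commutator_N: "x \<in> K \<Longrightarrow> y \<in> K \<Longrightarrow> group_commutator N x y = group_commutator G x y"
  unfolding N_def by (rule commutator_restrict[OF K.subgroup_axioms])

lemma lower_central_N_2: "lower_central N 2 = lower_central G 2"
  using derived_eq N.derived_eq_lower_central_2 derived_eq_lower_central_2
    derived_consistent[OF subset_refl K.subgroup_axioms]
  by (simp add: N_def)

lemma lower_central_N_normal:
  assumes "k \<ge> 1" shows "lower_central N k \<lhd> G"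
proof (rule normal_invI)
  show "subgroup (lower_central N k) G"
    using incl_subgroup[OF K.subgroup_axioms] N.lower_central_subgroup[OF assms] by (simp add: N_def)
  fix g x assume g: "g \<in> carrier G" and x: "x \<in> lower_central N k"
  have "(\<lambda>x. g \<otimes> x \<otimes> inv g) \<in> hom N N"
  proof (rule homI)
    show "g \<otimes> x \<otimes> inv g \<in> carrier N" if "x \<in> carrier N" for x
      using normal_conjugate[OF K _ g] that by (simp add: N_def)
    show "g \<otimes> (x \<otimes>\<^bsub>N\<^esub> y) \<otimes> inv g = (g \<otimes> x \<otimes> inv g) \<otimes>\<^bsub>N\<^esub> (g \<otimes> y \<otimes> inv g)"
      if "x \<in> carrier N" "y \<in> carrier N" for x y
      using that g by (simp add: N_def kernel_subset_carrier word_simps)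
  qed
  then show "g \<otimes> x \<otimes> inv g \<in> lower_central N k"
    using hom_lower_central[OF N.group_axioms N.group_axioms _ assms x] by blast
qed

text \<open>\<open>G\<close> acts trivially on \<open>N/N'\<close>, since \<open>(N, G)\<close> lies in \<open>G' = N'\<close>. The induction carries this to the
  higher pieces of \<open>gr N\<close>: for a generator \<open>(y, n)\<close> of the next term, the Hall-Witt identity leaves
  \<open>((n, z), y)\<close> and \<open>((z, y), n)\<close>, up to conjugations, for an element \<open>z\<close> of \<open>G\<close>; here \<open>(n, z)\<close> lies in
  \<open>\<gamma>\<^sub>2 N\<close> and \<open>(z, y)\<close> in \<open>\<gamma>\<^sub>k\<^sub>+\<^sub>1 N\<close>.\<close>

lemma commutator_lower_central_N:
  assumes "k \<ge> 1" "x \<in> lower_central N k" "g \<in> carrier G"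
  shows "group_commutator G x g \<in> lower_central N (Suc k)"
  using assms
proof (induction k arbitrary: x g rule: nat_induct_at_least)
  case base
  then have "x \<in> carrier G" using kernel_subset_carrier by (simp add: carrier_N)
  then have "group_commutator G x g \<in> lower_central G (Suc 1)"
    using commutator_in_lower_central_Suc[of 1 x g] base by simp
  then show ?case using lower_central_N_2 by (simp add: numeral_2_eq_2)
next
  case (Suc k)
  let ?M = "lower_central N (Suc (Suc k))"
  have M: "?M \<lhd> G" by (rule lower_central_N_normal) simp
  interpret M: normal ?M G by (rule M)
  let ?C = "{z \<in> carrier G. \<forall>g\<in>carrier G. group_commutator G z g \<in> ?M}"
  have sC: "subgroup ?C G" by (rule subgroup_centralizing_modulo[OF M subset_refl])
  have lk: "y \<in> K" if "y \<in> lower_central N k" for y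
    using that lower_central_N_subset Suc.hyps by blast
  have "group_commutator G (group_commutator G y n) g \<in> ?M"
    if y: "y \<in> lower_central N k" and n: "n \<in> K" and g: "g \<in> carrier G" for y n g
  proof -
    have c: "y \<in> carrier G" "n \<in> carrier G" using y n lk kernel_subset_carrier by auto
    \<comment> \<open>chosen such that the conjugate by \<open>n\<close> in the Hall-Witt identity is \<open>g\<close>\<close>
    define z where "z = inv n \<otimes> g \<otimes> n"
    have z: "z \<in> carrier G" and nz: "n \<otimes> z \<otimes> inv n = g" using c g by (simp_all add: z_def word_simps)
    let ?b = "group_commutator G (group_commutator G n z) (z \<otimes> y \<otimes> inv z)"
    let ?c = "group_commutator G (group_commutator G z y) (y \<otimes> n \<otimes> inv y)"
    have nz2: "group_commutator G n z \<in> lower_central N 2"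
      using commutator_in_lower_central_Suc[of 1 n z] c z lower_central_N_2 by (simp add: numeral_2_eq_2)
    have zy: "z \<otimes> y \<otimes> inv z \<in> lower_central N k"
      using lower_central_N_normal[OF Suc.hyps(1)] y z by (rule normal_conjugate)
    have "group_commutator N (group_commutator G n z) (z \<otimes> y \<otimes> inv z) \<in> ?M"
      using N.commutator_lower_central[of 2 k, OF _ Suc.hyps nz2 zy] by simp
    then have b: "?b \<in> ?M" using lower_central_N_subset[of 2] nz2 lk[OF zy] by (subst (asm) commutator_N) auto
    have "group_commutator G y z \<in> lower_central N (Suc k)" by (rule Suc.IH[OF y z])
    then have "inv (group_commutator G y z) \<in> lower_central N (Suc k)"
      using normal_imp_subgroup[OF lower_central_N_normal[of "Suc k"]] subgroup.m_inv_closed by fastforce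
    then have zy1: "group_commutator G z y \<in> lower_central N (Suc k)" using c z by (simp add: inv_commutator)
    have yn: "y \<otimes> n \<otimes> inv y \<in> K" using K n c(1) by (rule normal_conjugate)
    then have "group_commutator N (group_commutator G z y) (y \<otimes> n \<otimes> inv y) \<in> ?M"
      using N.commutator_in_lower_central_Suc[OF _ zy1] by (simp add: carrier_N)
    then have c': "?c \<in> ?M"
      using lower_central_N_subset[of "Suc k"] zy1 yn by (subst (asm) commutator_N) auto
    have "group_commutator G (group_commutator G y n) g \<otimes> ?b \<otimes> ?c = \<one>"
      using Hall_Witt[OF c z] unfolding nz .
    then have "group_commutator G (group_commutator G y n) g = inv (?b \<otimes> ?c)"
      using c g z by (intro inv_equality[symmetric]) (auto simp: m_assoc)
    moreover have "inv (?b \<otimes> ?c) \<in> ?M"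
      by (intro subgroup.m_inv_closed[OF M.subgroup_axioms] subgroup.m_closed[OF M.subgroup_axioms] b c')
    ultimately show ?thesis by simp
  qed
  then have gen: "group_commutator N y n \<in> ?C \<inter> K" if "y \<in> lower_central N k" "n \<in> K" for y n
    using that lk kernel_subset_carrier N.commutator_closed[of y n] by (simp add: commutator_N carrier_N)
  have "subgroup (?C \<inter> K) N"
    using subgroups_Inter_pair[OF sC K.subgroup_axioms] unfolding N_def
    by (intro subgroup_incl K.subgroup_axioms) auto
  then have "lower_central N (Suc k) \<subseteq> ?C \<inter> K"
    unfolding N.lower_central_Suc[OF Suc.hyps]
    using gen lk by (intro N.commutator_subgroup_incl) (auto simp: carrier_N)
  then show ?case using Suc.prems by auto
qed

lemma lower_central_N_eq:
  assumes "k \<ge> 2" shows "lower_central N k = lower_central G k"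
  using assms
proof (induction k rule: nat_induct_at_least)
  case base show ?case by (rule lower_central_N_2)
next
  case (Suc k)
  have k: "k \<ge> 1" using Suc by simp
  have "id \<in> hom N G" using kernel_subset_carrier by (auto simp: hom_def N_def)
  then have "lower_central N (Suc k) \<subseteq> lower_central G (Suc k)"
    using hom_lower_central[OF N.group_axioms group_axioms, of id "Suc k"] by auto
  moreover have "lower_central G (Suc k) \<subseteq> lower_central N (Suc k)"
    unfolding lower_central_Suc[OF k] Suc.IH[symmetric]
    using commutator_lower_central_N[OF k] lower_central_N_subset[OF k] kernel_subset_carrier
      normal_imp_subgroup[OF lower_central_N_normal[of "Suc k"]]
    by (intro commutator_subgroup_incl) auto
  ultimately show ?case by blast
qed

lemma gr_class_N: "k \<ge> 1 \<Longrightarrow> gr_class N k x = gr_class G k x"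
  by (simp add: gr_class_def lower_central_N_eq N_def[symmetric]) (simp add: N_def r_coset_def)

lemma one_gr_piece_N: "k \<ge> 1 \<Longrightarrow> \<one>\<^bsub>gr_piece N k\<^esub> = \<one>\<^bsub>gr_piece G k\<^esub>"
  using N.one_gr_piece[of k] one_gr_piece[of k] gr_class_N[of k] by (simp add: N_def)

text \<open>As \<open>\<gamma>\<^sub>k N = \<gamma>\<^sub>k G\<close> for \<open>k \<ge> 2\<close>, the cosets that represent classes in \<open>gr N\<close> and in \<open>gr G\<close> are the same
  sets, so \<open>gr_map G \<iota>\<close> is the identity on \<open>gr N\<close>. Since \<open>gr \<int>\<close> is concentrated in degree 1, an element
  lies in the kernel of \<open>gr \<chi>\<close> if and only if its component of degree 1 is represented by an element
  of \<open>K\<close>.\<close>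

theorem split_exact_gr:
  assumes \<chi>: "\<chi> \<in> epi G integer_group" and ker: "K = kernel G integer_group \<chi>"
    and \<iota>: "\<And>x. x \<in> K \<Longrightarrow> \<iota> x = x"
  shows "split_exact_graded_lie (gr N) (gr_map G \<iota>) (gr G) (gr_map integer_group \<chi>) (gr integer_group)"
proof -
  let ?Z = integer_group
  have \<chi>h: "\<chi> \<in> hom G ?Z" and \<chi>s: "\<chi> ` carrier G = UNIV" using \<chi> by (simp_all add: epi_def)
  note gZ = group_integer_group
  have Kchi: "x \<in> K \<longleftrightarrow> x \<in> carrier G \<and> \<chi> x = 0" for x unfolding ker kernel_def by simp
  have \<iota>h: "\<iota> \<in> hom N G"
    by (auto simp: hom_def N_def \<iota> kernel_subset_carrier)
  \<comment> \<open>the powers of \<open>t\<close> give the splitting\<close>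
  obtain t where t: "t \<in> carrier G" "\<chi> t = 1" using \<chi>s by (metis UNIV_I imageE)
  have sh: "(\<lambda>n::int. t [^] n) \<in> hom ?Z G" using t by (auto simp: hom_def int_pow_mult)
  have \<chi>t: "\<chi> (t [^] n) = n" for n :: int
    using hom_int_pow[OF \<chi>h t(1) group_axioms gZ] t by simp
  have \<iota>id: "gr_map G \<iota> x = x" if x: "x \<in> carrier (gr N)" for x
  proof (rule extensionalityI[of _ "{1..}"])
    show "gr_map G \<iota> x \<in> extensional {1..}" by (simp add: gr_map_def)
    show "x \<in> extensional {1..}" using x by (auto simp: carrier_gr[OF N.group_axioms] PiE_def)
    fix k :: nat assume k: "k \<in> {1..}"
    then obtain a where a: "x k = gr_class N k a" "a \<in> lower_central N k"
      using carrier_gr_coord[OF N.group_axioms x] by auto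
    then have "a \<in> K" using lower_central_N_subset k by auto
    then show "gr_map G \<iota> x k = x k"
      using k coset_map_gr_class[OF N.group_axioms group_axioms \<iota>h, of a k] \<iota> gr_class_N[of k a]
      by (simp add: gr_map_coord a carrier_N)
  qed
  have f: "gr_map G \<iota> \<in> graded_lie_hom (gr N) (gr G)"
    by (rule gr_map_graded_lie_hom[OF N.group_axioms group_axioms \<iota>h])
  have g: "gr_map ?Z \<chi> \<in> graded_lie_hom (gr G) (gr ?Z)"
    by (rule gr_map_graded_lie_hom[OF group_axioms gZ \<chi>h])
  have s: "gr_map G (\<lambda>n::int. t [^] n) \<in> graded_lie_hom (gr ?Z) (gr G)"
    by (rule gr_map_graded_lie_hom[OF gZ group_axioms sh])
  have gs: "gr_map ?Z \<chi> (gr_map G (\<lambda>n::int. t [^] n) z) = z" if z: "z \<in> carrier (gr ?Z)" for z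
  proof (rule extensionalityI[of _ "{1..}"])
    show "z \<in> extensional {1..}" using z by (auto simp: carrier_gr[OF gZ] PiE_def)
    fix k :: nat assume k: "k \<in> {1..}"
    then obtain a where "z k = gr_class ?Z k a" using carrier_gr_coord[OF gZ z] by auto
    then show "gr_map ?Z \<chi> (gr_map G (\<lambda>n::int. t [^] n) z) k = z k"
      using k coset_map_gr_class[OF gZ group_axioms sh, of a k] t
        coset_map_gr_class[OF group_axioms gZ \<chi>h, of "t [^] a" k]
      by (simp add: gr_map_coord \<chi>t)
  qed (simp add: gr_map_def)
  have surj: "gr_map ?Z \<chi> ` carrier (gr G) = carrier (gr ?Z)"
  proof
    show "gr_map ?Z \<chi> ` carrier (gr G) \<subseteq> carrier (gr ?Z)"
      using g by (auto simp: graded_lie_hom_def hom_def)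
    show "carrier (gr ?Z) \<subseteq> gr_map ?Z \<chi> ` carrier (gr G)"
    proof
      fix z assume z: "z \<in> carrier (gr ?Z)"
      have "gr_map G (\<lambda>n::int. t [^] n) z \<in> carrier (gr G)"
        using s z by (auto simp: graded_lie_hom_def hom_def)
      then show "z \<in> gr_map ?Z \<chi> ` carrier (gr G)" using gs[OF z] by (metis imageI)
    qed
  qed
  have im: "gr_map G \<iota> ` carrier (gr N) = carrier (gr N)" using \<iota>id by simp
  have ker_gr: "kernel (gr G) (gr ?Z) (gr_map ?Z \<chi>) = carrier (gr N)"
  proof (intro subset_antisym subsetI)
    fix x assume x: "x \<in> carrier (gr N)"
    have "gr_map G \<iota> x \<in> carrier (gr G)" using f x by (auto simp: graded_lie_hom_def hom_def)
    then have xG: "x \<in> carrier (gr G)" by (simp add: \<iota>id[OF x])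
    have "gr_map ?Z \<chi> x = \<one>\<^bsub>gr ?Z\<^esub>"
    proof (rule extensionalityI[of _ "{1..}"])
      fix k :: nat assume k: "k \<in> {1..}"
      then obtain a where a: "x k = gr_class N k a" "a \<in> lower_central N k"
        using carrier_gr_coord[OF N.group_axioms x] by auto
      then have "a \<in> K" using lower_central_N_subset k by auto
      then show "gr_map ?Z \<chi> x k = \<one>\<^bsub>gr ?Z\<^esub> k"
        using k coset_map_gr_class[OF group_axioms gZ \<chi>h, of a k] gr_class_N[of k a]
        by (simp add: gr_map_coord a Kchi one_gr group.one_gr_piece[OF gZ])
    qed (simp_all add: gr_map_def one_gr)
    with xG show "x \<in> kernel (gr G) (gr ?Z) (gr_map ?Z \<chi>)" by (simp add: kernel_def)
  next
    fix y assume "y \<in> kernel (gr G) (gr ?Z) (gr_map ?Z \<chi>)"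
    then have y: "y \<in> carrier (gr G)" and g1: "gr_map ?Z \<chi> y = \<one>\<^bsub>gr ?Z\<^esub>" by (auto simp: kernel_def)
    have yk: "y k \<in> carrier (gr_piece N k)" if k: "k \<ge> 1" for k
    proof -
      obtain a where a: "y k = gr_class G k a" "a \<in> lower_central G k"
        using carrier_gr_coord[OF group_axioms y k] by auto
      have "a \<in> lower_central N k"
      proof (cases "k = 1")
        case False
        then show ?thesis using a lower_central_N_eq k by simp
      next
        case True
        with a have ac: "a \<in> carrier G" by simp
        have "gr_map ?Z \<chi> y 1 = gr_class ?Z 1 (\<chi> a)"
          using a True coset_map_gr_class[OF group_axioms gZ \<chi>h ac, of 1] by (simp add: gr_map_coord)
        then have "gr_class ?Z 1 (\<chi> a) = \<one>\<^bsub>gr_piece ?Z 1\<^esub>"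
          using g1 by (simp add: one_gr)
        then have "\<chi> a = 0"
          using group.gr_class_eq_one[OF gZ, of "\<chi> a" 1] lower_central_integer_group[of 2]
          by (simp add: numeral_2_eq_2)
        then show ?thesis using ac True by (simp add: carrier_N Kchi)
      qed
      then show ?thesis using a gr_class_N[OF k] by (auto simp: N.carrier_gr_piece)
    qed
    have "{k \<in> {1..}. y k \<noteq> \<one>\<^bsub>gr_piece N k\<^esub>} = {k \<in> {1..}. y k \<noteq> \<one>\<^bsub>gr_piece G k\<^esub>}"
      using one_gr_piece_N by auto
    with y yk show "y \<in> carrier (gr N)"
      by (auto simp: carrier_gr[OF group_axioms] carrier_gr[OF N.group_axioms] PiE_iff)
  qed
  show ?thesis
    unfolding split_exact_graded_lie_def
    using f g s gs surj ker_gr im graded_lie_algebra_gr[OF N.group_axioms] graded_lie_algebra_gr[OF group_axioms]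
      graded_lie_algebra_gr[OF gZ]
    by (auto intro: inj_onI simp: \<iota>id)
qed

end

section \<open>Groups given by generators and relations\<close>

text \<open>Membership in \<open>lists (S \<times> UNIV)\<close> is kept in this form, as in the rules of \<open>presentation_rel\<close>.\<close>

declare in_lists_conv_set [simp del]

definition inverse_word :: "'x word \<Rightarrow> 'x word" where
  "inverse_word w = rev (map (\<lambda>(x, b). (x, \<not> b)) w)"

definition word_class :: "'x set \<Rightarrow> ('x word \<times> 'x word) set \<Rightarrow> 'x word \<Rightarrow> 'x word set" where
  "word_class S R w = presentation_rel S R `` {w}"

abbreviation generator :: "'x set \<Rightarrow> ('x word \<times> 'x word) set \<Rightarrow> 'x \<Rightarrow> 'x word set" where
  "generator S R x \<equiv> word_class S R [(x, True)]"

lemma inverse_word_simps [simp]: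
  "inverse_word [] = []" "inverse_word ((x, b) # w) = inverse_word w @ [(x, \<not> b)]"
  "inverse_word (inverse_word w) = w"
  by (simp_all add: inverse_word_def rev_map comp_def case_prod_beta)

lemma inverse_word_in_lists: "w \<in> lists (S \<times> UNIV) \<Longrightarrow> inverse_word w \<in> lists (S \<times> UNIV)"
  by (induction w) auto

lemma presentation_rel_words:
  assumes "(u, v) \<in> presentation_rel S R"
  shows "u \<in> lists (S \<times> UNIV)" "v \<in> lists (S \<times> UNIV)"
  using assms by (induction rule: presentation_rel.induct) auto

lemma equiv_presentation_rel: "equiv (lists (S \<times> UNIV)) (presentation_rel S R)"
proof (rule equivI)
  show "presentation_rel S R \<subseteq> lists (S \<times> UNIV) \<times> lists (S \<times> UNIV)"
    using presentation_rel_words by (metis mem_Sigma_iff subrelI)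
  show "refl_on (lists (S \<times> UNIV)) (presentation_rel S R)"
    using presentation_rel.refl by (auto simp: refl_on_def)
  show "sym (presentation_rel S R)" using presentation_rel.sym by (auto simp: sym_def)
  show "trans (presentation_rel S R)" by (rule transI) (rule presentation_rel.trans)
qed

lemma presentation_rel_context:
  assumes "(u, v) \<in> presentation_rel S R" "p \<in> lists (S \<times> UNIV)" "q \<in> lists (S \<times> UNIV)"
  shows "(p @ u @ q, p @ v @ q) \<in> presentation_rel S R"
  using assms
proof (induction rule: presentation_rel.induct)
  case (refl w)
  then show ?case by (intro presentation_rel.refl) auto
next
  case (cancel p' q' x b)
  then show ?case using presentation_rel.cancel[of "p @ p'" S "q' @ q" x b R] by simp
next
  case (relator p' q' u v)
  then show ?case using presentation_rel.relator[of "p @ p'" S "q' @ q" u v R] by simp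
qed (auto intro: presentation_rel.sym presentation_rel.trans)

lemma presentation_rel_append:
  assumes u: "(u, u') \<in> presentation_rel S R" and v: "(v, v') \<in> presentation_rel S R"
  shows "(u @ v, u' @ v') \<in> presentation_rel S R"
proof (rule presentation_rel.trans)
  show "(u @ v, u' @ v) \<in> presentation_rel S R"
    using presentation_rel_context[OF u, of "[]" v] presentation_rel_words[OF v] by simp
  show "(u' @ v, u' @ v') \<in> presentation_rel S R"
    using presentation_rel_context[OF v, of u' "[]"] presentation_rel_words[OF u] by simp
qed

lemma presentation_rel_inverse:
  "w \<in> lists (S \<times> UNIV) \<Longrightarrow> (w @ inverse_word w, []) \<in> presentation_rel S R"
proof (induction w)
  case Nil
  then show ?case by (simp add: presentation_rel.refl)
next
  case (Cons a w)
  obtain x b where a: "a = (x, b)" by force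
  have x: "x \<in> S" and w: "w \<in> lists (S \<times> UNIV)" using Cons.prems by (auto simp: a)
  have "([(x, b)] @ (w @ inverse_word w) @ [(x, \<not> b)], [(x, b)] @ [] @ [(x, \<not> b)]) \<in> presentation_rel S R"
    using Cons.IH[OF w] x by (intro presentation_rel_context) auto
  moreover have "([] @ [(x, b), (x, \<not> b)] @ [], [] @ []) \<in> presentation_rel S R"
    using x by (intro presentation_rel.cancel) auto
  ultimately show ?case by (auto simp: a intro: presentation_rel.trans)
qed

lemma word_class_eq_iff:
  "u \<in> lists (S \<times> UNIV) \<Longrightarrow> v \<in> lists (S \<times> UNIV)
    \<Longrightarrow> word_class S R u = word_class S R v \<longleftrightarrow> (u, v) \<in> presentation_rel S R"
  unfolding word_class_def using eq_equiv_class_iff[OF equiv_presentation_rel] by metis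

lemma in_word_class: "u \<in> lists (S \<times> UNIV) \<Longrightarrow> u \<in> word_class S R u"
  by (simp add: word_class_def presentation_rel.refl)

lemma carrier_presented_group: "carrier (presented_group S R) = word_class S R ` lists (S \<times> UNIV)"
  by (auto simp: presented_group_def quotient_def word_class_def)

lemma one_presented_group: "\<one>\<^bsub>presented_group S R\<^esub> = word_class S R []"
  by (simp add: presented_group_def word_class_def)

lemma mult_presented_group:
  assumes "u \<in> lists (S \<times> UNIV)" "v \<in> lists (S \<times> UNIV)"
  shows "word_class S R u \<otimes>\<^bsub>presented_group S R\<^esub> word_class S R v = word_class S R (u @ v)"
proof -
  have "word_class S R (u' @ v') = word_class S R (u @ v)"
    if "u' \<in> word_class S R u" "v' \<in> word_class S R v" for u' v'
  proof -
    have "(u @ v, u' @ v') \<in> presentation_rel S R"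
      using that by (intro presentation_rel_append) (auto simp: word_class_def)
    then show ?thesis using presentation_rel_words by (metis word_class_eq_iff)
  qed
  then have "word_class S R u \<otimes>\<^bsub>presented_group S R\<^esub> word_class S R v =
      (\<Union>u'\<in>word_class S R u. \<Union>v'\<in>word_class S R v. word_class S R (u @ v))"
    by (simp add: presented_group_def word_class_def)
  then show ?thesis using in_word_class[OF assms(1)] in_word_class[OF assms(2)] by blast
qed

lemma group_presented_group: "group (presented_group S R)"
proof (rule groupI)
  let ?G = "presented_group S R"
  show "x \<otimes>\<^bsub>?G\<^esub> y \<in> carrier ?G" if "x \<in> carrier ?G" "y \<in> carrier ?G" for x y
    using that unfolding carrier_presented_group
    by (elim imageE) (simp add: mult_presented_group imageI)
  show "\<one>\<^bsub>?G\<^esub> \<in> carrier ?G" by (auto simp: carrier_presented_group one_presented_group)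
  show "x \<otimes>\<^bsub>?G\<^esub> y \<otimes>\<^bsub>?G\<^esub> z = x \<otimes>\<^bsub>?G\<^esub> (y \<otimes>\<^bsub>?G\<^esub> z)"
    if "x \<in> carrier ?G" "y \<in> carrier ?G" "z \<in> carrier ?G" for x y z
    using that unfolding carrier_presented_group
    by (elim imageE) (simp add: mult_presented_group)
  show "\<one>\<^bsub>?G\<^esub> \<otimes>\<^bsub>?G\<^esub> x = x" if "x \<in> carrier ?G" for x
    using that unfolding carrier_presented_group one_presented_group
    by (elim imageE) (simp add: mult_presented_group)
  show "\<exists>y\<in>carrier ?G. y \<otimes>\<^bsub>?G\<^esub> x = \<one>\<^bsub>?G\<^esub>" if x: "x \<in> carrier ?G" for x
  proof -
    obtain w where w: "w \<in> lists (S \<times> UNIV)" "x = word_class S R w"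
      using x unfolding carrier_presented_group by blast
    note iw = inverse_word_in_lists[OF w(1)]
    have "(inverse_word w @ w, []) \<in> presentation_rel S R"
      using presentation_rel_inverse[OF iw, of R] by simp
    then have "word_class S R (inverse_word w) \<otimes>\<^bsub>?G\<^esub> x = \<one>\<^bsub>?G\<^esub>"
      unfolding w(2) mult_presented_group[OF iw w(1)] one_presented_group
      using presentation_rel_words by (metis word_class_eq_iff)
    then show ?thesis using iw unfolding carrier_presented_group by blast
  qed
qed

lemma generator_closed: "x \<in> S \<Longrightarrow> generator S R x \<in> carrier (presented_group S R)"
  by (auto simp: carrier_presented_group)

lemma presented_group_generated:
  "carrier (presented_group S R) = generate (presented_group S R) (generator S R ` S)"
proof
  interpret group "presented_group S R" by (rule group_presented_group)
  let ?G = "presented_group S R"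
  show "generate ?G (generator S R ` S) \<subseteq> carrier ?G"
    by (rule generate_incl) (auto intro: generator_closed)
  have "word_class S R w \<in> generate ?G (generator S R ` S)" if "w \<in> lists (S \<times> UNIV)" for w
    using that
  proof (induction w rule: list.induct)
    case Nil
    then show ?case using generate.one[of ?G] by (simp add: one_presented_group)
  next
    case (Cons a w)
    obtain x b where a: "a = (x, b)" by force
    have x: "x \<in> S" and w: "w \<in> lists (S \<times> UNIV)" using Cons.prems by (simp_all add: a)
    have g: "generator S R x \<in> generate ?G (generator S R ` S)" using x by (intro generate.incl) auto
    have "word_class S R [a] \<in> generate ?G (generator S R ` S)"
    proof (cases b)
      case True then show ?thesis using g a by simp
    next
      case False
      have "([] @ [(x, False), (x, \<not> False)] @ [], [] @ []) \<in> presentation_rel S R"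
        using x by (intro presentation_rel.cancel) auto
      then have "word_class S R [(x, False), (x, True)] = \<one>\<^bsub>?G\<^esub>"
        using x unfolding one_presented_group by (subst word_class_eq_iff) auto
      then have "word_class S R [(x, False)] \<otimes>\<^bsub>?G\<^esub> generator S R x = \<one>\<^bsub>?G\<^esub>"
        using x by (subst mult_presented_group) auto
      moreover have "word_class S R [(x, False)] \<in> carrier ?G" using x by (auto simp: carrier_presented_group)
      ultimately have "inv\<^bsub>?G\<^esub> generator S R x = word_class S R [(x, False)]"
        using generator_closed[OF x, of R] inv_equality by blast
      then show ?thesis using False a x generate.inv[of "generator S R x" "generator S R ` S" ?G] by auto
    qed
    then have "word_class S R [a] \<otimes>\<^bsub>?G\<^esub> word_class S R w \<in> generate ?G (generator S R ` S)"
      using Cons.IH[OF w] by (rule generate.eng)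
    moreover have "[a] \<in> lists (S \<times> UNIV)" using x a by auto
    ultimately show ?case using w by (simp add: mult_presented_group)
  qed
  then show "carrier ?G \<subseteq> generate ?G (generator S R ` S)" by (auto simp: carrier_presented_group)
qed

context group
begin

fun word_value :: "('x \<Rightarrow> 'a) \<Rightarrow> 'x word \<Rightarrow> 'a" where
  "word_value f [] = \<one>"
| "word_value f ((x, b) # w) = (if b then f x else inv (f x)) \<otimes> word_value f w"

lemma word_value_closed:
  assumes "f \<in> S \<rightarrow> carrier G" "w \<in> lists (S \<times> UNIV)" shows "word_value f w \<in> carrier G"
  using assms(2)
proof (induction w rule: list.induct)
  case (Cons a w)
  then show ?case using assms(1) by (cases a) auto
qed simp

lemma word_value_append:
  "f \<in> S \<rightarrow> carrier G \<Longrightarrow> u \<in> lists (S \<times> UNIV) \<Longrightarrow> v \<in> lists (S \<times> UNIV)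
    \<Longrightarrow> word_value f (u @ v) = word_value f u \<otimes> word_value f v"
proof (induction u)
  case (Cons a u)
  obtain x b where a: "a = (x, b)" by force
  have "f x \<in> carrier G" "u \<in> lists (S \<times> UNIV)" using Cons.prems by (auto simp: a)
  then show ?case using Cons word_value_closed[OF Cons.prems(1)]
    by (simp add: a m_assoc)
qed (simp add: word_value_closed)

lemma word_value_presentation_rel:
  assumes f: "f \<in> S \<rightarrow> carrier G"
    and R: "\<And>u v. \<lbrakk>(u, v) \<in> R; u \<in> lists (S \<times> UNIV); v \<in> lists (S \<times> UNIV)\<rbrakk> \<Longrightarrow> word_value f u = word_value f v"
    and "(u, v) \<in> presentation_rel S R"
  shows "word_value f u = word_value f v"
  using assms(3)
proof (induction rule: presentation_rel.induct)
  case (cancel p q x b)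
  have x: "f x \<in> carrier G" using f cancel by auto
  have "word_value f ([(x, b), (x, \<not> b)] @ q) = word_value f q"
    using x word_value_closed[OF f cancel(2)] by simp
  then show ?case using cancel(1-3)
    by (simp add: word_value_append[OF f] del: append_Cons append_Nil word_value.simps)
next
  case (relator p q u v)
  then show ?case using R[OF relator(3-5)]
    by (simp add: word_value_append[OF f])
qed auto

text \<open>Existence in the universal property of a presentation: evaluating words with \<open>f\<close> respects
  cancellation in every group, and the relators by assumption.\<close>

theorem presented_group_universal:
  assumes f: "f \<in> S \<rightarrow> carrier G"
    and R: "\<And>u v. \<lbrakk>(u, v) \<in> R; u \<in> lists (S \<times> UNIV); v \<in> lists (S \<times> UNIV)\<rbrakk> \<Longrightarrow> word_value f u = word_value f v"
  obtains h where "h \<in> hom (presented_group S R) G" "\<And>x. x \<in> S \<Longrightarrow> h (generator S R x) = f x"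
proof
  define h where "h A = word_value f (SOME w. w \<in> A)" for A
  have h: "h (word_class S R w) = word_value f w" if w: "w \<in> lists (S \<times> UNIV)" for w
  proof -
    have "(SOME w'. w' \<in> word_class S R w) \<in> word_class S R w"
      using in_word_class[OF w, of R] by (rule someI)
    then have "(w, SOME w'. w' \<in> word_class S R w) \<in> presentation_rel S R" by (simp add: word_class_def)
    from word_value_presentation_rel[OF f R this] show ?thesis by (simp add: h_def)
  qed
  show "h \<in> hom (presented_group S R) G"
  proof (rule homI)
    show "h A \<in> carrier G" if "A \<in> carrier (presented_group S R)" for A
      using that unfolding carrier_presented_group
      by (elim imageE) (simp add: h word_value_closed[OF f])
    show "h (A \<otimes>\<^bsub>presented_group S R\<^esub> B) = h A \<otimes> h B"
      if "A \<in> carrier (presented_group S R)" "B \<in> carrier (presented_group S R)" for A B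
      using that unfolding carrier_presented_group
      by (elim imageE) (simp add: mult_presented_group h word_value_append[OF f])
  qed
  show "h (generator S R x) = f x" if "x \<in> S" for x
    using that f by (subst h) (auto simp: Pi_iff)
qed

end

lemma hom_eq_on_generate:
  assumes "group G" "group H" "h \<in> hom G H" "h' \<in> hom G H" "A \<subseteq> carrier G"
    and "\<And>x. x \<in> A \<Longrightarrow> h x = h' x" "x \<in> generate G A"
  shows "h x = h' x"
proof -
  interpret h: group_hom G H h using assms by (simp add: group_hom_def group_hom_axioms_def)
  interpret h': group_hom G H h' using assms by (simp add: group_hom_def group_hom_axioms_def)
  show ?thesis using assms(7)
  proof (induction rule: generate.induct)
    case (eng x y)
    then have "x \<in> carrier G" "y \<in> carrier G" using h.G.generate_in_carrier[OF assms(5)] by auto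
    with eng show ?case by simp
  qed (use assms in auto)
qed

section \<open>Right-angled Artin groups\<close>

definition vertex_gen :: "'v set \<Rightarrow> 'v set set \<Rightarrow> 'v \<Rightarrow> 'v word set" where
  "vertex_gen V E = generator V {([(u, True), (v, True)], [(v, True), (u, True)]) | u v. {u, v} \<in> E}"

lemma group_raag: "group (raag V E)"
  unfolding raag_def by (rule group_presented_group)

lemma vertex_gen_closed: "v \<in> V \<Longrightarrow> vertex_gen V E v \<in> carrier (raag V E)"
  unfolding raag_def vertex_gen_def by (rule generator_closed)

lemma raag_generated: "carrier (raag V E) = generate (raag V E) (vertex_gen V E ` V)"
  unfolding raag_def vertex_gen_def by (rule presented_group_generated)

lemma vertex_gen_commute:
  assumes "u \<in> V" "v \<in> V" "{u, v} \<in> E"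
  shows "vertex_gen V E u \<otimes>\<^bsub>raag V E\<^esub> vertex_gen V E v = vertex_gen V E v \<otimes>\<^bsub>raag V E\<^esub> vertex_gen V E u"
proof -
  let ?R = "{([(u, True), (v, True)], [(v, True), (u, True)]) | u v. {u, v} \<in> E}"
  have "([] @ [(u, True), (v, True)] @ [], [] @ [(v, True), (u, True)] @ []) \<in> presentation_rel V ?R"
    using assms by (intro presentation_rel.relator) auto
  then have "word_class V ?R [(u, True), (v, True)] = word_class V ?R [(v, True), (u, True)]"
    using assms by (subst word_class_eq_iff) auto
  then show ?thesis unfolding raag_def vertex_gen_def using assms
    by (simp add: mult_presented_group)
qed

lemma raag_universal:
  assumes "group H" "f \<in> V \<rightarrow> carrier H"
    and "\<And>u v. \<lbrakk>u \<in> V; v \<in> V; {u, v} \<in> E\<rbrakk> \<Longrightarrow> f u \<otimes>\<^bsub>H\<^esub> f v = f v \<otimes>\<^bsub>H\<^esub> f u"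
  obtains h where "h \<in> hom (raag V E) H" "\<And>v. v \<in> V \<Longrightarrow> h (vertex_gen V E v) = f v"
proof -
  interpret H: group H by fact
  have f: "f v \<in> carrier H" if "v \<in> V" for v using assms(2) that by auto
  show ?thesis
    unfolding raag_def vertex_gen_def
  proof (rule H.presented_group_universal[OF assms(2)])
    let ?R = "{([(u, True), (v, True)], [(v, True), (u, True)]) | u v. {u, v} \<in> E}"
    show "H.word_value f u = H.word_value f v"
      if "(u, v) \<in> ?R" "u \<in> lists (V \<times> UNIV)" "v \<in> lists (V \<times> UNIV)" for u v
      using that f assms(3) by auto
    fix h assume "h \<in> hom (presented_group V ?R) H" "\<And>v. v \<in> V \<Longrightarrow> h (generator V ?R v) = f v"
    then show thesis by (intro that[of h]) (simp_all add: raag_def vertex_gen_def)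
  qed
qed

text \<open>The pair \<open>(z, n)\<close> stands for the affine map \<open>w \<mapsto> z + \<zeta>\<^sup>n w\<close>. The exponent is recorded instead of
  its power, so that the projection to \<open>\<int>\<close> is defined also if \<open>\<zeta>\<close> is a root of unity.\<close>

definition affine_group :: "complex \<Rightarrow> (complex \<times> int) monoid" where
  "affine_group \<zeta> = \<lparr>carrier = UNIV,
     monoid.mult = (\<lambda>x y. (fst x + \<zeta> powi snd x * fst y, snd x + snd y)), one = (0, 0)\<rparr>"

lemma group_affine_group: "\<zeta> \<noteq> 0 \<Longrightarrow> group (affine_group \<zeta>)"
proof (rule groupI)
  assume z: "\<zeta> \<noteq> 0"
  show "\<exists>y\<in>carrier (affine_group \<zeta>). y \<otimes>\<^bsub>affine_group \<zeta>\<^esub> x = \<one>\<^bsub>affine_group \<zeta>\<^esub>" for x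
    by (rule bexI[of _ "(- (\<zeta> powi (- snd x) * fst x), - snd x)"]) (auto simp: affine_group_def)
qed (auto simp: affine_group_def power_int_add algebra_simps)

text \<open>A crossed homomorphism is the first coordinate of a homomorphism to the affine group over \<open>\<chi>\<close>. The
  condition on \<open>c\<close> says that the images of adjacent vertices commute.\<close>

lemma raag_crossed_hom:
  fixes c :: "'v \<Rightarrow> complex"
  assumes \<chi>: "\<chi> \<in> hom (raag V E) integer_group" and \<zeta>: "\<zeta> \<noteq> 0"
    and c: "\<And>u v. \<lbrakk>u \<in> V; v \<in> V; {u, v} \<in> E\<rbrakk> \<Longrightarrow>
      (1 - \<zeta> powi \<chi> (vertex_gen V E u)) * c v = (1 - \<zeta> powi \<chi> (vertex_gen V E v)) * c u"
  obtains D where "\<And>v. v \<in> V \<Longrightarrow> D (vertex_gen V E v) = c v"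
    "\<And>g h. \<lbrakk>g \<in> carrier (raag V E); h \<in> carrier (raag V E)\<rbrakk>
      \<Longrightarrow> D (g \<otimes>\<^bsub>raag V E\<^esub> h) = D g + \<zeta> powi \<chi> g * D h"
proof -
  let ?G = "raag V E" and ?x = "vertex_gen V E"
  obtain h where h: "h \<in> hom ?G (affine_group \<zeta>)" "\<And>v. v \<in> V \<Longrightarrow> h (?x v) = (c v, \<chi> (?x v))"
  proof (rule raag_universal[OF group_affine_group[OF \<zeta>], of "\<lambda>v. (c v, \<chi> (?x v))" V E])
    show "(\<lambda>v. (c v, \<chi> (?x v))) \<in> V \<rightarrow> carrier (affine_group \<zeta>)" by (simp add: affine_group_def)
    fix u v assume "u \<in> V" "v \<in> V" "{u, v} \<in> E"
    from c[OF this] show "(c u, \<chi> (?x u)) \<otimes>\<^bsub>affine_group \<zeta>\<^esub> (c v, \<chi> (?x v)) =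
        (c v, \<chi> (?x v)) \<otimes>\<^bsub>affine_group \<zeta>\<^esub> (c u, \<chi> (?x u))"
      by (simp add: affine_group_def algebra_simps)
  qed blast
  have "snd \<circ> h \<in> hom ?G integer_group"
    using h(1) by (auto simp: hom_def affine_group_def integer_group_def)
  then have "(snd \<circ> h) g = \<chi> g" if "g \<in> carrier ?G" for g
  proof (rule hom_eq_on_generate[OF group_raag group_integer_group _ \<chi>])
    show "?x ` V \<subseteq> carrier ?G" by (auto intro: vertex_gen_closed)
    show "g \<in> generate ?G (?x ` V)" using that raag_generated[of V E] by simp
    show "(snd \<circ> h) x = \<chi> x" if "x \<in> ?x ` V" for x using that h(2) by auto
  qed
  then have "(fst \<circ> h) (g \<otimes>\<^bsub>?G\<^esub> k) = (fst \<circ> h) g + \<zeta> powi \<chi> g * (fst \<circ> h) k"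
    if "g \<in> carrier ?G" "k \<in> carrier ?G" for g k
    using that hom_mult[OF h(1), of g k] by (simp add: affine_group_def)
  then show ?thesis using h(2) by (intro that[of "fst \<circ> h"]) auto
qed

section \<open>Trivial action on first homology\<close>

text \<open>An additive function on the group is a 1-cocycle with trivial coefficients; this is its pairing with
  the 1-chains of the bar complex, whose basis elements are the lists of length 1.\<close>

definition chain_eval :: "('a \<Rightarrow> complex) \<Rightarrow> ('a list \<Rightarrow>\<^sub>0 rat) \<Rightarrow> complex" where
  "chain_eval \<psi> c = (\<Sum>w\<in>Poly_Mapping.keys c. of_rat (Poly_Mapping.lookup c w) * \<psi> (hd w))"

lemma chain_eval_superset:
  assumes "finite S" "Poly_Mapping.keys c \<subseteq> S"
  shows "chain_eval \<psi> c = (\<Sum>w\<in>S. of_rat (Poly_Mapping.lookup c w) * \<psi> (hd w))"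
  unfolding chain_eval_def using assms
  by (intro sum.mono_neutral_left) (auto simp: in_keys_iff)

lemma chain_eval_add: "chain_eval \<psi> (c + d) = chain_eval \<psi> c + chain_eval \<psi> d"
proof -
  let ?S = "Poly_Mapping.keys c \<union> Poly_Mapping.keys d"
  have "Poly_Mapping.keys (c + d) \<subseteq> ?S" by (rule Poly_Mapping.keys_add)
  then show ?thesis
    by (simp add: chain_eval_superset[of ?S] lookup_add of_rat_add algebra_simps sum.distrib)
qed

lemma chain_eval_sum: "chain_eval \<psi> (sum f A) = (\<Sum>x\<in>A. chain_eval \<psi> (f x))"
  by (induction A rule: infinite_finite_induct) (simp_all add: chain_eval_add, simp_all add: chain_eval_def)

lemma chain_eval_single: "chain_eval \<psi> (Poly_Mapping.single w r) = of_rat r * \<psi> (hd w)"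
  by (subst chain_eval_superset[of "{w}"]) auto

lemma chain_eval_boundary:
  assumes \<psi>: "\<And>x y. x \<in> carrier N \<Longrightarrow> y \<in> carrier N \<Longrightarrow> \<psi> (x \<otimes>\<^bsub>N\<^esub> y) = \<psi> x + \<psi> y"
    and b: "b \<in> bar_boundaries N 1"
  shows "chain_eval \<psi> b = 0"
proof -
  obtain d where d: "d \<in> bar_chains N 2" "b = bar_boundary N d"
    using b by (auto simp: bar_boundaries_def numeral_2_eq_2)
  have "chain_eval \<psi> (\<Sum>i\<le>length w. Poly_Mapping.single (bar_face N i w) ((-1) ^ i * Poly_Mapping.lookup d w)) = 0"
    if w: "w \<in> Poly_Mapping.keys d" for w
  proof -
    have "length w = 2" "set w \<subseteq> carrier N" using d w by (auto simp: bar_chains_def)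
    then obtain x y where xy: "w = [x, y]" "x \<in> carrier N" "y \<in> carrier N"
      by (auto simp: length_Suc_conv numeral_2_eq_2)
    have "{..length w} = {0, 1, 2}" using xy by auto
    then show ?thesis using \<psi>[OF xy(2,3)]
      unfolding chain_eval_sum
      by (simp add: chain_eval_single xy(1) bar_face_def of_rat_mult of_rat_minus algebra_simps)
  qed
  moreover have "w \<noteq> []" if "w \<in> Poly_Mapping.keys d" for w
    using d that by (auto simp: bar_chains_def)
  ultimately show ?thesis
    unfolding d(2) bar_boundary_def by (subst chain_eval_sum) (simp add: sum.neutral)
qed

text \<open>The 1-chain \<open>[n]\<close> is a cycle, and by hypothesis it is homologous to its conjugate; the pairing with
  the cocycle \<open>\<psi>\<close> depends on the homology class only.\<close>

lemma trivial_H1_action_additive: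
  fixes G :: "('a, 'm) monoid_scheme" and \<psi> :: "'a \<Rightarrow> complex"
  assumes "group G" "K \<lhd> G" and triv: "trivial_H1_action G K"
    and \<psi>: "\<And>x y. x \<in> K \<Longrightarrow> y \<in> K \<Longrightarrow> \<psi> (x \<otimes>\<^bsub>G\<^esub> y) = \<psi> x + \<psi> y"
    and g: "g \<in> carrier G" and n: "n \<in> K"
  shows "\<psi> (g \<otimes>\<^bsub>G\<^esub> n \<otimes>\<^bsub>G\<^esub> inv\<^bsub>G\<^esub> g) = \<psi> n"
proof -
  let ?N = "G\<lparr>carrier := K\<rparr>"
  let ?f = "\<lambda>x. g \<otimes>\<^bsub>G\<^esub> x \<otimes>\<^bsub>G\<^esub> inv\<^bsub>G\<^esub> g"
  let ?c = "Poly_Mapping.single [n] (1 :: rat)"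
  let ?B = "bar_boundaries ?N 1" and ?Z = "bar_cycles ?N 1"
  let ?A = "?B #>\<^bsub>?Z\<^esub> ?c"
  have "bar_boundary ?N ?c = 0"
    by (simp add: bar_boundary_def bar_face_def atMost_Suc flip: Poly_Mapping.single_add)
  then have c: "?c \<in> carrier ?Z" using n by (simp add: bar_cycles_def bar_chains_def)
  have "0 \<in> bar_chains ?N 2" "bar_boundary ?N 0 = 0" by (simp_all add: bar_chains_def bar_boundary_def)
  then have zero: "0 \<in> ?B" unfolding bar_boundaries_def by (metis One_nat_def Suc_1 imageI)
  have coset: "x \<in> ?B #>\<^bsub>?Z\<^esub> x" for x
    using zero by (force simp: r_coset_def bar_cycles_def)
  have "?A \<in> carrier (rat_homology ?N 1)"
    using c by (auto simp: rat_homology_def FactGroup_def RCOSETS_def)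
  then have A: "rat_homology_map ?N 1 ?f ?A = ?A"
    using triv g unfolding trivial_H1_action_def by blast
  have "bar_map ?f ?c \<in> rat_homology_map ?N 1 ?f ?A"
    unfolding rat_homology_map_def coset_map_def using coset by blast
  then have "bar_map ?f ?c \<in> ?A" by (simp only: A)
  moreover have "bar_map ?f ?c = Poly_Mapping.single [?f n] 1" by (simp add: bar_map_def)
  ultimately obtain b where b: "b \<in> ?B" "Poly_Mapping.single [?f n] 1 = b + ?c"
    by (auto simp: r_coset_def bar_cycles_def)
  have "chain_eval \<psi> b = 0" using chain_eval_boundary[OF _ b(1), of \<psi>] \<psi> by simp
  then have "chain_eval \<psi> (Poly_Mapping.single [?f n] 1) = chain_eval \<psi> ?c"
    by (simp add: b(2) chain_eval_add)
  then show ?thesis by (simp add: chain_eval_single)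
qed

section \<open>Vertices of degree not divisible by a given number\<close>

lemma ex_root_of_unity:
  obtains \<zeta> :: complex where "\<zeta> \<noteq> 0" "\<And>k. \<zeta> powi k = 1 \<longleftrightarrow> int m dvd k"
proof (cases "m = 0")
  case True
  have "(2 :: complex) powi k = 1 \<longleftrightarrow> k = 0" for k
  proof
    assume "(2 :: complex) powi k = 1"
    then have "norm ((2 :: complex) powi k) = 1" by simp
    then have *: "(2 :: real) powi k = 1" by (simp add: norm_power_int)
    show "k = 0"
    proof (rule ccontr)
      assume "k \<noteq> 0"
      then consider n where "k = int (Suc n)" | n where "k = - int (Suc n)"
        by (metis int_cases3 Suc_pred)
      then show False
      proof cases
        case 1
        then have "(2 :: real) ^ Suc n = 1" using * by (simp only: power_int_of_nat)
        then show False using one_less_power[of "2 :: real" "Suc n"] by simp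
      next
        case 2
        then have "inverse ((2 :: real) ^ Suc n) = 1" using * by (simp only: power_int_minus power_int_of_nat)
        then have "(2 :: real) ^ Suc n = 1" by (simp only: inverse_eq_1_iff)
        then show False using one_less_power[of "2 :: real" "Suc n"] by simp
      qed
    qed
  qed simp
  \<comment> \<open>for \<open>m = 0\<close> any number that is not a root of unity will do\<close>
  with True show ?thesis by (intro that[of 2]) auto
next
  case False
  let ?z = "cis (2 * pi / m)"
  have "?z powi k = 1 \<longleftrightarrow> int m dvd k" for k
  proof -
    have "?z powi k = 1 \<longleftrightarrow> cis (of_int k * (2 * pi / m)) = 1" by (simp add: cis_power_int)
    also have "\<dots> \<longleftrightarrow> cos (of_int k * (2 * pi / m)) = 1"
      by (auto simp: complex_eq_iff) (metis cos_one_sin_zero)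
    also have "\<dots> \<longleftrightarrow> (\<exists>n::int. of_int k * (2 * pi / m) = of_int n * 2 * pi)"
      by (simp add: cos_one_2pi_int)
    also have "\<dots> \<longleftrightarrow> (\<exists>n::int. real_of_int k = real_of_int (int m * n))"
      using False by (auto simp: field_simps)
    also have "\<dots> \<longleftrightarrow> int m dvd k" unfolding of_int_eq_iff dvd_def ..
    finally show ?thesis .
  qed
  then show ?thesis by (intro that[of ?z]) auto
qed

text \<open>On the kernel \<open>D\<close> is additive, and conjugation by an element of degree 1 multiplies it by \<open>\<zeta>\<close>. As the
  conjugation acts trivially on homology and \<open>\<zeta> \<noteq> 1\<close>, \<open>D\<close> vanishes on the kernel. So it takes the same
  value on \<open>g h\<close> and on \<open>h g\<close>, which is the claim.\<close>

lemma crossed_hom_symmetric: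
  assumes G: "group G" and \<chi>: "\<chi> \<in> epi G integer_group"
    and triv: "trivial_H1_action G (kernel G integer_group \<chi>)"
    and \<zeta>: "\<zeta> \<noteq> 0" "\<zeta> \<noteq> (1 :: complex)"
    and D: "\<And>g h. \<lbrakk>g \<in> carrier G; h \<in> carrier G\<rbrakk> \<Longrightarrow> D (g \<otimes>\<^bsub>G\<^esub> h) = D g + \<zeta> powi \<chi> g * D h"
    and gh: "g \<in> carrier G" "h \<in> carrier G"
  shows "(1 - \<zeta> powi \<chi> h) * D g = (1 - \<zeta> powi \<chi> g) * D h"
proof -
  interpret group_hom G integer_group \<chi>
    using G \<chi> by (simp add: group_hom_def group_hom_axioms_def epi_def)
  let ?K = "kernel G integer_group \<chi>"
  have K: "?K \<lhd> G" by (rule normal_kernel)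
  have zero: "D n = 0" if n: "n \<in> ?K" for n
  proof -
    have nG: "n \<in> carrier G" "\<chi> n = 0" using n by (auto simp: kernel_def)
    have "1 \<in> \<chi> ` carrier G" using \<chi> by (simp add: epi_def)
    then obtain t where t: "t \<in> carrier G" "\<chi> t = 1" by auto
    have "D (t \<otimes>\<^bsub>G\<^esub> n \<otimes>\<^bsub>G\<^esub> inv\<^bsub>G\<^esub> t) = D n"
      using D by (intro trivial_H1_action_additive[OF G K triv _ t(1) n]) (auto simp: kernel_def)
    moreover have "D (t \<otimes>\<^bsub>G\<^esub> n \<otimes>\<^bsub>G\<^esub> inv\<^bsub>G\<^esub> t) = (D t + \<zeta> * D (inv\<^bsub>G\<^esub> t)) + \<zeta> * D n"
      using t nG by (simp add: D)
    moreover have "D \<one>\<^bsub>G\<^esub> = 0" using D[of "\<one>\<^bsub>G\<^esub>" "\<one>\<^bsub>G\<^esub>"] by simp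
    then have "D t + \<zeta> * D (inv\<^bsub>G\<^esub> t) = 0"
      using D[of t "inv\<^bsub>G\<^esub> t"] t by simp
    ultimately have "\<zeta> * D n = D n" by (simp only: add_0_left)
    then show ?thesis using \<zeta> by simp
  qed
  let ?c = "g \<otimes>\<^bsub>G\<^esub> h \<otimes>\<^bsub>G\<^esub> inv\<^bsub>G\<^esub> g \<otimes>\<^bsub>G\<^esub> inv\<^bsub>G\<^esub> h"
  have c: "?c \<in> ?K" using gh by (simp add: kernel_def)
  have "D (g \<otimes>\<^bsub>G\<^esub> h) = D (?c \<otimes>\<^bsub>G\<^esub> (h \<otimes>\<^bsub>G\<^esub> g))"
    using gh by (simp add: G.m_assoc)
  also have "\<dots> = D (h \<otimes>\<^bsub>G\<^esub> g)"
    using c gh zero[OF c] D[of ?c "h \<otimes>\<^bsub>G\<^esub> g"] by (simp add: kernel_def)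
  finally show ?thesis using gh by (simp add: D algebra_simps)
qed

context
  fixes V :: "'v set" and E and \<chi>
  assumes \<chi>: "\<chi> \<in> epi (raag V E) integer_group"
    and triv: "trivial_H1_action (raag V E) (kernel (raag V E) integer_group \<chi>)"
begin

private abbreviation weight where "weight v \<equiv> \<chi> (vertex_gen V E v)"

lemma ex_vertex_weight_not_dvd:
  assumes "m \<noteq> 1" obtains v where "v \<in> V" "\<not> int m dvd weight v"
proof -
  interpret group_hom "raag V E" integer_group \<chi>
    using \<chi> group_raag[of V E] by (simp add: group_hom_def group_hom_axioms_def epi_def)
  have "\<exists>v\<in>V. \<not> int m dvd weight v"
  proof (rule ccontr)
    assume no: "\<not> (\<exists>v\<in>V. \<not> int m dvd weight v)"
    have "int m dvd \<chi> g" if "g \<in> generate (raag V E) (vertex_gen V E ` V)" for g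
      using that
    proof (induction rule: generate.induct)
      case (eng x y)
      then have "x \<in> carrier (raag V E)" "y \<in> carrier (raag V E)" by (simp_all add: raag_generated)
      then show ?case using eng by simp
    qed (use no vertex_gen_closed[of _ V E] in auto)
    moreover have "1 \<in> \<chi> ` carrier (raag V E)" using \<chi> by (simp add: epi_def)
    ultimately have "int m dvd 1" using raag_generated[of V E] by (metis imageE)
    then show False using assms by simp
  qed
  then show ?thesis using that by blast
qed

lemma crossed_hom_relation:
  fixes c :: "'v \<Rightarrow> complex"
  assumes "\<zeta> \<noteq> 0" "\<zeta> \<noteq> 1"
    and c: "\<And>u v. \<lbrakk>u \<in> V; v \<in> V; {u, v} \<in> E\<rbrakk> \<Longrightarrow> (1 - \<zeta> powi weight u) * c v = (1 - \<zeta> powi weight v) * c u"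
    and uv: "u \<in> V" "v \<in> V"
  shows "(1 - \<zeta> powi weight u) * c v = (1 - \<zeta> powi weight v) * c u"
proof -
  have "\<chi> \<in> hom (raag V E) integer_group" using \<chi> by (simp add: epi_def)
  then obtain D where D: "\<And>v. v \<in> V \<Longrightarrow> D (vertex_gen V E v) = c v"
    "\<And>g h. \<lbrakk>g \<in> carrier (raag V E); h \<in> carrier (raag V E)\<rbrakk>
      \<Longrightarrow> D (g \<otimes>\<^bsub>raag V E\<^esub> h) = D g + \<zeta> powi \<chi> g * D h"
    by (rule raag_crossed_hom[of \<chi> V E \<zeta> c]) (use assms(1) c in auto)
  show ?thesis
    using crossed_hom_symmetric[OF group_raag \<chi> triv assms(1,2) D(2)] uv D(1) vertex_gen_closed by metis
qed

text \<open>Otherwise the indicator function of \<open>x\<close> extends to a crossed homomorphism; it does not have the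
  symmetry property for \<open>x\<close> and a vertex of degree not divisible by \<open>m\<close>.\<close>

lemma support_dominating:
  assumes m: "m \<noteq> 1" and x: "x \<in> V" "int m dvd weight x"
  shows "\<exists>u\<in>V. \<not> int m dvd weight u \<and> {u, x} \<in> E"
proof (rule ccontr)
  assume no: "\<not> ?thesis"
  obtain \<zeta> :: complex where \<zeta>: "\<zeta> \<noteq> 0" "\<And>k. \<zeta> powi k = 1 \<longleftrightarrow> int m dvd k"
    using ex_root_of_unity by blast
  have "\<zeta> \<noteq> 1" using \<zeta>(2)[of 1] m by auto
  obtain v where v: "v \<in> V" "\<not> int m dvd weight v" using ex_vertex_weight_not_dvd m by blast
  have "(1 - \<zeta> powi weight v) * (if x = x then 1 else 0) = (1 - \<zeta> powi weight x) * (if v = x then 1 else 0)"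
  proof (rule crossed_hom_relation[OF \<zeta>(1) \<open>\<zeta> \<noteq> 1\<close>, of "\<lambda>v. if v = x then 1 else 0"])
    fix u w assume "u \<in> V" "w \<in> V" "{u, w} \<in> E"
    then show "(1 - \<zeta> powi weight u) * (if w = x then 1 else 0) = (1 - \<zeta> powi weight w) * (if u = x then 1 else 0)"
      using no x by (auto simp: \<zeta> insert_commute)
  qed (use v x in auto)
  then show False using v x by (auto simp: \<zeta>(2) split: if_splits)
qed

text \<open>Otherwise the crossed homomorphism that is principal on \<open>A\<close> and zero on the other vertices is well
  defined; it does not have the symmetry property for \<open>a\<close> and \<open>b\<close>.\<close>

lemma support_connected:
  assumes m: "m \<noteq> 1" and A: "A \<subseteq> V" "\<And>a. a \<in> A \<Longrightarrow> \<not> int m dvd weight a" "a \<in> A"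
    and b: "b \<in> V - A" "\<not> int m dvd weight b"
  shows "\<exists>a\<in>A. \<exists>b\<in>V - A. \<not> int m dvd weight b \<and> {a, b} \<in> E"
proof (rule ccontr)
  assume no: "\<not> ?thesis"
  obtain \<zeta> :: complex where \<zeta>: "\<zeta> \<noteq> 0" "\<And>k. \<zeta> powi k = 1 \<longleftrightarrow> int m dvd k"
    using ex_root_of_unity by blast
  have "\<zeta> \<noteq> 1" using \<zeta>(2)[of 1] m by auto
  let ?c = "\<lambda>v. if v \<in> A then 1 - \<zeta> powi weight v else 0"
  have "(1 - \<zeta> powi weight b) * ?c a = (1 - \<zeta> powi weight a) * ?c b"
  proof (rule crossed_hom_relation[OF \<zeta>(1) \<open>\<zeta> \<noteq> 1\<close>, of ?c])
    fix u v assume uv: "u \<in> V" "v \<in> V" "{u, v} \<in> E"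
    moreover from uv have "{v, u} \<in> E" by (simp add: insert_commute)
    ultimately show "(1 - \<zeta> powi weight u) * ?c v = (1 - \<zeta> powi weight v) * ?c u"
      using no by (auto simp: \<zeta>(2))
  qed (use A b in auto)
  then show False using A b by (auto simp: \<zeta>(2))
qed

end

section \<open>Prime ideals of a commutative ring\<close>

definition is_ideal :: "'a :: comm_ring_1 set \<Rightarrow> bool" where
  "is_ideal I \<longleftrightarrow> 0 \<in> I \<and> (\<forall>a\<in>I. \<forall>b\<in>I. a + b \<in> I) \<and> (\<forall>a\<in>I. \<forall>r. r * a \<in> I)"

text \<open>A maximal proper ideal \<open>I\<close>, from Zorn's lemma: if \<open>a\<close> is not in \<open>I\<close>, then 1 lies in the ideal generated by
  \<open>I\<close> and \<open>a\<close>, and multiplication by \<open>b\<close> shows that \<open>b \<in> I\<close> if \<open>a b \<in> I\<close>.\<close>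

lemma ex_prime_ideal:
  assumes J: "is_ideal J" "1 \<notin> J"
  obtains I where "is_ideal I" "1 \<notin> I" "J \<subseteq> I" "\<And>a b. a * b \<in> I \<Longrightarrow> a \<in> I \<or> b \<in> I"
proof -
  let ?P = "{I. is_ideal I \<and> 1 \<notin> I \<and> J \<subseteq> I}"
  have "\<exists>M\<in>?P. \<forall>S\<in>?P. M \<subseteq> S \<longrightarrow> S = M"
  proof (rule subset_Zorn_nonempty)
    show "?P \<noteq> {}" using J by auto
    fix C assume C: "C \<noteq> {}" "subset.chain ?P C"
    have "is_ideal (\<Union>C)" unfolding is_ideal_def
    proof (intro conjI ballI allI)
      show "0 \<in> \<Union>C" using C by (auto simp: subset.chain_def is_ideal_def)
      fix a assume "a \<in> \<Union>C"
      then obtain S where S: "S \<in> C" "a \<in> S" by auto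
      then have "is_ideal S" using C by (auto simp: subset.chain_def)
      then show "r * a \<in> \<Union>C" for r using S unfolding is_ideal_def by blast
      fix b assume "b \<in> \<Union>C"
      then obtain T where T: "T \<in> C" "b \<in> T" by auto
      have "S \<subseteq> T \<or> T \<subseteq> S" using C S T by (auto simp: subset.chain_def)
      moreover have "is_ideal S" "is_ideal T" using C S T by (auto simp: subset.chain_def)
      ultimately show "a + b \<in> \<Union>C" using S T unfolding is_ideal_def by blast
    qed
    with C show "\<Union>C \<in> ?P" by (auto simp: subset.chain_def)
  qed
  then obtain I where "I \<in> ?P" and max: "\<forall>S\<in>?P. I \<subseteq> S \<longrightarrow> S = I" by (rule bexE)
  then have I: "is_ideal I" "1 \<notin> I" "J \<subseteq> I" by simp_all
  have "b \<in> I" if ab: "a * b \<in> I" and a: "a \<notin> I" for a b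
  proof -
    let ?S = "{i + r * a | i r. i \<in> I}"
    have sub: "I \<subseteq> ?S"
    proof
      fix i assume "i \<in> I"
      moreover have "i = i + 0 * a" by simp
      ultimately show "i \<in> ?S" by blast
    qed
    have "a = 0 + 1 * a" "0 \<in> I" using I(1) by (simp_all add: is_ideal_def)
    then have "a \<in> ?S" by blast
    have "is_ideal ?S" unfolding is_ideal_def
    proof (intro conjI ballI allI)
      show "0 \<in> ?S" using sub I(1) unfolding is_ideal_def by blast
      fix p assume "p \<in> ?S"
      then obtain i r where p: "p = i + r * a" "i \<in> I" by auto
      have "c * p = c * i + (c * r) * a" for c by (simp add: p algebra_simps)
      moreover have "c * i \<in> I" for c using p I(1) by (auto simp: is_ideal_def)
      ultimately show "c * p \<in> ?S" for c by blast
      fix q assume "q \<in> ?S"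
      then obtain j s where q: "q = j + s * a" "j \<in> I" by auto
      have "p + q = (i + j) + (r + s) * a" by (simp add: p q algebra_simps)
      moreover have "i + j \<in> I" using p q I(1) by (auto simp: is_ideal_def)
      ultimately show "p + q \<in> ?S" by blast
    qed
    moreover have "?S \<noteq> I" using \<open>a \<in> ?S\<close> a by auto
    ultimately have "1 \<in> ?S" using max sub I(3) by blast
    then obtain i r where ir: "1 = i + r * a" "i \<in> I" by auto
    then have "b = b * i + r * (a * b)" by (metis distrib_left mult.commute mult.left_commute mult_1_right)
    moreover have "b * i \<in> I" "r * (a * b) \<in> I" using ir ab I(1) by (auto simp: is_ideal_def)
    ultimately show "b \<in> I" using I(1) unfolding is_ideal_def by metis
  qed
  then show ?thesis using that I by blast
qed

section \<open>Polynomials acting through an endomorphism\<close>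

text \<open>\<open>p\<close> acts as \<open>p(\<tau>)\<close>, evaluated by Horner's scheme; the group is written multiplicatively.\<close>

definition poly_act :: "('a, 'm) monoid_scheme \<Rightarrow> ('a \<Rightarrow> 'a) \<Rightarrow> int poly \<Rightarrow> 'a \<Rightarrow> 'a" where
  "poly_act M \<tau> p b = fold_coeffs (\<lambda>c y. b [^]\<^bsub>M\<^esub> c \<otimes>\<^bsub>M\<^esub> \<tau> y) p \<one>\<^bsub>M\<^esub>"

locale comm_group_endo = comm_group M for M :: "('a, 'm) monoid_scheme" (structure) +
  fixes \<tau> :: "'a \<Rightarrow> 'a"
  assumes \<tau>: "\<tau> \<in> hom M M"
begin

abbreviation act where "act \<equiv> poly_act M \<tau>"

lemma \<tau>_closed [simp]: "b \<in> carrier M \<Longrightarrow> \<tau> b \<in> carrier M"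
  using \<tau> by (auto simp: hom_def)

lemma \<tau>_mult: "\<lbrakk>b \<in> carrier M; c \<in> carrier M\<rbrakk> \<Longrightarrow> \<tau> (b \<otimes> c) = \<tau> b \<otimes> \<tau> c"
  using \<tau> by (auto simp: hom_def)

lemma \<tau>_one [simp]: "\<tau> \<one> = \<one>"
  using hom_one[OF \<tau>] group_axioms by simp

lemma \<tau>_int_pow: "b \<in> carrier M \<Longrightarrow> \<tau> (b [^] (c :: int)) = \<tau> b [^] c"
  using hom_int_pow[OF \<tau>] group_axioms by simp

lemma act_0 [simp]: "act 0 b = \<one>"
  by (simp add: poly_act_def)

lemma act_pCons: "b \<in> carrier M \<Longrightarrow> act (pCons c p) b = b [^] c \<otimes> \<tau> (act p b)"
  by (cases "c = 0 \<and> p = 0") (auto simp: poly_act_def)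

lemma act_closed [simp]: "b \<in> carrier M \<Longrightarrow> act p b \<in> carrier M"
  by (induction p) (simp_all add: act_pCons)

lemma act_one [simp]: "b \<in> carrier M \<Longrightarrow> act 1 b = b"
  by (simp add: one_pCons act_pCons int_pow_1)

lemma act_add: "b \<in> carrier M \<Longrightarrow> act (p + q) b = act p b \<otimes> act q b"
proof (induction p q rule: poly_induct2)
  case (pCons c p d q)
  then have "act (pCons c p + pCons d q) b = (b [^] c \<otimes> b [^] d) \<otimes> (\<tau> (act p b) \<otimes> \<tau> (act q b))"
    by (simp add: act_pCons int_pow_mult \<tau>_mult)
  then show ?case using pCons by (simp add: act_pCons m_ac)
qed simp

lemma act_smult: "b \<in> carrier M \<Longrightarrow> act (smult c p) b = act p b [^] c"
proof (induction p)
  case (pCons d p)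
  then show ?case
    by (simp add: act_pCons int_pow_distrib \<tau>_int_pow int_pow_pow mult.commute)
qed simp

lemma act_mult: "b \<in> carrier M \<Longrightarrow> act (p * q) b = act p (act q b)"
proof (induction p)
  case (pCons c p)
  then show ?case
    by (simp add: act_add act_smult act_pCons)
qed simp

lemma act_hom: "b \<in> carrier M \<Longrightarrow> c \<in> carrier M \<Longrightarrow> act p (b \<otimes> c) = act p b \<otimes> act p c"
proof (induction p)
  case (pCons d p)
  then have "act (pCons d p) (b \<otimes> c) = (b [^] d \<otimes> c [^] d) \<otimes> (\<tau> (act p b) \<otimes> \<tau> (act p c))"
    by (simp add: act_pCons int_pow_distrib \<tau>_mult)
  then show ?case using pCons.prems by (simp add: act_pCons m_ac)
qed simp

lemma act_of_one [simp]: "act p \<one> = \<one>"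
  by (induction p) (simp_all add: act_pCons)

lemma act_minus: "b \<in> carrier M \<Longrightarrow> act (- p) b = inv (act p b)"
  using act_add[of b "- p" p] by (simp add: inv_equality)

lemma annihilator_ideal: "b \<in> carrier M \<Longrightarrow> is_ideal {p. act p b = \<one>}"
  by (auto simp: is_ideal_def act_add act_mult)

end

section \<open>Quantum integers\<close>

text \<open>The quotient of \<open>1 - X\<^sup>n\<close> by \<open>1 - X\<close>. With \<open>1 - X\<^sup>n\<close> instead, \<open>generators_commute\<close> could not treat the prime
  ideals that contain \<open>1 - X\<close>, because all these polynomials lie in them.\<close>

definition quantum_int :: "nat \<Rightarrow> int poly" where
  "quantum_int n = (\<Sum>i<n. monom 1 i)"

lemma quantum_int_0 [simp]: "quantum_int 0 = 0" and quantum_int_1: "quantum_int (Suc 0) = 1"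
  by (simp_all add: quantum_int_def)

lemma quantum_int_add: "quantum_int (m + n) = quantum_int m + monom 1 m * quantum_int n"
  by (induction n) (simp_all add: quantum_int_def distrib_left mult_monom)

lemma one_minus_times_quantum_int: "(1 - monom 1 1) * quantum_int n = 1 - monom 1 n"
proof (induction n)
  case (Suc n)
  have "quantum_int (Suc n) = quantum_int n + monom 1 n" by (simp add: quantum_int_def)
  then show ?case using Suc by (simp add: distrib_left left_diff_distrib mult_monom)
qed simp

lemma nat_set_eq_multiples:
  fixes S :: "nat set"
  assumes "0 \<in> S" and add: "\<And>a b. a \<in> S \<Longrightarrow> b \<in> S \<Longrightarrow> a + b \<in> S"
    and diff: "\<And>a b. a \<in> S \<Longrightarrow> a + b \<in> S \<Longrightarrow> b \<in> S"
  obtains m where "S = {n. m dvd n}"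
proof (cases "S = {0}")
  case True
  then show ?thesis by (intro that[of 0]) auto
next
  case False
  define m where "m = (LEAST n. n \<in> S \<and> n > 0)"
  obtain k where "k \<in> S" "k > 0" using False assms(1) by (metis not_gr_zero singletonI singleton_iff subsetI subset_antisym)
  then have m: "m \<in> S" "m > 0" and least: "\<And>n. n \<in> S \<Longrightarrow> n > 0 \<Longrightarrow> m \<le> n"
    using LeastI_ex[of "\<lambda>n. n \<in> S \<and> n > 0"] Least_le[of "\<lambda>n. n \<in> S \<and> n > 0"]
    by (auto simp: m_def)
  have mult: "k * m \<in> S" for k by (induction k) (auto intro: assms m)
  have "n \<in> S \<longleftrightarrow> m dvd n" for n
  proof
    assume n: "n \<in> S"
    have "n div m * m + n mod m \<in> S" using n by simp
    then have "n mod m \<in> S" by (rule diff[OF mult])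
    then have "n mod m = 0" using least[of "n mod m"] m(2) by (metis mod_less_divisor not_gr_zero not_le)
    then show "m dvd n" by auto
  next
    assume "m dvd n"
    then show "n \<in> S" using mult by (auto simp: dvd_def mult.commute)
  qed
  then show ?thesis by (intro that[of m]) auto
qed

text \<open>The identity \<open>[a + b] = [a] + X\<^sup>a [b]\<close> shows that the set of \<open>n\<close> with \<open>[n] \<in> I\<close> is closed under sums and,
  if \<open>X\<close> is not in \<open>I\<close>, under differences. If \<open>X \<in> I\<close>, then \<open>[n]\<close> is 1 modulo \<open>I\<close> for \<open>n > 0\<close>, and \<open>m = 0\<close>.\<close>

lemma quantum_int_in_prime_ideal:
  assumes I: "is_ideal I" "1 \<notin> I" and prime: "\<And>a b. a * b \<in> I \<Longrightarrow> a \<in> I \<or> b \<in> I"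
  obtains m where "m \<noteq> 1" "\<And>n. quantum_int n \<in> I \<longleftrightarrow> m dvd n"
proof -
  have neg: "- a \<in> I" if "a \<in> I" for a using I(1) that unfolding is_ideal_def by (metis mult_minus1)
  have add: "a + b \<in> I" if "a \<in> I" "b \<in> I" for a b using I(1) that by (auto simp: is_ideal_def)
  have mult: "r * a \<in> I" if "a \<in> I" for a r using I(1) that by (auto simp: is_ideal_def)
  have ex: "\<exists>m. {n. quantum_int n \<in> I} = {n. m dvd n}"
  proof (cases "monom 1 1 \<in> I")
    case False
    have X: "monom 1 a \<notin> I" for a
    proof (induction a)
      case 0 then show ?case using I(2) by simp
    next
      case (Suc a)
      have "monom 1 (Suc a) = monom 1 1 * (monom 1 a :: int poly)" by (simp add: mult_monom)
      then show ?case using prime False Suc by metis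
    qed
    show ?thesis
    proof (rule nat_set_eq_multiples[of "{n. quantum_int n \<in> I}"])
      show "0 \<in> {n. quantum_int n \<in> I}" using I(1) by (simp add: is_ideal_def)
      show "a + b \<in> {n. quantum_int n \<in> I}" if "a \<in> {n. quantum_int n \<in> I}" "b \<in> {n. quantum_int n \<in> I}" for a b
        using that by (simp add: quantum_int_add add mult)
      show "b \<in> {n. quantum_int n \<in> I}" if "a \<in> {n. quantum_int n \<in> I}" "a + b \<in> {n. quantum_int n \<in> I}" for a b
      proof -
        have "quantum_int (a + b) + - quantum_int a \<in> I" using that by (intro add neg) auto
        then have "monom 1 a * quantum_int b \<in> I" by (simp add: quantum_int_add)
        then show ?thesis using prime X by blast
      qed
    qed blast
  next
    case True
    have "quantum_int n \<notin> I" if n: "n \<noteq> 0" for n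
    proof
      assume q: "quantum_int n \<in> I"
      obtain k where k: "n = 1 + k" using n by (metis Suc_pred' not_gr_zero plus_1_eq_Suc)
      have "quantum_int n + - (quantum_int k * monom 1 1) \<in> I"
        by (intro add neg mult q True)
      then show False using I(2) unfolding k quantum_int_add by (simp add: quantum_int_1 mult.commute)
    qed
    then have "{n. quantum_int n \<in> I} = {n. 0 dvd n}" using I(1) by (auto simp: is_ideal_def)
    then show ?thesis by blast
  qed
  then obtain m where m: "{n. quantum_int n \<in> I} = {n. m dvd n}" by blast
  then have "m \<noteq> 1" using I(2) quantum_int_1 by (metis One_nat_def dvd_1_left mem_Collect_eq)
  with m show ?thesis using that by blast
qed

section \<open>Commuting generators of a group with abelian kernel\<close>

text \<open>\<open>A\<close> and \<open>M\<close> are the abelian kernel of \<open>\<chi>\<close>, as a set and as a group; conjugation by \<open>t\<close> makes it a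
  module over \<open>\<int>[X]\<close>.\<close>

locale cyclic_by_abelian = group Q for Q :: "('a, 'm) monoid_scheme" (structure) +
  fixes \<chi> :: "'a \<Rightarrow> int" and A and t and \<tau> and M
  assumes \<chi>: "\<chi> \<in> hom Q integer_group"
    and abelian: "\<And>a b. \<lbrakk>a \<in> kernel Q integer_group \<chi>; b \<in> kernel Q integer_group \<chi>\<rbrakk> \<Longrightarrow> a \<otimes> b = b \<otimes> a"
    and t: "t \<in> carrier Q" "\<chi> t = 1"
  defines "A \<equiv> kernel Q integer_group \<chi>"
    and "\<tau> \<equiv> \<lambda>b. t \<otimes> b \<otimes> inv t"
    and "M \<equiv> Q\<lparr>carrier := A\<rparr>"
begin

sublocale \<chi>: group_hom Q integer_group \<chi>
  using \<chi> group_axioms by (simp add: group_hom_def group_hom_axioms_def)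

lemma A_iff: "b \<in> A \<longleftrightarrow> b \<in> carrier Q \<and> \<chi> b = 0"
  unfolding A_def kernel_def by simp

lemma A_subgroup: "subgroup A Q"
  unfolding A_def by (rule \<chi>.subgroup_kernel)

sublocale M: comm_group_endo M \<tau>
proof -
  have "comm_group M"
    using abelian unfolding M_def A_def
    by (intro group.group_comm_groupI subgroup_imp_group \<chi>.subgroup_kernel) simp
  moreover have "\<tau> \<in> hom M M"
  proof (rule homI)
    show "\<tau> b \<in> carrier M" if "b \<in> carrier M" for b
      using that t by (simp add: M_def A_iff \<tau>_def)
    show "\<tau> (b \<otimes>\<^bsub>M\<^esub> c) = \<tau> b \<otimes>\<^bsub>M\<^esub> \<tau> c" if "b \<in> carrier M" "c \<in> carrier M" for b c
      using that t by (simp add: M_def A_iff \<tau>_def word_simps)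
  qed
  ultimately show "comm_group_endo M \<tau>" by (simp add: comm_group_endo_def comm_group_endo_axioms_def)
qed

lemma carrier_M: "carrier M = A" and mult_M: "b \<otimes>\<^bsub>M\<^esub> c = b \<otimes> c" and one_M: "\<one>\<^bsub>M\<^esub> = \<one>"
  by (simp_all add: M_def)

lemma inv_M: "b \<in> A \<Longrightarrow> inv\<^bsub>M\<^esub> b = inv b"
  unfolding M_def by (rule m_inv_consistent[OF A_subgroup])

lemma act_monom: "b \<in> A \<Longrightarrow> M.act (monom 1 n) b = t [^] n \<otimes> b \<otimes> inv (t [^] n)"
proof (induction n)
  case 0
  then show ?case using M.act_one[of b] by (simp add: carrier_M A_iff)
next
  case (Suc n)
  have tt: "t [^] Suc n = t \<otimes> t [^] n" using nat_pow_Suc2[OF t(1)] .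
  have "M.act (monom 1 (Suc n)) b = b [^]\<^bsub>M\<^esub> (0 :: int) \<otimes>\<^bsub>M\<^esub> \<tau> (M.act (monom 1 n) b)"
    unfolding monom_Suc using Suc.prems by (intro M.act_pCons) (simp add: carrier_M)
  also have "\<dots> = \<tau> (t [^] n \<otimes> b \<otimes> inv (t [^] n))"
    using Suc t by (simp add: one_M mult_M \<tau>_def A_iff)
  also have "\<dots> = t [^] Suc n \<otimes> b \<otimes> inv (t [^] Suc n)"
    using Suc.prems t unfolding tt by (simp add: \<tau>_def A_iff word_simps)
  finally show ?case .
qed

text \<open>In additive notation the commutator of \<open>b t\<^sup>m\<close> and \<open>c t\<^sup>n\<close> is \<open>(1 - X\<^sup>n) b - (1 - X\<^sup>m) c\<close>.\<close>

lemma commutator_as_act: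
  assumes b: "b \<in> A" and c: "c \<in> A"
  shows "group_commutator Q (b \<otimes> t [^] m) (c \<otimes> t [^] n) =
    M.act ((1 - monom 1 1) * quantum_int n) b \<otimes> inv (M.act ((1 - monom 1 1) * quantum_int m) c)"
proof -
  have bc: "b \<in> carrier M" "c \<in> carrier M" "b \<in> carrier Q" "c \<in> carrier Q" using b c by (auto simp: carrier_M A_iff)
  let ?b = "t [^] n \<otimes> b \<otimes> inv (t [^] n)" and ?c = "t [^] m \<otimes> c \<otimes> inv (t [^] m)"
  have b': "?b \<in> A" and c': "?c \<in> A"
    using M.act_closed[OF bc(1)] M.act_closed[OF bc(2)] act_monom[OF b] act_monom[OF c]
    unfolding carrier_M by metis+
  have act: "M.act ((1 - monom 1 1) * quantum_int k) a = a \<otimes> inv (t [^] k \<otimes> a \<otimes> inv (t [^] k))"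
    if a: "a \<in> A" for a k
  proof -
    have aM: "a \<in> carrier M" using a by (simp add: carrier_M)
    have "M.act ((1 - monom 1 1) * quantum_int k) a = M.act (1 + - monom 1 k) a"
      by (simp only: one_minus_times_quantum_int) simp
    also have "\<dots> = a \<otimes> inv (M.act (monom 1 k) a)"
      unfolding M.act_add[OF aM] M.act_minus[OF aM] M.act_one[OF aM] mult_M
      using M.act_closed[OF aM] by (simp add: inv_M carrier_M)
    finally show ?thesis by (simp add: act_monom[OF a])
  qed
  have "t [^] m \<otimes> t [^] n = t [^] n \<otimes> t [^] m" using t by (simp add: nat_pow_mult add.commute)
  then have "inv (t [^] m) \<otimes> (t [^] m \<otimes> t [^] n) \<otimes> inv (t [^] m) = inv (t [^] m) \<otimes> (t [^] n \<otimes> t [^] m) \<otimes> inv (t [^] m)"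
    by simp
  then have "t [^] n \<otimes> inv (t [^] m) = inv (t [^] m) \<otimes> t [^] n" using t by (simp add: m_assoc)
  then have swap: "t [^] n \<otimes> (inv (t [^] m) \<otimes> z) = inv (t [^] m) \<otimes> (t [^] n \<otimes> z)" if "z \<in> carrier Q" for z
    using that t by (simp flip: m_assoc)
  have "group_commutator Q (b \<otimes> t [^] m) (c \<otimes> t [^] n) = b \<otimes> (?c \<otimes> inv ?b) \<otimes> inv c"
    using bc t by (simp add: group_commutator_def word_simps swap)
  also have "?c \<otimes> inv ?b = inv ?b \<otimes> ?c"
    using b' c' subgroup.m_inv_closed[OF A_subgroup b'] abelian unfolding A_def by blast
  also have "b \<otimes> (inv ?b \<otimes> ?c) \<otimes> inv c = (b \<otimes> inv ?b) \<otimes> inv (c \<otimes> inv ?c)"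
    using bc t by (simp add: word_simps)
  finally show ?thesis by (simp only: act b c)
qed

end

text \<open>The last two hypotheses say that, for every \<open>m \<noteq> 1\<close>, the vertices of degree not divisible by \<open>m\<close>
  span a connected subgraph to which every other vertex is adjacent.\<close>

locale cyclic_by_abelian_graph = cyclic_by_abelian Q \<chi> A t \<tau> M
    for Q :: "('a, 'm) monoid_scheme" (structure) and \<chi> A t \<tau> M +
  fixes V :: "'v set" and E :: "'v set set" and x :: "'v \<Rightarrow> 'a" and deg :: "'v \<Rightarrow> nat"
  assumes x_closed: "v \<in> V \<Longrightarrow> x v \<in> carrier Q"
    and x_deg: "v \<in> V \<Longrightarrow> \<chi> (x v) = int (deg v)"
    and adjacent: "\<lbrakk>u \<in> V; v \<in> V; {u, v} \<in> E\<rbrakk> \<Longrightarrow> x u \<otimes> x v = x v \<otimes> x u"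
    and dominating: "\<lbrakk>m \<noteq> 1; v \<in> V; m dvd deg v\<rbrakk> \<Longrightarrow> \<exists>u\<in>V. \<not> m dvd deg u \<and> {u, v} \<in> E"
    and connected: "\<lbrakk>m \<noteq> 1; S \<subseteq> V; \<And>a. a \<in> S \<Longrightarrow> \<not> m dvd deg a; a \<in> S; b \<in> V - S; \<not> m dvd deg b\<rbrakk>
      \<Longrightarrow> \<exists>a\<in>S. \<exists>b\<in>V - S. \<not> m dvd deg b \<and> {a, b} \<in> E"
begin

abbreviation "q v \<equiv> quantum_int (deg v)"
abbreviation "w u v \<equiv> group_commutator Q (x u) (x v)"

definition base where "base v = x v \<otimes> inv (t [^] deg v)"

lemma base_closed: "v \<in> V \<Longrightarrow> base v \<in> carrier M"
  using t \<chi>.hom_nat_pow[OF t(1), of "deg v"]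
  by (simp add: base_def carrier_M A_iff x_closed x_deg)

lemma w_eq:
  assumes "u \<in> V" "v \<in> V"
  shows "w u v = M.act ((1 - monom 1 1) * q v) (base u) \<otimes>\<^bsub>M\<^esub> M.act (- ((1 - monom 1 1) * q u)) (base v)"
proof -
  have "x v = base v \<otimes> t [^] deg v" if "v \<in> V" for v
    using that t x_closed by (simp add: base_def m_assoc)
  then have "w u v = group_commutator Q (base u \<otimes> t [^] deg u) (base v \<otimes> t [^] deg v)"
    using assms by simp
  also have "\<dots> = M.act ((1 - monom 1 1) * q v) (base u) \<otimes> inv (M.act ((1 - monom 1 1) * q u) (base v))"
    using assms base_closed by (intro commutator_as_act) (simp_all add: carrier_M)
  finally show ?thesis
    using base_closed[OF assms(2)] M.act_closed[OF base_closed[OF assms(2)]]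
    by (simp add: M.act_minus mult_M inv_M carrier_M)
qed

lemma w_closed: "u \<in> V \<Longrightarrow> v \<in> V \<Longrightarrow> w u v \<in> carrier M"
  by (simp add: w_eq base_closed del: mult_M)

text \<open>In additive notation \<open>w u v = (1 - X) ([n v] b u - [n u] b v)\<close>, where \<open>b v\<close> is \<open>base v\<close> and \<open>n v\<close> the degree
  of \<open>v\<close>; the relation follows by expanding.\<close>

lemma w_cocycle:
  assumes "u \<in> V" "v \<in> V" "y \<in> V"
  shows "M.act (q u) (w v y) = M.act (q v) (w u y) \<otimes>\<^bsub>M\<^esub> M.act (q y) (w v u)"
proof -
  let ?P = "1 - monom 1 1 :: int poly"
  note b = base_closed[OF assms(1)] base_closed[OF assms(2)] base_closed[OF assms(3)]
  have eq: "M.act (q u') (w v' y') = M.act (q u' * (?P * q y')) (base v') \<otimes>\<^bsub>M\<^esub> M.act (- (q u' * (?P * q v'))) (base y')"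
    if "u' \<in> V" "v' \<in> V" "y' \<in> V" for u' v' y'
    using that base_closed by (simp add: w_eq M.act_hom M.act_mult [symmetric])
  have "M.act (q v) (w u y) \<otimes>\<^bsub>M\<^esub> M.act (q y) (w v u) =
      (M.act (q v * (?P * q y)) (base u) \<otimes>\<^bsub>M\<^esub> M.act (- (q v * (?P * q u))) (base y)) \<otimes>\<^bsub>M\<^esub>
      (M.act (q y * (?P * q u)) (base v) \<otimes>\<^bsub>M\<^esub> M.act (- (q y * (?P * q v))) (base u))"
    using assms by (simp only: eq)
  also have "\<dots> = (M.act (q v * (?P * q y)) (base u) \<otimes>\<^bsub>M\<^esub> M.act (- (q y * (?P * q v))) (base u)) \<otimes>\<^bsub>M\<^esub>
      (M.act (q y * (?P * q u)) (base v) \<otimes>\<^bsub>M\<^esub> M.act (- (q v * (?P * q u))) (base y))"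
    using b by (simp add: M.m_ac)
  also have "M.act (q v * (?P * q y)) (base u) \<otimes>\<^bsub>M\<^esub> M.act (- (q y * (?P * q v))) (base u) = \<one>\<^bsub>M\<^esub>"
    using b by (simp add: M.act_add [symmetric] mult.left_commute mult.commute)
  also have "q y * (?P * q u) = q u * (?P * q y)"
    by (simp add: mult.left_commute mult.commute)
  also have "q v * (?P * q u) = q u * (?P * q v)"
    by (simp add: mult.left_commute mult.commute)
  finally show ?thesis using assms b by (simp add: eq)
qed

lemma w_swap: "u \<in> V \<Longrightarrow> v \<in> V \<Longrightarrow> w v u = inv\<^bsub>M\<^esub> w u v"
  using w_closed[of u v] x_closed by (simp add: inv_M carrier_M inv_commutator)

lemma w_adjacent: "u \<in> V \<Longrightarrow> v \<in> V \<Longrightarrow> {u, v} \<in> E \<Longrightarrow> w u v = \<one>\<^bsub>M\<^esub>"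
  using adjacent[of u v] x_closed[of u] x_closed[of v]
  by (simp add: group_commutator_def one_M) (simp add: word_simps)

text \<open>If \<open>w a b\<close> and \<open>w a c\<close> vanish in the localization and \<open>[n a]\<close> is invertible there, then \<open>w b c\<close>
  vanishes too, by \<open>w_cocycle\<close>. Starting from the edges, this first reaches all pairs in the connected
  subgraph, then the pairs with one vertex in it, and then all pairs.\<close>

theorem generators_commute:
  assumes uv: "u \<in> V" "v \<in> V"
  shows "x u \<otimes> x v = x v \<otimes> x u"
proof -
  have "w u v = \<one>\<^bsub>M\<^esub>"
  proof (rule ccontr)
    assume nz: "w u v \<noteq> \<one>\<^bsub>M\<^esub>"
    let ?J = "{p. M.act p (w u v) = \<one>\<^bsub>M\<^esub>}"
    have J: "is_ideal ?J" "1 \<notin> ?J" using M.annihilator_ideal[OF w_closed[OF uv]] nz w_closed[OF uv] by auto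
    obtain I where I: "is_ideal I" "1 \<notin> I" "?J \<subseteq> I" and prime: "\<And>a b. a * b \<in> I \<Longrightarrow> a \<in> I \<or> b \<in> I"
      using ex_prime_ideal[OF J] by blast
    obtain m where m: "m \<noteq> 1" and q: "\<And>n. quantum_int n \<in> I \<longleftrightarrow> m dvd n"
      using quantum_int_in_prime_ideal[OF I(1,2) prime] by blast
    \<comment> \<open>vanishing in the localization of \<open>M\<close> at the prime \<open>I\<close>\<close>
    define Z where "Z a \<longleftrightarrow> (\<exists>s. s \<notin> I \<and> M.act s a = \<one>\<^bsub>M\<^esub>)" for a
    have Z_comb: "Z (M.act p a \<otimes>\<^bsub>M\<^esub> M.act r b)"
      if ab: "Z a" "Z b" "a \<in> carrier M" "b \<in> carrier M" for p r a b
    proof -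
      obtain s s' where s: "s \<notin> I" "M.act s a = \<one>\<^bsub>M\<^esub>" "s' \<notin> I" "M.act s' b = \<one>\<^bsub>M\<^esub>"
        using ab by (auto simp: Z_def)
      have "M.act (s * s') (M.act p a) = M.act (s' * p) (M.act s a)"
        using that by (simp add: M.act_mult [symmetric] ac_simps)
      moreover have "M.act (s * s') (M.act r b) = M.act (s * r) (M.act s' b)"
        using that by (simp add: M.act_mult [symmetric] ac_simps)
      ultimately have "M.act (s * s') (M.act p a \<otimes>\<^bsub>M\<^esub> M.act r b) = \<one>\<^bsub>M\<^esub>"
        using that s by (simp add: M.act_hom)
      moreover have "s * s' \<notin> I" using s prime by blast
      ultimately show ?thesis unfolding Z_def by blast
    qed
    have Z_div: "Z a" if pa: "Z (M.act p a)" "p \<notin> I" "a \<in> carrier M" for p a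
    proof -
      obtain s where "s \<notin> I" "M.act s (M.act p a) = \<one>\<^bsub>M\<^esub>" using pa by (auto simp: Z_def)
      then have "M.act (s * p) a = \<one>\<^bsub>M\<^esub>" "s * p \<notin> I" using that prime by (auto simp: M.act_mult)
      then show ?thesis unfolding Z_def by blast
    qed
    have Z_one: "Z \<one>\<^bsub>M\<^esub>" unfolding Z_def using I(2) by (intro exI[of _ 1]) simp
    have Z_swap: "Z (w b a)" if "Z (w a b)" "a \<in> V" "b \<in> V" for a b
      using Z_comb[OF that(1) Z_one, of "- 1" 1] w_closed[of a b] that w_swap[of a b] by (simp add: M.act_minus)
    have Z_trans: "Z (w b c)" if "Z (w a b)" "Z (w a c)" "\<not> m dvd deg a" "a \<in> V" "b \<in> V" "c \<in> V" for a b c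
    proof (rule Z_div)
      show "q a \<notin> I" using that q by simp
      show "Z (M.act (q a) (w b c))"
        unfolding w_cocycle[OF that(4-6)] by (intro Z_comb[OF that(2) Z_swap[OF that(1,4,5)]] w_closed that(4-6))
    qed (use that w_closed in auto)
    have supp: "Z (w a b)" if a: "a \<in> V" "\<not> m dvd deg a" and b: "b \<in> V" "\<not> m dvd deg b" for a b
    proof (rule ccontr)
      assume nZ: "\<not> Z (w a b)"
      let ?S = "{c \<in> V. \<not> m dvd deg c \<and> Z (w a c)}"
      have "w a a = \<one>\<^bsub>M\<^esub>" using a x_closed by (simp add: commutator_self one_M)
      then have "a \<in> ?S" using a Z_one by simp
      then obtain c d where c: "c \<in> ?S" and d: "d \<in> V - ?S" "\<not> m dvd deg d" and cd: "{c, d} \<in> E"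
        using connected[OF m, of ?S a b] b nZ by blast
      have "Z (w c d)" using w_adjacent[OF _ _ cd] c d Z_one by simp
      moreover have "Z (w c a)" using c a by (intro Z_swap[of a c]) auto
      ultimately have "Z (w a d)" using c d a by (intro Z_trans[of c a d]) auto
      then show False using d by auto
    qed
    have supp1: "Z (w a b)" if a: "a \<in> V" "\<not> m dvd deg a" and b: "b \<in> V" for a b
    proof (cases "m dvd deg b")
      case True
      obtain c where c: "c \<in> V" "\<not> m dvd deg c" "{c, b} \<in> E" using dominating[OF m b True] by blast
      have "Z (w c b)" using w_adjacent[OF c(1) b c(3)] Z_one by simp
      then show ?thesis using supp[OF c(1,2) a] a b c by (intro Z_trans[of c a b]) auto
    next
      case False
      then show ?thesis using supp a b by blast
    qed
    obtain c where c: "c \<in> V" "\<not> m dvd deg c" using dominating[OF m uv(1)] uv(1) by blast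
    have "Z (w u v)" using supp1[OF c uv(1)] supp1[OF c uv(2)] c uv by (intro Z_trans[of c u v]) auto
    then show False using I(3) by (auto simp: Z_def)
  qed
  then have "x u \<otimes> x v \<otimes> inv (x v \<otimes> x u) = \<one>"
    using uv x_closed by (simp add: one_M group_commutator_def word_simps)
  then show ?thesis using uv x_closed by (simp add: inv_solve_right')
qed

end

section \<open>The derived subgroups of a right-angled Artin group and of the kernel\<close>

lemma (in group) commute_inv:
  assumes "x \<in> carrier G" "y \<in> carrier G" "x \<otimes> y = y \<otimes> x" shows "inv x \<otimes> y = y \<otimes> inv x"
proof -
  have "inv x \<otimes> (x \<otimes> y) \<otimes> inv x = inv x \<otimes> (y \<otimes> x) \<otimes> inv x" by (simp add: assms(3))
  then show ?thesis using assms(1,2) by (simp add: m_assoc)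
qed

lemma (in group) commute_up_to_inverse:
  assumes xy: "x \<in> carrier G" "y \<in> carrier G" "x \<otimes> y = y \<otimes> x"
    and "x' = x \<or> x' = inv x" "y' = y \<or> y' = inv y"
  shows "x' \<otimes> y' = y' \<otimes> x'"
proof -
  have 1: "inv y \<otimes> x = x \<otimes> inv y" using commute_inv[OF xy(2,1) xy(3)[symmetric]] .
  have 2: "inv x \<otimes> y = y \<otimes> inv x" using commute_inv[OF xy] .
  have 3: "inv x \<otimes> inv y = inv y \<otimes> inv x" using commute_inv[OF xy(1) inv_closed[OF xy(2)] 1[symmetric]] .
  from assms(4,5) 1 2 3 xy(3) show ?thesis by metis
qed

lemma (in group) commute_iff_commutator:
  "\<lbrakk>x \<in> carrier G; y \<in> carrier G\<rbrakk> \<Longrightarrow> group_commutator G x y = \<one> \<longleftrightarrow> x \<otimes> y = y \<otimes> x"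
  by (simp add: group_commutator_def inv_solve_right')

lemma (in group) commutator_in_derived:
  "x \<in> S \<Longrightarrow> y \<in> S \<Longrightarrow> group_commutator G x y \<in> derived G S"
  unfolding derived_def group_commutator_def by (rule generate.incl) blast

text \<open>Centralizing the generators modulo \<open>M\<close> is a subgroup property, and so is then centralizing the
  whole group.\<close>

lemma (in group) derived_subset_if_generators_commute:
  assumes M: "M \<lhd> G" and A: "A \<subseteq> carrier G" and gen: "carrier G = generate G A"
    and c: "\<And>x y. x \<in> A \<Longrightarrow> y \<in> A \<Longrightarrow> group_commutator G x y \<in> M"
  shows "derived G (carrier G) \<subseteq> M"
proof -
  have sub: "subgroup M G" using M by (rule normal_imp_subgroup)
  let ?C = "\<lambda>S. {z \<in> carrier G. \<forall>x\<in>S. group_commutator G z x \<in> M}"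
  have "generate G A \<subseteq> ?C A"
    using A c by (intro generate_subgroup_incl subgroup_centralizing_modulo[OF M]) auto
  then have 1: "group_commutator G g x \<in> M" if "g \<in> carrier G" "x \<in> A" for g x
    using that gen by auto
  have "group_commutator G x g \<in> M" if "g \<in> carrier G" "x \<in> A" for g x
    using subgroup.m_inv_closed[OF sub 1[OF that]] that A by (simp add: inv_commutator subsetD)
  then have "generate G A \<subseteq> ?C (carrier G)"
    using A by (intro generate_subgroup_incl subgroup_centralizing_modulo[OF M]) auto
  then have "derived_set G (carrier G) \<subseteq> M" using gen by (auto simp: group_commutator_def)
  then show ?thesis unfolding derived_def by (rule generate_subgroup_incl[OF _ sub])
qed

lemma (in group_hom) hom_const_on_coset:
  assumes "M \<subseteq> kernel G H h" "x \<in> carrier G" "y \<in> M #> x" shows "h y = h x"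
proof -
  obtain m where m: "m \<in> M" "y = m \<otimes> x" using assms(3) by (auto simp: r_coset_def)
  then have "m \<in> carrier G" "h m = \<one>\<^bsub>H\<^esub>" using assms(1) by (auto simp: kernel_def)
  then show ?thesis using assms(2) m by simp
qed

lemma quotient_hom:
  assumes "group G" "group H" "h \<in> hom G H" and M: "M \<lhd> G" "M \<subseteq> kernel G H h"
    and h': "\<And>x. x \<in> carrier G \<Longrightarrow> h' (M #>\<^bsub>G\<^esub> x) = h x"
  shows "h' \<in> hom (G Mod M) H"
    and "kernel (G Mod M) H h' = (\<lambda>x. M #>\<^bsub>G\<^esub> x) ` kernel G H h"
    and "h' ` carrier (G Mod M) = h ` carrier G"
proof -
  interpret group_hom G H h using assms by (simp add: group_hom_def group_hom_axioms_def)
  interpret M: normal M G by fact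
  have car: "carrier (G Mod M) = (\<lambda>x. M #>\<^bsub>G\<^esub> x) ` carrier G"
    by (auto simp: FactGroup_def RCOSETS_def)
  have mult: "(M #>\<^bsub>G\<^esub> x) \<otimes>\<^bsub>G Mod M\<^esub> (M #>\<^bsub>G\<^esub> y) = M #>\<^bsub>G\<^esub> (x \<otimes>\<^bsub>G\<^esub> y)"
    if "x \<in> carrier G" "y \<in> carrier G" for x y
    using that by (simp add: FactGroup_def M.rcos_sum)
  show "h' \<in> hom (G Mod M) H"
    by (rule homI) (auto simp: car h' mult simp del: mult_FactGroup)
  show "kernel (G Mod M) H h' = (\<lambda>x. M #>\<^bsub>G\<^esub> x) ` kernel G H h"
    using h' by (auto simp: kernel_def car)
  show "h' ` carrier (G Mod M) = h ` carrier G"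
    using h' by (auto simp: car image_image)
qed

text \<open>In the quotient \<open>Q\<close> by the derived subgroup of the kernel, the kernel becomes abelian. The properties of
  the graph from \<open>support_dominating\<close> and \<open>support_connected\<close> make the vertex generators commute in
  \<open>Q\<close>, which means that \<open>Q\<close> is abelian.\<close>

theorem raag_derived_eq_derived_kernel:
  assumes \<chi>: "\<chi> \<in> epi (raag V E) integer_group"
    and triv: "trivial_H1_action (raag V E) (kernel (raag V E) integer_group \<chi>)"
  shows "derived (raag V E) (carrier (raag V E)) = derived (raag V E) (kernel (raag V E) integer_group \<chi>)"
proof -
  let ?G = "raag V E" and ?Z = integer_group and ?x = "vertex_gen V E"
  let ?K = "kernel ?G ?Z \<chi>"
  let ?D = "derived ?G ?K"
  have \<chi>h: "\<chi> \<in> hom ?G ?Z" using \<chi> by (simp add: epi_def)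
  interpret group_hom ?G ?Z \<chi>
    using \<chi>h group_raag[of V E] by (simp add: group_hom_def group_hom_axioms_def)
  have K: "?K \<lhd> ?G" by (rule normal_kernel)
  have D: "?D \<lhd> ?G" by (rule G.derived_is_normal[OF K])
  have DK: "?D \<subseteq> ?K" by (rule G.derived_incl[OF subset_refl subgroup_kernel])
  interpret D: normal ?D ?G by (rule D)
  let ?Q = "?G Mod ?D" and ?\<pi> = "\<lambda>g. ?D #>\<^bsub>?G\<^esub> g"
  interpret Q: group ?Q by (rule D.factorgroup_is_group)
  interpret \<pi>: group_hom ?G ?Q ?\<pi>
    using D.r_coset_hom_Mod by (simp add: group_hom_def group_hom_axioms_def G.group_axioms Q.group_axioms)
  have \<pi>_one: "?\<pi> g = \<one>\<^bsub>?Q\<^esub> \<longleftrightarrow> g \<in> ?D" if "g \<in> carrier ?G" for g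
    using that D.rcos_const[of g] G.rcos_self[OF that D.subgroup_axioms]
    by (auto simp: FactGroup_def D.rcos_const)
  note mult_FactGroup [simp del] one_FactGroup [simp del]
  have \<pi>_comm: "group_commutator ?Q (?\<pi> g) (?\<pi> h) = ?\<pi> (group_commutator ?G g h)"
    if "g \<in> carrier ?G" "h \<in> carrier ?G" for g h
    using that by (simp add: group_commutator_def)
  define \<chi>' where "\<chi>' A = \<chi> (SOME a. a \<in> A)" for A
  have \<chi>': "\<chi>' (?\<pi> g) = \<chi> g" if g: "g \<in> carrier ?G" for g
    unfolding \<chi>'_def
    using hom_const_on_coset[OF DK g] someI[of "\<lambda>a. a \<in> ?\<pi> g", OF G.rcos_self[OF g D.subgroup_axioms]] by blast
  note q = quotient_hom[of ?G ?Z \<chi> ?D \<chi>', OF G.group_axioms group_integer_group \<chi>h D DK \<chi>']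
  have abelian: "a \<otimes>\<^bsub>?Q\<^esub> b = b \<otimes>\<^bsub>?Q\<^esub> a" if ab: "a \<in> kernel ?Q ?Z \<chi>'" "b \<in> kernel ?Q ?Z \<chi>'" for a b
  proof -
    have "a \<in> ?\<pi> ` ?K" "b \<in> ?\<pi> ` ?K" using ab q(2) by (simp_all only:)
    then obtain g h where gh: "g \<in> ?K" "h \<in> ?K" "a = ?\<pi> g" "b = ?\<pi> h" by (elim imageE)
    then have c: "g \<in> carrier ?G" "h \<in> carrier ?G" by (auto simp: kernel_def)
    have "group_commutator ?G g h \<in> ?D" using gh by (intro G.commutator_in_derived)
    then have "group_commutator ?Q a b = \<one>\<^bsub>?Q\<^esub>"
      unfolding gh(3,4) \<pi>_comm[OF c] by (simp only: \<pi>_one[OF G.commutator_closed[OF c]])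
    then show ?thesis using gh c by (simp add: Q.commute_iff_commutator)
  qed
  obtain t where t: "t \<in> carrier ?G" "\<chi> t = 1"
  proof -
    have "1 \<in> \<chi> ` carrier ?G" using \<chi> by (simp add: epi_def)
    then show ?thesis using that by auto
  qed
  have xc: "?x v \<in> carrier ?G" if "v \<in> V" for v using that by (rule vertex_gen_closed)
  \<comment> \<open>quantum integers are defined for nonnegative degrees only, so generators of negative degree
    are replaced by their inverses\<close>
  define y where "y v = (if \<chi> (?x v) \<ge> 0 then ?\<pi> (?x v) else inv\<^bsub>?Q\<^esub> ?\<pi> (?x v))" for v
  have deg: "m dvd nat \<bar>\<chi> (?x v)\<bar> \<longleftrightarrow> int m dvd \<chi> (?x v)" for m v
    by (simp add: nat_dvd_iff int_dvd_int_iff flip: int_dvd_int_iff)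
  have CG: "cyclic_by_abelian_graph ?Q \<chi>' (?\<pi> t) V E y (\<lambda>v. nat \<bar>\<chi> (?x v)\<bar>)"
  proof (intro cyclic_by_abelian_graph.intro cyclic_by_abelian.intro cyclic_by_abelian_axioms.intro
      cyclic_by_abelian_graph_axioms.intro)
    show "group ?Q" by (rule Q.group_axioms)
    show "\<chi>' \<in> hom ?Q ?Z" by (rule q(1))
    show "a \<otimes>\<^bsub>?Q\<^esub> b = b \<otimes>\<^bsub>?Q\<^esub> a" if "a \<in> kernel ?Q ?Z \<chi>'" "b \<in> kernel ?Q ?Z \<chi>'" for a b
      using that by (rule abelian)
    show "?\<pi> t \<in> carrier ?Q" "\<chi>' (?\<pi> t) = 1" using t by (simp_all add: \<chi>')
    show yc: "y v \<in> carrier ?Q" if "v \<in> V" for v using xc[OF that] by (simp add: y_def)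
    show "\<chi>' (y v) = int (nat \<bar>\<chi> (?x v)\<bar>)" if "v \<in> V" for v
    proof -
      have "\<chi>' (inv\<^bsub>?Q\<^esub> ?\<pi> (?x v)) = - \<chi> (?x v)"
        using xc[OF that] \<chi>'[of "inv\<^bsub>?G\<^esub> ?x v"] by simp
      then show ?thesis using xc[OF that] by (simp add: y_def \<chi>')
    qed
    show "y u \<otimes>\<^bsub>?Q\<^esub> y v = y v \<otimes>\<^bsub>?Q\<^esub> y u" if uv: "u \<in> V" "v \<in> V" "{u, v} \<in> E" for u v
    proof -
      have "?\<pi> (?x u) \<otimes>\<^bsub>?Q\<^esub> ?\<pi> (?x v) = ?\<pi> (?x v) \<otimes>\<^bsub>?Q\<^esub> ?\<pi> (?x u)"
        using vertex_gen_commute[OF uv] xc uv by (metis \<pi>.hom_mult)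
      then show ?thesis
        by (rule Q.commute_up_to_inverse[OF \<pi>.hom_closed[OF xc[OF uv(1)]] \<pi>.hom_closed[OF xc[OF uv(2)]]])
           (simp_all add: y_def)
    qed
    show "\<exists>u\<in>V. \<not> m dvd nat \<bar>\<chi> (?x u)\<bar> \<and> {u, v} \<in> E"
      if "m \<noteq> 1" "v \<in> V" "m dvd nat \<bar>\<chi> (?x v)\<bar>" for m v
      using support_dominating[OF \<chi> triv that(1,2)] that(3) unfolding deg by blast
    show "\<exists>a\<in>S. \<exists>b\<in>V - S. \<not> m dvd nat \<bar>\<chi> (?x b)\<bar> \<and> {a, b} \<in> E"
      if "m \<noteq> 1" "S \<subseteq> V" "\<And>a. a \<in> S \<Longrightarrow> \<not> m dvd nat \<bar>\<chi> (?x a)\<bar>" "a \<in> S" "b \<in> V - S"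
        "\<not> m dvd nat \<bar>\<chi> (?x b)\<bar>" for m S a b
      using support_connected[OF \<chi> triv that(1,2) _ that(4,5)] that(3,6) unfolding deg by blast
  qed
  have "group_commutator ?G (?x u) (?x v) \<in> ?D" if uv: "u \<in> V" "v \<in> V" for u v
  proof -
    have y: "?\<pi> (?x v) = y v \<or> ?\<pi> (?x v) = inv\<^bsub>?Q\<^esub> y v" "y v \<in> carrier ?Q" if "v \<in> V" for v
      using xc[OF that] by (simp_all add: y_def)
    have "y u \<otimes>\<^bsub>?Q\<^esub> y v = y v \<otimes>\<^bsub>?Q\<^esub> y u" by (rule cyclic_by_abelian_graph.generators_commute[OF CG uv])
    then have "?\<pi> (?x u) \<otimes>\<^bsub>?Q\<^esub> ?\<pi> (?x v) = ?\<pi> (?x v) \<otimes>\<^bsub>?Q\<^esub> ?\<pi> (?x u)"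
      by (rule Q.commute_up_to_inverse[OF y(2)[OF uv(1)] y(2)[OF uv(2)] _ y(1)[OF uv(1)] y(1)[OF uv(2)]])
    then have "?\<pi> (group_commutator ?G (?x u) (?x v)) = \<one>\<^bsub>?Q\<^esub>"
      using xc[OF uv(1)] xc[OF uv(2)] by (simp add: Q.commute_iff_commutator flip: \<pi>_comm)
    then show ?thesis by (simp only: \<pi>_one[OF G.commutator_closed[OF xc[OF uv(1)] xc[OF uv(2)]]])
  qed
  then have "derived ?G (carrier ?G) \<subseteq> ?D"
    using raag_generated[of V E] xc
    by (intro G.derived_subset_if_generators_commute[OF D, of "?x ` V"]) auto
  moreover have "?D \<subseteq> derived ?G (carrier ?G)"
    by (rule G.mono_derived) (auto simp: kernel_def)
  ultimately show ?thesis by blast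
qed

section \<open>Maximal metabelian quotients\<close>

context
  fixes G :: "('a, 'm) monoid_scheme" (structure) and \<chi> and K and N :: "('a, 'm) monoid_scheme"
  assumes G: "group G" and \<chi>: "\<chi> \<in> epi G integer_group"
    and K_def: "K = kernel G integer_group \<chi>" and N_def: "N = G\<lparr>carrier := K\<rparr>"
    and derived_eq: "derived G (carrier G) = derived G K"
begin

interpretation group G by (rule G)

interpretation \<chi>: group_hom G integer_group \<chi>
  using \<chi> G by (simp add: group_hom_def group_hom_axioms_def epi_def)

lemma kernel_subgroup: "subgroup K G"
  unfolding K_def by (rule \<chi>.subgroup_kernel)

lemma second_derived_kernel: "second_derived N = second_derived G"
proof -
  have "derived G K \<subseteq> K" by (rule derived_incl[OF subset_refl kernel_subgroup])
  then have "derived N (derived N K) = derived G (derived G K)"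
    unfolding N_def using derived_consistent[OF _ kernel_subgroup] by simp
  then show ?thesis by (simp add: second_derived_def derived_eq) (simp add: N_def)
qed

lemma second_derived_normal: "second_derived G \<lhd> G"
  unfolding second_derived_def by (intro derived_is_normal derived_self_is_normal)

lemma second_derived_subset_kernel: "second_derived G \<subseteq> K"
proof -
  have "derived G K \<subseteq> K" by (rule derived_incl[OF subset_refl kernel_subgroup])
  then show ?thesis
    unfolding second_derived_def derived_eq by (rule derived_incl[OF _ kernel_subgroup])
qed

text \<open>The second derived subgroups of \<open>N\<close> and \<open>G\<close> coincide, so the cosets forming \<open>N/N''\<close> are some of the
  cosets forming \<open>G/G''\<close>. This equality of groups lets \<open>split_exact_gr\<close> apply to \<open>G/G''\<close>.\<close>

lemma max_metabelian_kernel: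
  "max_metabelian N = (max_metabelian G)\<lparr>carrier := (\<lambda>x. second_derived G #> x) ` K\<rparr>"
  unfolding max_metabelian_def second_derived_kernel
  by (auto simp: FactGroup_def RCOSETS_def r_coset_def set_mult_def N_def fun_eq_iff)

theorem split_exact_gr_max_metabelian:
  "split_exact_graded_lie
     (gr (max_metabelian N))
     (gr_map (max_metabelian G) (max_metabelian_map G id))
     (gr (max_metabelian G))
     (gr_map integer_group (the_elem \<circ> max_metabelian_map integer_group \<chi>))
     (gr integer_group)"
proof -
  let ?Z = integer_group and ?S = "second_derived G" and ?M = "max_metabelian G"
  let ?h = "the_elem \<circ> max_metabelian_map ?Z \<chi>" and ?\<pi> = "\<lambda>x. ?S #> x"
  have \<chi>h: "\<chi> \<in> hom G ?Z" using \<chi> by (simp add: epi_def)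
  interpret S: normal ?S G by (rule second_derived_normal)
  have M: "group ?M" unfolding max_metabelian_def by (rule S.factorgroup_is_group)
  have SZ: "second_derived ?Z = {0}"
    unfolding second_derived_def
    using comm_group.derived_eq_singleton[OF abelian_integer_group] by simp
  have h: "?h (?\<pi> g) = \<chi> g" if g: "g \<in> carrier G" for g
  proof -
    have "(\<Union>x\<in>?\<pi> g. {0} #>\<^bsub>?Z\<^esub> \<chi> x) = (\<Union>x\<in>?\<pi> g. {\<chi> g})"
      using \<chi>.hom_const_on_coset[OF _ g, of ?S] second_derived_subset_kernel
      by (auto simp: r_coset_def K_def)
    also have "\<dots> = {\<chi> g}" using rcos_self[OF g S.subgroup_axioms] by blast
    finally show ?thesis by (simp add: max_metabelian_map_def coset_map_def SZ)
  qed
  note q = quotient_hom[of G ?Z \<chi> ?S ?h, OF G group_integer_group \<chi>h second_derived_normal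
      second_derived_subset_kernel[unfolded K_def] h, folded max_metabelian_def, folded K_def]
  interpret \<pi>: group_hom G ?M ?\<pi>
    using S.r_coset_hom_Mod M G by (simp add: group_hom_def group_hom_axioms_def max_metabelian_def)
  interpret h: group_hom ?M ?Z ?h
    by (intro group_hom.intro group_hom_axioms.intro M group_integer_group q(1))
  have "?h ` carrier ?M = carrier ?Z" using q(3) \<chi> by (simp only: epi_def mem_Collect_eq)
  then have epi: "?h \<in> epi ?M ?Z" using q(1) unfolding epi_def by blast
  have car: "carrier ?M = ?\<pi> ` carrier G"
    by (auto simp: max_metabelian_def FactGroup_def RCOSETS_def)
  have der: "derived ?M (carrier ?M) = derived ?M (?\<pi> ` K)"
    unfolding car using \<pi>.derived_img[OF subset_refl] \<pi>.derived_img[OF subgroup.subset[OF kernel_subgroup]]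
      derived_eq by simp
  have id: "max_metabelian_map G id A = A" if A: "A \<in> ?\<pi> ` K" for A
  proof -
    obtain x where x: "x \<in> carrier G" "A = ?\<pi> x" using A subgroup.subset[OF kernel_subgroup] by auto
    have "(\<Union>y\<in>?\<pi> x. ?\<pi> y) = (\<Union>y\<in>?\<pi> x. ?\<pi> x)"
      using repr_independence[OF _ x(1) S.subgroup_axioms] by simp
    also have "\<dots> = ?\<pi> x" using rcos_self[OF x(1) S.subgroup_axioms] by blast
    finally show ?thesis by (simp add: max_metabelian_map_def coset_map_def x(2))
  qed
  show ?thesis
    unfolding max_metabelian_kernel
    by (rule split_exact_gr[OF M _ der epi q(2)[symmetric] id]) (use h.normal_kernel q(2) in simp)
qed

end

theorem proposition9p2:
  fixes V :: "'v set" and E :: "'v set set" and \<chi> :: "'v word set \<Rightarrow> int"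
  defines "G \<equiv> raag V E"
  defines "K \<equiv> kernel G integer_group \<chi>"
  defines "N \<equiv> G\<lparr>carrier := K\<rparr>"
  assumes "finite V" and "simple_graph V E"
    and "\<chi> \<in> epi G integer_group"
    and "trivial_H1_action G K"
  shows "split_exact_graded_lie
           (gr N) (gr_map G id) (gr G) (gr_map integer_group \<chi>) (gr integer_group) \<and>
         split_exact_graded_lie
           (gr (max_metabelian N))
           (gr_map (max_metabelian G) (max_metabelian_map G id))
           (gr (max_metabelian G))
           (gr_map integer_group (the_elem \<circ> max_metabelian_map integer_group \<chi>))
           (gr integer_group)"
proof
  have G: "group G" unfolding G_def by (rule group_raag)
  have K: "K \<lhd> G"
    using G assms(6) unfolding K_def
    by (intro group_hom.normal_kernel) (simp add: group_hom_def group_hom_axioms_def epi_def)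
  have der: "derived G (carrier G) = derived G K"
    using raag_derived_eq_derived_kernel assms(6,7) unfolding G_def K_def by blast
  show "split_exact_graded_lie
      (gr N) (gr_map G id) (gr G) (gr_map integer_group \<chi>) (gr integer_group)"
    unfolding N_def
    by (rule split_exact_gr[OF G K der assms(6)]) (simp_all add: K_def)
  show "split_exact_graded_lie
           (gr (max_metabelian N))
           (gr_map (max_metabelian G) (max_metabelian_map G id))
           (gr (max_metabelian G))
           (gr_map integer_group (the_elem \<circ> max_metabelian_map integer_group \<chi>))
           (gr integer_group)"
    by (rule split_exact_gr_max_metabelian[OF G assms(6) K_def[THEN meta_eq_to_obj_eq]
          N_def[THEN meta_eq_to_obj_eq] der])
qed

end
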